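(* Let $G$ be a group acting on a CAT(0) cube complex $X$ and $A \leq G$ a normal finitely generated abelian subgroup. Then there exist a finite-index subgroup $H \leq G$ containing $A$ and a median subalgebra $Y \subset X$ which is $H$-invariant and which decomposes as a product $T \times F \times Q$ of median algebras $T,F,Q$ such that: (1) $H \curvearrowright Y$ decomposes as a product of actions $H \curvearrowright T$, $H \curvearrowright F$, $H \curvearrowright Q$; (2) $F$ is a median flat or a single point; (3) $Q$ is a finite-dimensional cube; (4) $A$ acts trivially on $T$.
   Context: A CAT(0) cube complex $X$ (possibly infinite-dimensional) is identified with its one-skeleton: $x\in X$ means that $x$ is a vertex, with the graph metric $d$. Groups act by cubical automorphisms (isometries). Every triple of vertices $x,y,z$ has a unique median point $\mu(x,y,z)$, the unique vertex lying on a geodesic between any two of $x,y,z$. A median subalgebra of $X$ is a set of vertices stable under $\mu$. Median algebras. A median algebra is a set $M$ with a map $\mu:M^3\to M$ such that $\mu(x,y,y)=y$, $\mu(x,y,z)=\mu(z,x,y)=\mu(x,z,y)$ and $\mu(\mu(x,w,y),w,z)=\mu(x,w,\mu(y,w,z))$. The interval is $I(x,y)=\{z : \mu(x,y,z)=z\}$; $C\subset M$ is convex if $I(x,y)\subset C$ for all $x,y\in C$; $M$ is discrete if all intervals are finite. A halfspace of $M$ is a subset $D$ with $D$ and $D^c$ convex (and non-empty), and $\{D,D^c\}$ is a wall. If $M$ is discrete, any two points are separated by finitely many walls, and the cubulation of $M$ is the CAT(0) cube complex with vertex-set $M$, edges joining points separated by exactly one wall, and $n$-cubes filling in all one-skeleta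 of $n$-cubes. The dimension of $M$ is that of its cubulation. An orientation is a set $\sigma$ of halfspaces containing exactly one halfspace of each wall and such that $A\in\sigma$, $A\subset B$ imply $B\in\sigma$. The Roller compactification $\overline M$ is the set of all orientations, $M$ embeds in it via $x\mapsto\{\text{halfspaces containing }x\}$, the Roller boundary is $\mathfrak{R}M=\overline M\setminus M$, and $\overline M$ is a median algebra with $\mu(\sigma_1,\sigma_2,\sigma_3)=\{\text{halfspaces belonging to at least two of the }\sigma_i\}$. A median flat is a non-empty, finite-dimensional, discrete median algebra $M$ for which there exist $\zeta,\xi\in\mathfrak{R}M$ with $M\subset I(\zeta,\xi)$. A finite-dimensional cube is the median algebra $\{0,1\}^k$, $0\le k<\infty$ (coordinatewise majority). Decomposing as a product means being isomorphic, as a median algebra, to the product with coordinatewise median. The action decomposes as a product of actions if $h\cdot(t,f,q)=(h\cdot t,h\cdot f,h\cdot q)$ for actions on the factors by median automorphisms. *)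

theory Defs
  imports "HOL-Algebra.Group_Action" "HOL-Algebra.Generated_Groups"
begin

section \<open>CAT(0) cube complexes\<close>

text \<open>
  A cube is recorded by its vertex set. The vertex set \<open>{0,1}\<^sup>n\<close> of the standard \<open>n\<close>-cube is
  represented by \<open>Pow {..<n}\<close> (characteristic functions), so that its faces are the order
  intervals \<open>{S. L \<subseteq> S \<and> S \<subseteq> U}\<close>.
\<close>

record 'a cube_complex =
  verts :: "'a set"
  cubes :: "'a set set"

definition cube_faces :: "nat \<Rightarrow> nat set set set" where
  "cube_faces n = {{S. L \<subseteq> S \<and> S \<subseteq> U} | L U. L \<subseteq> U \<and> U \<subseteq> {..<n}}"

text \<open>
  Cubes are embedded and two cubes meet in a common face or not at all, as in
  Bridson and Haefliger's definition of a cubical complex. The dimension may be infinite.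
\<close>

definition cube_complex :: "'a cube_complex \<Rightarrow> bool" where
  "cube_complex X \<longleftrightarrow>
     (\<forall>v\<in>verts X. {v} \<in> cubes X) \<and>
     (\<forall>C\<in>cubes X. C \<subseteq> verts X \<and>
        (\<exists>n f. bij_betw f (Pow {..<n}) C \<and> {D \<in> cubes X. D \<subseteq> C} = (\<lambda>P. f ` P) ` cube_faces n)) \<and>
     (\<forall>C\<in>cubes X. \<forall>D\<in>cubes X. C \<inter> D = {} \<or> C \<inter> D \<in> cubes X)"

definition adj :: "'a cube_complex \<Rightarrow> 'a \<Rightarrow> 'a \<Rightarrow> bool" where
  "adj X x y \<longleftrightarrow> x \<noteq> y \<and> {x, y} \<in> cubes X"

definition edge_path :: "'a cube_complex \<Rightarrow> 'a \<Rightarrow> 'a list \<Rightarrow> 'a \<Rightarrow> bool" where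
  "edge_path X x p y \<longleftrightarrow>
     p \<noteq> [] \<and> hd p = x \<and> last p = y \<and> set p \<subseteq> verts X \<and> successively (adj X) p"

text \<open>
  The generating moves of homotopy of edge-paths in the two-skeleton. Triviality of the resulting
  edge-path group is simple connectedness, since the fundamental group of a cube complex is the
  edge-path group of its two-skeleton.
\<close>

inductive elem_homotopy :: "'a cube_complex \<Rightarrow> 'a list \<Rightarrow> 'a list \<Rightarrow> bool" for X where
  backtrack: "adj X x y \<Longrightarrow> elem_homotopy X (p @ [x, y, x] @ q) (p @ [x] @ q)"
| square: "\<lbrakk>{x, y, z, w} \<in> cubes X; distinct [x, y, z, w];
            adj X x y; adj X y z; adj X z w; adj X w x\<rbrakk>
           \<Longrightarrow> elem_homotopy X (p @ [x, y, z] @ q) (p @ [x, w, z] @ q)"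

definition simply_connected_complex :: "'a cube_complex \<Rightarrow> bool" where
  "simply_connected_complex X \<longleftrightarrow>
     verts X \<noteq> {} \<and>
     (\<forall>x\<in>verts X. \<forall>y\<in>verts X. \<exists>p. edge_path X x p y) \<and>
     (\<forall>x p. edge_path X x p x \<longrightarrow> equivclp (elem_homotopy X) p [x])"

text \<open>
  A vertex of the link of \<open>v\<close> is an edge at \<open>v\<close>, recorded by its other endpoint; each cube
  containing \<open>v\<close> contributes the simplex of its edges at \<open>v\<close>.
\<close>

definition link :: "'a cube_complex \<Rightarrow> 'a \<Rightarrow> 'a set set" where
  "link X v = {{w \<in> C. adj X v w} | C. C \<in> cubes X \<and> v \<in> C}"

definition flag :: "'a set set \<Rightarrow> bool" where
  "flag K \<longleftrightarrow> (\<forall>S. finite S \<and> S \<subseteq> \<Union>K \<and> (\<forall>a\<in>S. \<forall>b\<in>S. {a, b} \<in> K) \<longrightarrow> S \<in> K)"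

definition CAT0_cube_complex :: "'a cube_complex \<Rightarrow> bool" where
  "CAT0_cube_complex X \<longleftrightarrow>
     cube_complex X \<and> simply_connected_complex X \<and> (\<forall>v\<in>verts X. flag (link X v))"

text \<open>An \<open>n\<close>-cube has \<open>2 ^ n\<close> vertices.\<close>

definition finite_dimensional :: "'a cube_complex \<Rightarrow> bool" where
  "finite_dimensional X \<longleftrightarrow> (\<exists>N::nat. \<forall>C\<in>cubes X. card C \<le> 2 ^ N)"

definition geodesic :: "'a cube_complex \<Rightarrow> 'a \<Rightarrow> 'a list \<Rightarrow> 'a \<Rightarrow> bool" where
  "geodesic X x p y \<longleftrightarrow> edge_path X x p y \<and> (\<forall>q. edge_path X x q y \<longrightarrow> length p \<le> length q)"

definition on_geodesic :: "'a cube_complex \<Rightarrow> 'a \<Rightarrow> 'a \<Rightarrow> 'a \<Rightarrow> bool" where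
  "on_geodesic X x y m \<longleftrightarrow> (\<exists>p. geodesic X x p y \<and> m \<in> set p)"

definition vertex_median :: "'a cube_complex \<Rightarrow> 'a \<Rightarrow> 'a \<Rightarrow> 'a \<Rightarrow> 'a" where
  "vertex_median X x y z =
     (THE m. on_geodesic X x y m \<and> on_geodesic X y z m \<and> on_geodesic X x z m)"

definition cubical_action ::
    "('g, 'b) monoid_scheme \<Rightarrow> 'a cube_complex \<Rightarrow> ('g \<Rightarrow> 'a \<Rightarrow> 'a) \<Rightarrow> bool" where
  "cubical_action G X \<phi> \<longleftrightarrow>
     group_action G (verts X) \<phi> \<and> (\<forall>g\<in>carrier G. \<forall>C\<in>cubes X. \<phi> g ` C \<in> cubes X)"

section \<open>Median algebras\<close>

record 'a med_alg = "'a partial_object" +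
  med :: "'a \<Rightarrow> 'a \<Rightarrow> 'a \<Rightarrow> 'a"

definition median_algebra :: "'a med_alg \<Rightarrow> bool" where
  "median_algebra M \<longleftrightarrow>
     (\<forall>x\<in>carrier M. \<forall>y\<in>carrier M. \<forall>z\<in>carrier M. med M x y z \<in> carrier M) \<and>
     (\<forall>x\<in>carrier M. \<forall>y\<in>carrier M. med M x y y = y) \<and>
     (\<forall>x\<in>carrier M. \<forall>y\<in>carrier M. \<forall>z\<in>carrier M.
        med M x y z = med M z x y \<and> med M x y z = med M x z y) \<and>
     (\<forall>x\<in>carrier M. \<forall>y\<in>carrier M. \<forall>z\<in>carrier M. \<forall>w\<in>carrier M.
        med M (med M x w y) w z = med M x w (med M y w z))"

definition vertex_alg :: "'a cube_complex \<Rightarrow> 'a med_alg" where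
  "vertex_alg X = \<lparr>carrier = verts X, med = vertex_median X\<rparr>"

definition median_subalgebra :: "'a set \<Rightarrow> 'a med_alg \<Rightarrow> bool" where
  "median_subalgebra Y M \<longleftrightarrow>
     Y \<subseteq> carrier M \<and> (\<forall>x\<in>Y. \<forall>y\<in>Y. \<forall>z\<in>Y. med M x y z \<in> Y)"

definition med_iso :: "'a med_alg \<Rightarrow> 'b med_alg \<Rightarrow> ('a \<Rightarrow> 'b) set" where
  "med_iso M N = {f. bij_betw f (carrier M) (carrier N) \<and>
     (\<forall>x\<in>carrier M. \<forall>y\<in>carrier M. \<forall>z\<in>carrier M. f (med M x y z) = med N (f x) (f y) (f z))}"

definition med_prod :: "'a med_alg \<Rightarrow> 'b med_alg \<Rightarrow> ('a \<times> 'b) med_alg" (infixr "\<times>\<^sub>m" 80) where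
  "M \<times>\<^sub>m N = \<lparr>carrier = carrier M \<times> carrier N,
     med = (\<lambda>x y z. (med M (fst x) (fst y) (fst z), med N (snd x) (snd y) (snd z)))\<rparr>"

definition med_action ::
    "('g, 'b) monoid_scheme \<Rightarrow> 'a med_alg \<Rightarrow> ('g \<Rightarrow> 'a \<Rightarrow> 'a) \<Rightarrow> bool" where
  "med_action G M \<psi> \<longleftrightarrow> group_action G (carrier M) \<psi> \<and> (\<forall>g\<in>carrier G. \<psi> g \<in> med_iso M M)"

text \<open>Coordinatewise majority on \<open>{0,1}\<^sup>k\<close>, again with points represented as subsets of \<open>{..<k}\<close>.\<close>

definition cube_alg :: "nat \<Rightarrow> nat set med_alg" where
  "cube_alg k = \<lparr>carrier = Pow {..<k}, med = (\<lambda>x y z. (x \<inter> y) \<union> (y \<inter> z) \<union> (x \<inter> z))\<rparr>"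

definition finite_dim_cube :: "'a med_alg \<Rightarrow> bool" where
  "finite_dim_cube M \<longleftrightarrow> (\<exists>k. med_iso M (cube_alg k) \<noteq> {})"

definition med_interval :: "'a med_alg \<Rightarrow> 'a \<Rightarrow> 'a \<Rightarrow> 'a set" where
  "med_interval M x y = {z \<in> carrier M. med M x y z = z}"

definition med_convex :: "'a med_alg \<Rightarrow> 'a set \<Rightarrow> bool" where
  "med_convex M C \<longleftrightarrow> C \<subseteq> carrier M \<and> (\<forall>x\<in>C. \<forall>y\<in>C. med_interval M x y \<subseteq> C)"

definition med_discrete :: "'a med_alg \<Rightarrow> bool" where
  "med_discrete M \<longleftrightarrow> (\<forall>x\<in>carrier M. \<forall>y\<in>carrier M. finite (med_interval M x y))"

definition halfspaces :: "'a med_alg \<Rightarrow> 'a set set" where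
  "halfspaces M = {D. med_convex M D \<and> med_convex M (carrier M - D) \<and>
                      D \<noteq> {} \<and> carrier M - D \<noteq> {}}"

definition walls :: "'a med_alg \<Rightarrow> 'a set set set" where
  "walls M = {{D, carrier M - D} | D. D \<in> halfspaces M}"

definition wall_separates :: "'a set set \<Rightarrow> 'a \<Rightarrow> 'a \<Rightarrow> bool" where
  "wall_separates W x y \<longleftrightarrow> (\<exists>D\<in>W. x \<in> D \<and> y \<notin> D)"

definition wall_adj :: "'a med_alg \<Rightarrow> 'a \<Rightarrow> 'a \<Rightarrow> bool" where
  "wall_adj M x y \<longleftrightarrow> (\<exists>!W. W \<in> walls M \<and> wall_separates W x y)"

definition cubulation :: "'a med_alg \<Rightarrow> 'a cube_complex" where
  "cubulation M = \<lparr>verts = carrier M,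
     cubes = {C. C \<subseteq> carrier M \<and> (\<exists>(n::nat) f. bij_betw f (Pow {..<n}) C \<and>
       (\<forall>S\<in>Pow {..<n}. \<forall>T\<in>Pow {..<n}.
          wall_adj M (f S) (f T) \<longleftrightarrow> card ((S - T) \<union> (T - S)) = 1))}\<rparr>"

definition orientation :: "'a med_alg \<Rightarrow> 'a set set \<Rightarrow> bool" where
  "orientation M \<sigma> \<longleftrightarrow>
     \<sigma> \<subseteq> halfspaces M \<and>
     (\<forall>W\<in>walls M. \<exists>!D. D \<in> W \<and> D \<in> \<sigma>) \<and>
     (\<forall>D\<in>\<sigma>. \<forall>E\<in>halfspaces M. D \<subseteq> E \<longrightarrow> E \<in> \<sigma>)"

definition roller_compactification :: "'a med_alg \<Rightarrow> 'a set set med_alg" where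
  "roller_compactification M = \<lparr>carrier = {\<sigma>. orientation M \<sigma>},
     med = (\<lambda>\<sigma>\<^sub>1 \<sigma>\<^sub>2 \<sigma>\<^sub>3. (\<sigma>\<^sub>1 \<inter> \<sigma>\<^sub>2) \<union> (\<sigma>\<^sub>2 \<inter> \<sigma>\<^sub>3) \<union> (\<sigma>\<^sub>1 \<inter> \<sigma>\<^sub>3))\<rparr>"

definition principal_orientation :: "'a med_alg \<Rightarrow> 'a \<Rightarrow> 'a set set" where
  "principal_orientation M x = {D \<in> halfspaces M. x \<in> D}"

definition roller_boundary :: "'a med_alg \<Rightarrow> 'a set set set" where
  "roller_boundary M =
     carrier (roller_compactification M) - principal_orientation M ` carrier M"

definition median_flat :: "'a med_alg \<Rightarrow> bool" where
  "median_flat M \<longleftrightarrow>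
     median_algebra M \<and> carrier M \<noteq> {} \<and> med_discrete M \<and> finite_dimensional (cubulation M) \<and>
     (\<exists>\<zeta>\<in>roller_boundary M. \<exists>\<xi>\<in>roller_boundary M.
        principal_orientation M ` carrier M \<subseteq> med_interval (roller_compactification M) \<zeta> \<xi>)"

section \<open>Subgroups\<close>

definition fin_gen_abelian_subgroup :: "'g set \<Rightarrow> ('g, 'b) monoid_scheme \<Rightarrow> bool" where
  "fin_gen_abelian_subgroup A G \<longleftrightarrow>
     subgroup A G \<and> comm_group (G\<lparr>carrier := A\<rparr>) \<and>
     (\<exists>S. finite S \<and> S \<subseteq> carrier G \<and> generate G S = A)"

definition finite_index_subgroup :: "'g set \<Rightarrow> ('g, 'b) monoid_scheme \<Rightarrow> bool" where
  "finite_index_subgroup H G \<longleftrightarrow> subgroup H G \<and> finite (rcosets\<^bsub>G\<^esub> H)"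

end

theory Submission imports Defs begin

text \<open>
  Square moves on edge-paths of \<open>X\<close> satisfy an exchange property, which the flag condition provides through
  3-cubes. Hence every homotopy class of paths has a reduced representative that is unique up to square moves,
  so the 1-skeleton is bipartite and satisfies the quadrangle condition; this makes it a median graph whose
  halfspaces separate points and of which only finitely many separate two given points.

  For \<open>a \<in> A\<close>, a halfspace is either \<open>a\<close>-periodic, or contains both ends of every \<open>a\<close>-orbit (or its
  complement does), or is crossed by every \<open>a\<close>-orbit. Consider the points that lie in all halfspaces of the
  second kind, cross those of the third kind monotonically under \<open>a\<^sup>N\<close> for a fixed \<open>N\<close>, and
  whose \<open>A\<close>-orbit is split by the fewest periodic halfspaces. They form a \<open>G\<close>-invariant median
  subalgebra \<open>Y\<close>, so one may take \<open>H = G\<close>. The halfspaces cutting \<open>Y\<close> fall into three \<open>G\<close>-invariant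
  classes, with mutually transverse traces: those crossed by some \<open>a \<in> A\<close>, giving \<open>F\<close>; the periodic ones that
  split \<open>A\<close>-orbits, giving \<open>Q\<close>; and those with \<open>A\<close>-invariant trace, giving \<open>T\<close>. An element of \<open>A\<close> that is
  periodic on no halfspace of the first class has an axis in \<open>F\<close> whose two ends span \<open>F\<close>.
\<close>

section \<open>Edge-paths up to square moves\<close>

text \<open>An orbit of \<open>a\<close> may cross a skewered halfspace back and forth before it
  settles, and then it would not run along a geodesic of \<open>F\<close>; monotonicity under
  \<open>a [^] N\<close> excludes this. One \<open>N\<close> for all of \<open>A\<close> keeps the
  condition invariant under conjugation by \<open>G\<close>, so no passage to a smaller group is
  needed. It exists because, up to translation by \<open>A\<close>, only finitely many halfspaces
  split an orbit, and because a fixed power of every element of \<open>A\<close> moves a skewered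
  halfspace like some power of one element.

  Taking the fewest splitting halfspaces is what makes \<open>Q\<close> a cube. It forces them to be
  the same for all points of \<open>Y\<close>, and none of them can contain more than half of the
  patterns that the points of an orbit show on them: otherwise Helly's theorem would give a point of
  \<open>Y\<close> whose orbit it does not split. As complements are included, each contains exactly
  half, so nested ones coincide on \<open>Y\<close>, and Helly's theorem realises every choice of
  sides.\<close>

definition square :: "'a cube_complex \<Rightarrow> 'a \<Rightarrow> 'a \<Rightarrow> 'a \<Rightarrow> 'a \<Rightarrow> bool" where
  "square X x y z w \<longleftrightarrow> {x, y, z, w} \<in> cubes X \<and> distinct [x, y, z, w] \<and>
     adj X x y \<and> adj X y z \<and> adj X z w \<and> adj X w x"

lemma adj_sym: "adj X x y \<Longrightarrow> adj X y x"
  by (metis adj_def insert_commute)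

lemma square_rot: "square X x y z w \<Longrightarrow> square X y z w x"
proof -
  have "{y, z, w, x} = {x, y, z, w}" by blast
  then show "square X x y z w \<Longrightarrow> square X y z w x" unfolding square_def by auto
qed

lemma square_flip:
  assumes "square X x y z w"
  shows "square X x w z y"
proof -
  have "{x, w, z, y} = {x, y, z, w}" by blast
  moreover have "adj X x w" "adj X w z" "adj X z y" "adj X y x" "distinct [x, w, z, y]"
    using assms unfolding square_def by (auto intro: adj_sym)
  ultimately show ?thesis using assms unfolding square_def by simp
qed

definition square_move :: "'a cube_complex \<Rightarrow> 'a list \<Rightarrow> 'a list \<Rightarrow> bool" where
  "square_move X p q \<longleftrightarrow>
     (\<exists>l m x y z w. p = l @ [x, y, z] @ m \<and> q = l @ [x, w, z] @ m \<and> square X x y z w)"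

abbreviation sw :: "'a cube_complex \<Rightarrow> 'a list \<Rightarrow> 'a list \<Rightarrow> bool" where
  "sw X \<equiv> (square_move X)\<^sup>*\<^sup>*"

lemma square_moveI: "square X x y z w \<Longrightarrow> square_move X (l @ [x, y, z] @ m) (l @ [x, w, z] @ m)"
  unfolding square_move_def by blast

lemma square_move_sym: "square_move X p q \<Longrightarrow> square_move X q p"
  unfolding square_move_def by (blast intro: square_flip)

lemma sw_sym: "sw X p q \<Longrightarrow> sw X q p"
  by (induction rule: rtranclp_induct) (auto intro: converse_rtranclp_into_rtranclp square_move_sym)

lemma square_move_context: "square_move X p q \<Longrightarrow> square_move X (l @ p @ m) (l @ q @ m)"
  unfolding square_move_def by (metis append.assoc)

lemma sw_context: "sw X p q \<Longrightarrow> sw X (l @ p @ m) (l @ q @ m)"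
  by (induction rule: rtranclp_induct) (auto intro: rtranclp.rtrancl_into_rtrancl square_move_context)

lemma sw_append: "sw X p q \<Longrightarrow> sw X (p @ m) (q @ m)"
  using sw_context[of X p q "[]"] by simp

lemma sw_end: "square X x y z w \<Longrightarrow> sw X (l @ [x, y, z]) (l @ [x, w, z])"
  using square_moveI[of X x y z w l "[]"] by auto

lemma sw_trans: "sw X p q \<Longrightarrow> sw X q r \<Longrightarrow> sw X p r"
  by (rule rtranclp_trans)

lemma square_move_length: "square_move X p q \<Longrightarrow> length p = length q"
  unfolding square_move_def by auto

lemma sw_length: "sw X p q \<Longrightarrow> length p = length q"
  by (induction rule: rtranclp_induct) (auto dest: square_move_length)

lemma square_move_last: "square_move X p q \<Longrightarrow> last p = last q"
  unfolding square_move_def by (auto simp: last_append)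

lemma sw_last: "sw X p q \<Longrightarrow> last p = last q"
  by (induction rule: rtranclp_induct) (auto dest: square_move_last)

lemma square_move_edge_path:
  assumes "square_move X p q" "edge_path X x p y" "cube_complex X"
  shows "edge_path X x q y"
proof -
  obtain l m a b c d where *: "p = l @ [a, b, c] @ m" "q = l @ [a, d, c] @ m" "square X a b c d"
    using assms(1) unfolding square_move_def by blast
  have "d \<in> verts X"
    using *(3) assms(3) unfolding square_def cube_complex_def by auto
  with * assms(2) show ?thesis
    unfolding edge_path_def
    by (auto simp: successively_append_iff hd_append last_append square_def adj_sym split: if_splits)
qed

lemma sw_edge_path:
  "sw X p q \<Longrightarrow> edge_path X x p y \<Longrightarrow> cube_complex X \<Longrightarrow> edge_path X x q y"
  by (induction rule: rtranclp_induct) (auto intro: square_move_edge_path)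

section \<open>Local geometry of cubes\<close>

lemma cube_complexD:
  assumes "cube_complex X" "C \<in> cubes X"
  shows "C \<subseteq> verts X"
    and "\<exists>n (f :: nat set \<Rightarrow> 'a). bij_betw f (Pow {..<n}) C \<and>
           {D \<in> cubes X. D \<subseteq> C} = (\<lambda>P. f ` P) ` cube_faces n"
    and "D \<in> cubes X \<Longrightarrow> C \<inter> D = {} \<or> C \<inter> D \<in> cubes X"
  using assms unfolding cube_complex_def by simp_all

lemma cube_card:
  assumes "cube_complex X" "C \<in> cubes X"
  obtains n where "card C = 2 ^ n" "finite C"
proof -
  obtain n f where "bij_betw f (Pow {..<n::nat}) C"
    using cube_complexD(2)[OF assms] by auto
  then have "card C = 2 ^ n" "finite C"
    using bij_betw_same_card[of f "Pow {..<n}" C] bij_betw_finite[of f "Pow {..<n}" C]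
    by (simp_all add: card_Pow)
  with that show ?thesis by blast
qed

text \<open>Two squares with three common corners and different fourth ones would meet in a cube
  with three vertices, and three is not a power of two.\<close>

lemma square_unique:
  assumes X: "cube_complex X" and "square X a b c d" "square X a b c e"
  shows "d = e"
proof -
  let ?C = "{a, b, c, d}" and ?D = "{a, b, c, e}"
  have "?C \<in> cubes X" "?D \<in> cubes X" using assms unfolding square_def by auto
  then have I: "?C \<inter> ?D \<in> cubes X" using cube_complexD(3)[OF X] by blast
  show ?thesis
  proof (rule ccontr)
    assume "d \<noteq> e"
    then have "?C \<inter> ?D = {a, b, c}" using assms unfolding square_def by auto
    then have "card (?C \<inter> ?D) = 3" using assms unfolding square_def by auto
    then obtain n where n: "(2::nat) ^ n = 3" using cube_card[OF X I] by metis
    then show False by (cases n; simp; presburger)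
  qed
qed

text \<open>Flipping coordinates by \<open>sym_diff\<close> treats all corners of a cube alike,
  whether or not \<open>i\<close> belongs to \<open>S\<close>.\<close>

lemma cube_coordinates:
  assumes X: "cube_complex X" and C: "C \<in> cubes X"
  obtains n and f :: "nat set \<Rightarrow> 'a" where
    "bij_betw f (Pow {..<n}) C"
    "\<And>S i. S \<subseteq> {..<n} \<Longrightarrow> i < n \<Longrightarrow> adj X (f S) (f (sym_diff S {i}))"
    "\<And>S i j. S \<subseteq> {..<n} \<Longrightarrow> i < n \<Longrightarrow> j < n \<Longrightarrow> i \<noteq> j \<Longrightarrow>
       square X (f S) (f (sym_diff S {i})) (f (sym_diff S {i, j})) (f (sym_diff S {j}))"
    "\<And>S T. S \<subseteq> {..<n} \<Longrightarrow> T \<subseteq> {..<n} \<Longrightarrow> adj X (f S) (f T) \<Longrightarrow> \<exists>i<n. T = sym_diff S {i}"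
proof -
  obtain n and f :: "nat set \<Rightarrow> 'a" where f: "bij_betw f (Pow {..<n}) C"
    and faces: "{D \<in> cubes X. D \<subseteq> C} = (\<lambda>P. f ` P) ` cube_faces n"
    using cube_complexD(2)[OF assms] by auto
  have inj: "f S = f T \<longleftrightarrow> S = T" if "S \<subseteq> {..<n}" "T \<subseteq> {..<n}" for S T
    using f that by (auto simp: bij_betw_def inj_on_def)
  have face: "f ` {S. L \<subseteq> S \<and> S \<subseteq> U} \<in> cubes X" if "L \<subseteq> U" "U \<subseteq> {..<n}" for L U
    using faces that unfolding cube_faces_def by blast
  have sub: "sym_diff S {i} \<subseteq> {..<n}" if "S \<subseteq> {..<n}" "i < n" for S i
    using that by auto
  have ne: "sym_diff S {i} \<noteq> S" for S :: "nat set" and i by blast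
  have A: "adj X (f S) (f (sym_diff S {i}))" if S: "S \<subseteq> {..<n}" and i: "i < n" for S i
  proof -
    have "{T. S - {i} \<subseteq> T \<and> T \<subseteq> insert i S} = {S, sym_diff S {i}}" by blast
    moreover have "f ` {T. S - {i} \<subseteq> T \<and> T \<subseteq> insert i S} \<in> cubes X"
      by (rule face) (use S i in auto)
    ultimately have "{f S, f (sym_diff S {i})} \<in> cubes X" by simp
    moreover have "f S \<noteq> f (sym_diff S {i})" using inj[OF S sub[OF S i]] ne[of S i] by metis
    ultimately show ?thesis unfolding adj_def by blast
  qed
  have B: "square X (f S) (f (sym_diff S {i})) (f (sym_diff S {i, j})) (f (sym_diff S {j}))"
    if S: "S \<subseteq> {..<n}" and i: "i < n" and j: "j < n" and ij: "i \<noteq> j" for S i j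
  proof -
    have "{T. S - {i, j} \<subseteq> T \<and> T \<subseteq> insert i (insert j S)}
      = {S, sym_diff S {i}, sym_diff S {i, j}, sym_diff S {j}}" (is "?L = ?R")
    proof
      show "?L \<subseteq> ?R"
      proof
        fix T assume "T \<in> ?L"
        then have T: "\<And>k. k \<noteq> i \<Longrightarrow> k \<noteq> j \<Longrightarrow> k \<in> T \<longleftrightarrow> k \<in> S" by blast
        consider "i \<in> T \<longleftrightarrow> i \<in> S" "j \<in> T \<longleftrightarrow> j \<in> S" | "i \<in> T \<longleftrightarrow> i \<notin> S" "j \<in> T \<longleftrightarrow> j \<in> S"
          | "i \<in> T \<longleftrightarrow> i \<in> S" "j \<in> T \<longleftrightarrow> j \<notin> S" | "i \<in> T \<longleftrightarrow> i \<notin> S" "j \<in> T \<longleftrightarrow> j \<notin> S" by blast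
        then show "T \<in> ?R"
        proof cases
          case 1
          have "k \<in> T \<longleftrightarrow> k \<in> S" for k
            using 1 T[of k] ij by (cases "k = i"; cases "k = j"; auto)
          then show ?thesis by blast
        next
          case 2
          have "k \<in> T \<longleftrightarrow> k \<in> sym_diff S {i}" for k
            using 2 T[of k] ij by (cases "k = i"; cases "k = j"; auto)
          then show ?thesis by blast
        next
          case 3
          have "k \<in> T \<longleftrightarrow> k \<in> sym_diff S {j}" for k
            using 3 T[of k] ij by (cases "k = i"; cases "k = j"; auto)
          then show ?thesis by blast
        next
          case 4
          have "k \<in> T \<longleftrightarrow> k \<in> sym_diff S {i, j}" for k
            using 4 T[of k] ij by (cases "k = i"; cases "k = j"; auto)
          then show ?thesis by blast
        qed
      qed
    qed (use ij in blast)
    moreover have "f ` {T. S - {i, j} \<subseteq> T \<and> T \<subseteq> insert i (insert j S)} \<in> cubes X"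
      by (rule face) (use S i j in auto)
    ultimately have 1: "{f S, f (sym_diff S {i}), f (sym_diff S {i, j}), f (sym_diff S {j})} \<in> cubes X"
      by simp
    have eq: "sym_diff (sym_diff S {i}) {j} = sym_diff S {i, j}"
      "sym_diff (sym_diff S {j}) {i} = sym_diff S {i, j}"
      using ij by blast+
    have "adj X (f (sym_diff S {i})) (f (sym_diff S {i, j}))" "adj X (f (sym_diff S {j})) (f (sym_diff S {i, j}))"
      using A[OF sub[OF S i] j] A[OF sub[OF S j] i] unfolding eq by blast+
    moreover have "f (sym_diff S {i}) \<noteq> f (sym_diff S {j})" "f S \<noteq> f (sym_diff S {i, j})"
    proof -
      have "sym_diff S {i, j} \<subseteq> {..<n}" using S i j by auto
      moreover have "sym_diff S {i} \<noteq> sym_diff S {j}" "S \<noteq> sym_diff S {i, j}" using ij by blast+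
      ultimately show "f (sym_diff S {i}) \<noteq> f (sym_diff S {j})" "f S \<noteq> f (sym_diff S {i, j})"
        using inj S sub[OF S i] sub[OF S j] by metis+
    qed
    ultimately show ?thesis
      using 1 A[OF S i] A[OF S j] unfolding square_def
      by (metis adj_sym adj_def distinct_length_2_or_more distinct_singleton)
  qed
  have D: "\<exists>i<n. T = sym_diff S {i}" if S: "S \<subseteq> {..<n}" and T: "T \<subseteq> {..<n}" and a: "adj X (f S) (f T)" for S T
  proof -
    \<comment> \<open>An edge within \<open>C\<close> is a face, that is, an order interval; having
      two elements, it joins sets that differ in one coordinate.\<close>
    have "{f S, f T} \<in> {D \<in> cubes X. D \<subseteq> C}" and ST: "S \<noteq> T"
      using a f S T unfolding adj_def bij_betw_def by auto
    then obtain L U where LU: "L \<subseteq> U" "U \<subseteq> {..<n}" and eq: "{f S, f T} = f ` {S. L \<subseteq> S \<and> S \<subseteq> U}"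
      unfolding faces cube_faces_def by blast
    have "f ` {S, T} = f ` {S. L \<subseteq> S \<and> S \<subseteq> U}" using eq by simp
    moreover have "{S, T} \<subseteq> Pow {..<n}" "{S. L \<subseteq> S \<and> S \<subseteq> U} \<subseteq> Pow {..<n}"
      using S T LU by auto
    ultimately have ST2: "{S, T} = {S. L \<subseteq> S \<and> S \<subseteq> U}"
      using inj_on_image_eq_iff[OF bij_betw_imp_inj_on[OF f]] by metis
    have "R \<in> {S, T} \<longleftrightarrow> L \<subseteq> R \<and> R \<subseteq> U" for R
      by (simp only: ST2 mem_Collect_eq)
    then have mem: "R = S \<or> R = T \<longleftrightarrow> L \<subseteq> R \<and> R \<subseteq> U" for R by simp
    have "L \<subseteq> S" "S \<subseteq> U" "L \<subseteq> T" "T \<subseteq> U" using mem[of S] mem[of T] by simp_all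
    then have "L \<noteq> U" using ST by auto
    then obtain i where i: "i \<in> U" "i \<notin> L" using LU(1) by (meson psubsetI psubset_imp_ex_mem Diff_iff)
    have "insert i L = S \<or> insert i L = T" "L = S \<or> L = T" using mem[of "insert i L"] mem[of L] i LU(1) subset_insertI[of L i] by simp_all
    moreover have "L \<noteq> insert i L" using i by blast
    ultimately have "S = L \<and> T = insert i L \<or> S = insert i L \<and> T = L" by auto
    moreover have "sym_diff L {i} = insert i L" "sym_diff (insert i L) {i} = L" using i by auto
    ultimately have "T = sym_diff S {i}" by (elim disjE conjE) simp_all
    then show ?thesis using i(1) LU(2) by auto
  qed
  show ?thesis by (rule that[OF f A B D])
qed

lemma elem_homotopy_parity: "elem_homotopy X p q \<Longrightarrow> even (length p) \<longleftrightarrow> even (length q)"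
  by (induction rule: elem_homotopy.induct) auto

lemma equivclp_homotopy_parity:
  "equivclp (elem_homotopy X) p q \<Longrightarrow> even (length p) \<longleftrightarrow> even (length q)"
  by (induction rule: equivclp_induct) (auto dest: elem_homotopy_parity)

text \<open>\<open>length\<close> counts vertices, so an odd length means an even number of edges:
  the 1-skeleton is bipartite because the generating homotopies preserve parity.\<close>

lemma closed_path_odd:
  assumes "simply_connected_complex X" "edge_path X x p x"
  shows "odd (length p)"
  using equivclp_homotopy_parity[of X p "[x]"] assms unfolding simply_connected_complex_def by auto

text \<open>A diagonal edge would close up a triangle, whose vertex list has even length.
  Consequently a square contributes exactly a pair of vertices to the link of a corner.\<close>

lemma square_not_adj_diag:
  assumes X: "CAT0_cube_complex X" and s: "square X x y z w"
  shows "\<not> adj X x z"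
proof
  assume a: "adj X x z"
  have "{x, y, z, w} \<subseteq> verts X" using cube_complexD(1) s X unfolding square_def CAT0_cube_complex_def by blast
  then have "edge_path X x [x, y, z, x] x"
    using s a unfolding edge_path_def square_def by (auto simp: adj_sym)
  from closed_path_odd[OF _ this] X show False unfolding CAT0_cube_complex_def by auto
qed

text \<open>The flag condition enters here. Three squares around \<open>c\<close>, pairwise sharing
  an edge at \<open>c\<close>, form a triangle in its link, so they lie in a common cube;
  \<open>y\<close> is the corner opposite to \<open>c\<close>.\<close>

lemma three_squares_cube:
  assumes X: "CAT0_cube_complex X"
    and s1: "square X c w1 x w2" and s2: "square X c w1 a u" and s3: "square X c w2 b u"
  obtains y where "square X x w1 a y" "square X x w2 b y" "square X u a y b"
proof -
  have cc: "cube_complex X" and fl: "\<And>v. v \<in> verts X \<Longrightarrow> flag (link X v)"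
    using X unfolding CAT0_cube_complex_def by auto
  have cv: "c \<in> verts X" using s1 cube_complexD(1)[OF cc] unfolding square_def by blast
  have ad: "adj X c w1" "adj X c w2" "adj X c u"
    using s1 s2 adj_sym unfolding square_def by metis+
  have sl: "{p, q} \<in> link X c" if s: "square X c p r q" for p q r
  proof -
    have "{w \<in> {c, p, r, q}. adj X c w} = {p, q}"
      using s square_not_adj_diag[OF X s] adj_sym[of X q c] unfolding square_def by (auto simp: adj_def)
    moreover have "{c, p, r, q} \<in> cubes X" using s unfolding square_def by auto
    ultimately show ?thesis unfolding link_def by blast
  qed
  have el: "{p} \<in> link X c" if "adj X c p" for p
  proof -
    have "{w \<in> {c, p}. adj X c w} = {p}" using that by (auto simp: adj_def)
    moreover have "{c, p} \<in> cubes X" using that unfolding adj_def by auto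
    ultimately show ?thesis unfolding link_def by blast
  qed
  let ?S = "{w1, w2, u}"
  have pl: "{w1, w2} \<in> link X c" "{w1, u} \<in> link X c" "{w2, u} \<in> link X c"
    using sl s1 s2 s3 by blast+
  have "?S \<in> link X c"
  proof -
    have "finite ?S \<and> ?S \<subseteq> \<Union> (link X c) \<and> (\<forall>a\<in>?S. \<forall>b\<in>?S. {a, b} \<in> link X c)"
      using pl el ad by (auto simp: insert_commute)
    then show ?thesis using fl[OF cv] unfolding flag_def by blast
  qed
  then obtain K where K: "K \<in> cubes X" "c \<in> K" and KS: "?S = {w \<in> K. adj X c w}"
    unfolding link_def by blast
  obtain n and f :: "nat set \<Rightarrow> 'a" where f: "bij_betw f (Pow {..<n}) K"
    and fB: "\<And>S i j. S \<subseteq> {..<n} \<Longrightarrow> i < n \<Longrightarrow> j < n \<Longrightarrow> i \<noteq> j \<Longrightarrow>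
       square X (f S) (f (sym_diff S {i})) (f (sym_diff S {i, j})) (f (sym_diff S {j}))"
    and fD: "\<And>S T. S \<subseteq> {..<n} \<Longrightarrow> T \<subseteq> {..<n} \<Longrightarrow> adj X (f S) (f T) \<Longrightarrow> \<exists>i<n. T = sym_diff S {i}"
    using cube_coordinates[OF cc K(1)] by metis
  obtain S where S: "S \<subseteq> {..<n}" "c = f S" using f K(2) unfolding bij_betw_def by blast
  have nb: "\<exists>i<n. w = f (sym_diff S {i})" if "w \<in> ?S" for w
  proof -
    have "w \<in> K" "adj X c w" using that KS by auto
    then obtain T where "T \<subseteq> {..<n}" "w = f T" using f unfolding bij_betw_def by blast
    then show ?thesis using fD[OF S(1)] S(2) \<open>adj X c w\<close> by blast
  qed
  obtain i where i: "i < n" "w1 = f (sym_diff S {i})" using nb by blast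
  obtain j where j: "j < n" "w2 = f (sym_diff S {j})" using nb by blast
  obtain k where k: "k < n" "u = f (sym_diff S {k})" using nb by blast
  have d: "i \<noteq> j" "i \<noteq> k" "j \<noteq> k" using i j k s1 s2 s3 unfolding square_def by auto
  \<comment> \<open>By \<open>square_unique\<close> the given squares are the faces of the cube
    spanned by the same edges at \<open>c\<close>.\<close>
  have un: "r = f (sym_diff S {p, q})" if "square X c v r w" "v = f (sym_diff S {p})" "w = f (sym_diff S {q})"
    "p < n" "q < n" "p \<noteq> q" for p q r v w
  proof -
    have "square X w c v (f (sym_diff S {p, q}))" 
      using square_rot[OF square_rot[OF square_rot[OF fB[OF S(1) that(4,5,6)]]]] that S by simp
    moreover have "square X w c v r" using square_rot[OF square_rot[OF square_rot[OF that(1)]]] .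
    ultimately show ?thesis using square_unique[OF cc] by blast
  qed
  have x: "x = f (sym_diff S {i, j})" and a: "a = f (sym_diff S {i, k})" and b: "b = f (sym_diff S {j, k})"
    using un[OF s1] un[OF s2] un[OF s3] i j k d by blast+
  let ?y = "f (sym_diff S {i, j, k})"
  have sub: "sym_diff S {p} \<subseteq> {..<n}" if "p < n" for p using S(1) that by auto
  have e: "sym_diff (sym_diff S {p}) {q} = sym_diff S {p, q}" if "p \<noteq> q" for p q using that by blast
  have e3: "sym_diff (sym_diff S {p}) {q, r} = sym_diff S {p, q, r}" if "p \<noteq> q" "p \<noteq> r" for p q r
    using that by blast
  have q1: "square X w1 x ?y a"
    using fB[OF sub[OF i(1)] j(1) k(1) d(3)] i x a d by (simp only: e e3 simp_thms)
  have c1: "{j, i} = {i, j}" "{j, i, k} = {i, j, k}" "{k, i} = {i, k}" "{k, j} = {j, k}" "{k, i, j} = {i, j, k}" by blast+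
  have q2: "square X w2 x ?y b"
    using fB[OF sub[OF j(1)] i(1) k(1) d(2)] j x b d by (simp only: e[of j i] e[of j k] e3[of j i k] c1 simp_thms not_sym)
  have q3: "square X u a ?y b"
    using fB[OF sub[OF k(1)] i(1) j(1) d(1)] k a b d by (simp only: e[of k i] e[of k j] e3[of k i j] c1 simp_thms not_sym)
  show ?thesis
    using that[OF square_flip[OF square_rot[OF q1]] square_flip[OF square_rot[OF q2]] q3]
    by blast
qed

section \<open>The exchange property of square moves\<close>

definition descends :: "'a cube_complex \<Rightarrow> 'a list \<Rightarrow> 'a list \<Rightarrow> 'a \<Rightarrow> bool" where
  "descends X P Q u \<longleftrightarrow> sw X P Q \<or>
     (\<exists>r w. square X w (last P) u (last Q) \<and> sw X P (r @ [w, last P]) \<and> sw X Q (r @ [w, last Q]))"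

text \<open>The square of the previous comparison, the new square and the one that \<open>IH\<close>
  supplies for the shorter paths ending in \<open>y\<close> meet in \<open>y\<close>, pairwise along
  an edge. They span a 3-cube, and its corner opposite to \<open>y\<close> is the new common
  predecessor.\<close>

lemma descends_step:
  assumes X: "CAT0_cube_complex X"
    and IH: "\<And>P' Q' u. length P' < length P \<Longrightarrow> P' \<noteq> [] \<Longrightarrow> sw X (P' @ [u]) (Q' @ [u]) \<Longrightarrow> descends X P' Q' u"
    and PQ: "descends X P (l @ [x, y]) u" and len: "length P = length (l @ [x, y])"
    and s: "square X x y u w"
  shows "descends X P (l @ [x, w]) u"
proof -
  have cc: "cube_complex X" using X unfolding CAT0_cube_complex_def by simp
  let ?a = "last P"
  consider "sw X P (l @ [x, y])"
    | r t where "square X t ?a u y" "sw X P (r @ [t, ?a])" "sw X (l @ [x, y]) (r @ [t, y])"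
    using PQ unfolding descends_def by auto
  then show ?thesis
  proof cases
    case 1
    then have "?a = y" using sw_last by fastforce
    with 1 s show ?thesis unfolding descends_def by fastforce
  next
    case (2 r t)
    have "descends X (l @ [x]) (r @ [t]) y"
      by (rule IH) (use 2(3) len in auto)
    then consider "sw X (l @ [x]) (r @ [t])"
      | s' v where "square X v x y t" "sw X (l @ [x]) (s' @ [v, x])" "sw X (r @ [t]) (s' @ [v, t])"
      unfolding descends_def by auto
    then show ?thesis
    proof cases
      case 1
      \<comment> \<open>The third square degenerates here, and the other two coincide by
        \<open>square_unique\<close>.\<close>
      then have xt: "x = t" using sw_last by fastforce
      then have aw: "?a = w" using square_unique[OF cc square_flip[OF 2(1)]] s by simp
      have "sw X (l @ [x, w]) (r @ [t, ?a])" using sw_append[OF 1, of "[w]"] aw by simp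
      then show ?thesis using sw_trans[OF 2(2) sw_sym] unfolding descends_def by blast
    next
      case (2 s' v)
      note * = \<open>square X t ?a u y\<close> \<open>sw X P (r @ [t, ?a])\<close>
      have a: "square X y x v t" using square_flip[OF square_rot[OF square_rot[OF 2(1)]]] .
      have b: "square X y x w u" using square_rot[OF square_rot[OF square_rot[OF square_flip[OF s]]]] .
      have c: "square X y t ?a u" using square_rot[OF square_rot[OF square_rot[OF *(1)]]] .
      obtain z where z: "square X v x w z" "square X v t ?a z" "square X u w z ?a"
        using three_squares_cube[OF X a b c] by blast
      have "sw X P (s' @ [v, t, ?a])" using sw_trans[OF *(2)] sw_append[OF 2(3), of "[?a]"] by simp
      then have "sw X P ((s' @ [v]) @ [z, ?a])" using sw_end[OF z(2), of s'] sw_trans by fastforce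
      moreover have "sw X (l @ [x, w]) (s' @ [v, x, w])" using sw_append[OF 2(2), of "[w]"] by simp
      then have "sw X (l @ [x, w]) ((s' @ [v]) @ [z, w])" using sw_end[OF z(1), of s'] sw_trans by fastforce
      moreover have "square X z ?a u w" using square_rot[OF square_rot[OF z(3)]] .
      ultimately show ?thesis unfolding descends_def by fastforce
    qed
  qed
qed

text \<open>
  Square moves satisfy an exchange property: two equivalent paths that enter their common endpoint
  along different edges can be pushed across the square spanned by these edges.
\<close>

lemma descent:
  assumes X: "CAT0_cube_complex X"
  shows "P \<noteq> [] \<Longrightarrow> sw X (P @ [u]) (Q @ [u]) \<Longrightarrow> descends X P Q u"
proof (induction "length P" arbitrary: P Q u rule: less_induct)
  case less
  have "\<exists>Q. R = Q @ [u] \<and> descends X P Q u" if "sw X (P @ [u]) R" for R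
    using that
  proof (induction rule: rtranclp_induct)
    case base
    then show ?case unfolding descends_def by blast
  next
    case (step R R')
    then obtain Q where Q: "R = Q @ [u]" "descends X P Q u" by blast
    obtain l m x y z w where R: "R = l @ [x, y, z] @ m" and R': "R' = l @ [x, w, z] @ m"
      and s: "square X x y z w"
      using step(2) unfolding square_move_def by blast
    \<comment> \<open>With \<open>m\<close> empty, the move changes the edge that enters
      \<open>u\<close>; otherwise it takes place inside \<open>Q\<close> and keeps its last
      vertex.\<close>
    show ?case
    proof (cases m rule: rev_cases)
      case Nil
      then have *: "Q = l @ [x, y]" "z = u" using R Q(1) by auto
      have "length P = length Q" using sw_length[OF step(1)] Q(1) by simp
      then have "descends X P (l @ [x, w]) u"
        using descends_step[OF X less(1)] Q(2) s unfolding * by blast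
      then show ?thesis using R' Nil *(2) by auto
    next
      case (snoc m' v)
      let ?Q' = "l @ [x, w, z] @ m'"
      have *: "Q = l @ [x, y, z] @ m'" "v = u" using R Q(1) snoc by auto
      have mv: "square_move X Q ?Q'" unfolding * by (rule square_moveI[OF s])
      then have "sw X Q ?Q'" by blast
      moreover have "last ?Q' = last Q" using square_move_last[OF mv] by simp
      ultimately have "descends X P ?Q' u"
        using Q(2) unfolding descends_def by (metis sw_sym sw_trans)
      then show ?thesis using R' snoc *(2) by auto
    qed
  qed
  then show ?case using less(3) by fastforce
qed

lemma descent_cases:
  assumes "CAT0_cube_complex X" "sw X (p @ [a, u]) (q @ [b, u])"
  obtains "a = b" "sw X (p @ [a]) (q @ [a])"
    | r w where "square X w a u b" "sw X (p @ [a]) (r @ [w, a])" "sw X (q @ [b]) (r @ [w, b])"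
proof -
  have "descends X (p @ [a]) (q @ [b]) u" by (rule descent[OF assms(1)]) (use assms(2) in auto)
  then consider "sw X (p @ [a]) (q @ [b])"
    | r w where "square X w a u b" "sw X (p @ [a]) (r @ [w, a])" "sw X (q @ [b]) (r @ [w, b])"
    unfolding descends_def by auto
  then show ?thesis
  proof cases
    case 1
    moreover have "a = b" using sw_last[OF 1] by simp
    ultimately show ?thesis using that(1) by simp
  qed (rule that(2))
qed

section \<open>Reduced edge-paths\<close>

definition backtracking :: "'a list \<Rightarrow> bool" where
  "backtracking p \<longleftrightarrow> (\<exists>l x y m. p = l @ [x, y, x] @ m)"

definition reduced :: "'a cube_complex \<Rightarrow> 'a list \<Rightarrow> bool" where
  "reduced X p \<longleftrightarrow> (\<forall>q. sw X p q \<longrightarrow> \<not> backtracking q)"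

lemma backtracking_append: "backtracking p \<Longrightarrow> backtracking (p @ q)"
  unfolding backtracking_def by fastforce

lemma reduced_sw: "reduced X p \<Longrightarrow> sw X p q \<Longrightarrow> reduced X q"
  unfolding reduced_def using sw_trans by blast

lemma reduced_prefix: "reduced X (p @ q) \<Longrightarrow> reduced X p"
  unfolding reduced_def using sw_append backtracking_append by blast

lemma reduced_no_return: "reduced X p \<Longrightarrow> \<not> sw X p (q @ [x, y, x])"
  unfolding reduced_def backtracking_def by (metis append.right_neutral)

text \<open>This is the dichotomy behind \<open>step\<close>: appending \<open>a\<close> keeps a
  reduced path reduced, unless square moves can make its last edge come from \<open>a\<close>. By
  the exchange property, a backtrack in a path equivalent to \<open>P @ [a]\<close> leads to a
  backtrack in one equivalent to \<open>P\<close>, or to such a last edge.\<close>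

lemma reduced_append:
  assumes X: "CAT0_cube_complex X"
  shows "reduced X P \<Longrightarrow> P \<noteq> [] \<Longrightarrow> \<nexists>q. sw X P (q @ [a, last P]) \<Longrightarrow> reduced X (P @ [a])"
proof (induction "length P" arbitrary: P a rule: less_induct)
  case less
  have cc: "cube_complex X" using X unfolding CAT0_cube_complex_def by simp
  obtain P0 u where P: "P = P0 @ [u]" using less(3) by (cases P rule: rev_cases) auto
  have no: False if "sw X P (q @ [a, u])" for q using less(4) that P by auto
  show ?case unfolding reduced_def
  proof (intro allI impI notI)
    fix L assume L: "sw X (P @ [a]) L" and "backtracking L"
    then obtain l x y m where Leq: "L = l @ [x, y, x] @ m" unfolding backtracking_def by blast
    show False
    proof (cases m rule: rev_cases)
      \<comment> \<open>The backtrack ends the path. Unless \<open>u = y\<close>, two exchanges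
        produce squares with three common corners, so \<open>w2 = u\<close>, and \<open>P\<close>
        would be equivalent to a backtracking path.\<close>
      case Nil
      then have "x = a" using sw_last[OF L] Leq by simp
      then have "sw X (P0 @ [u, a]) ((l @ [a]) @ [y, a])" using L Leq Nil P by simp
      then show False
      proof (rule descent_cases[OF X])
        assume "u = y" "sw X (P0 @ [u]) ((l @ [a]) @ [u])"
        then show False using no[of l] P by simp
      next
        fix r w
        assume 1: "square X w u a y" "sw X (P0 @ [u]) (r @ [w, u])" "sw X ((l @ [a]) @ [y]) (r @ [w, y])"
        then have "sw X (l @ [a, y]) (r @ [w, y])" by simp
        then show False
        proof (rule descent_cases[OF X])
          assume "a = w"
          then show False using 1(1) unfolding square_def by auto
        next
          fix r2 w2
          assume 2: "square X w2 a y w" "sw X (l @ [a]) (r2 @ [w2, a])" "sw X (r @ [w]) (r2 @ [w2, w])"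
          have "square X a y w w2" using square_rot[OF 2(1)] .
          moreover have "square X a y w u" using square_rot[OF square_rot[OF \<open>square X w u a y\<close>]] .
          ultimately have "w2 = u" using square_unique[OF cc] by blast
          then have "sw X (r @ [w, u]) (r2 @ [u, w, u])" using sw_append[OF 2(3), of "[u]"] by simp
          then have "sw X P (r2 @ [u, w, u])" using \<open>sw X (P0 @ [u]) (r @ [w, u])\<close> P sw_trans by metis
          then show False using reduced_no_return[OF less(2)] by blast
        qed
      qed
    next
      \<comment> \<open>The backtrack survives the removal of the last vertex. Unless
        \<open>u = u2\<close>, after an exchange the induction hypothesis gives
        \<open>r @ [w]\<close> a last edge from \<open>u2\<close>, and one more square move gives
        \<open>P\<close> a last edge from \<open>a\<close>.\<close>
      case (snoc m' v)
      let ?M = "l @ [x, y, x] @ m'"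
      have bt: "backtracking ?M" unfolding backtracking_def by blast
      obtain M0 u2 where M: "?M = M0 @ [u2]" by (cases ?M rule: rev_cases) auto
      have "v = a" using sw_last[OF L] Leq snoc by simp
      then have "L = ?M @ [a]" using Leq snoc by simp
      then have "L = (M0 @ [u2]) @ [a]" unfolding M .
      then have "sw X (P0 @ [u, a]) (M0 @ [u2, a])" using L P by simp
      then show False
      proof (rule descent_cases[OF X])
        assume "u = u2" "sw X (P0 @ [u]) (M0 @ [u])"
        then show False using less(2) bt P M unfolding reduced_def by metis
      next
        fix r w
        assume 2: "square X w u a u2" "sw X (P0 @ [u]) (r @ [w, u])" "sw X (M0 @ [u2]) (r @ [w, u2])"
        have rw: "reduced X (r @ [w])"
          using reduced_prefix[of X "r @ [w]" "[u]"] reduced_sw[OF less(2)] 2(2) P by simp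
        have "\<not> reduced X ((r @ [w]) @ [u2])"
          using 2(3) bt M sw_sym unfolding reduced_def by fastforce
        moreover have "length (r @ [w]) < length P" using sw_length[OF 2(2)] P by simp
        ultimately obtain q where "sw X (r @ [w]) (q @ [u2, w])"
          using less(1)[of "r @ [w]" u2] rw by auto
        then have "sw X (r @ [w, u]) (q @ [u2, w, u])" using sw_append[of X "r @ [w]" _ "[u]"] by fastforce
        then have "sw X P (q @ [u2, w, u])" using 2(2) P sw_trans by metis
        moreover have "square X u2 w u a" using square_rot[OF square_rot[OF square_rot[OF 2(1)]]] .
        ultimately have "sw X P (q @ [u2, a, u])" using sw_end sw_trans by metis
        then show False using no[of "q @ [u2]"] by simp
      qed
    qed
  qed
qed

text \<open>Van der Waerden's device for normal forms: vertices act one by one on reduced paths up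
  to square moves, deleting the last edge when possible and extending the path otherwise. The choice
  in \<open>SOME\<close> does not matter up to \<open>sw\<close>, by
  \<open>step_delete\<close>.\<close>

definition step :: "'a cube_complex \<Rightarrow> 'a list \<Rightarrow> 'a \<Rightarrow> 'a list" where
  "step X p a = (if \<exists>q. sw X p (q @ [a, last p]) then (SOME q. sw X p (q @ [a, last p])) @ [a] else p @ [a])"

lemma step_simps [simp]: "last (step X p a) = a" "step X p a \<noteq> []"
  unfolding step_def by auto

lemma step_delete:
  assumes X: "CAT0_cube_complex X" and p: "sw X p (q @ [a, u])"
  shows "sw X (step X p a) (q @ [a])"
proof -
  have u: "last p = u" using sw_last[OF p] by simp
  let ?q = "SOME q. sw X p (q @ [a, u])"
  have "sw X p (?q @ [a, u])" using p by (rule someI)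
  then have "sw X (?q @ [a, u]) (q @ [a, u])" using p sw_sym sw_trans by metis
  then have "sw X (?q @ [a]) (q @ [a])"
    by (rule descent_cases[OF X]) (auto simp: square_def)
  moreover have "step X p a = ?q @ [a]" using p unfolding step_def u by auto
  ultimately show ?thesis by simp
qed

lemma step_append: "(\<And>q. \<not> sw X p (q @ [a, last p])) \<Longrightarrow> step X p a = p @ [a]"
  unfolding step_def by simp

lemma step_sw:
  assumes X: "CAT0_cube_complex X" and "sw X p p'"
  shows "sw X (step X p a) (step X p' a)"
proof (cases "\<exists>q. sw X p' (q @ [a, last p'])")
  case True
  then obtain q where "sw X p' (q @ [a, last p'])" by blast
  then show ?thesis using step_delete[OF X] assms(2) sw_trans sw_sym by metis
next
  case False
  then have "step X p a = p @ [a]" "step X p' a = p' @ [a]"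
    using assms(2) sw_last[OF assms(2)] sw_trans sw_sym by (metis step_append)+
  then show ?thesis using sw_append[OF assms(2)] by simp
qed

lemma reduced_step:
  assumes X: "CAT0_cube_complex X" and "reduced X p" "p \<noteq> []"
  shows "reduced X (step X p a)"
proof (cases "\<exists>q. sw X p (q @ [a, last p])")
  case True
  then obtain q where q: "sw X p (q @ [a, last p])" by blast
  then have "reduced X (q @ [a])" using reduced_sw[OF assms(2)] reduced_prefix[of X "q @ [a]" "[last p]"] by simp
  then show ?thesis using step_delete[OF X q] reduced_sw sw_sym by blast
next
  case False
  then show ?thesis using reduced_append[OF X assms(2,3)] step_append[of X p a] by auto
qed

text \<open>Needed for the invariance of \<open>nf\<close> under backtracks. If \<open>a\<close>
  deletes an edge, the return cannot delete another one, since \<open>p\<close> would then be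
  equivalent to a backtracking path; so it restores the edge.\<close>

lemma step_back:
  assumes X: "CAT0_cube_complex X" and p: "reduced X p" "p \<noteq> []"
  shows "sw X (step X (step X p a) (last p)) p"
proof (cases "\<exists>q. sw X p (q @ [a, last p])")
  case True
  let ?u = "last p"
  obtain q where q: "sw X p (q @ [a, ?u])" using True by blast
  have "step X (q @ [a]) ?u = (q @ [a]) @ [?u]"
  proof (rule step_append)
    fix q' show "\<not> sw X (q @ [a]) (q' @ [?u, last (q @ [a])])"
    proof
      assume "sw X (q @ [a]) (q' @ [?u, last (q @ [a])])"
      from sw_append[OF this, of "[?u]"] have "sw X p (q' @ [?u, a, ?u])"
        using q sw_trans by fastforce
      then show False using reduced_no_return[OF p(1)] by blast
    qed
  qed
  then have "sw X (step X (step X p a) ?u) (q @ [a, ?u])"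
    using step_sw[OF X step_delete[OF X q], of ?u] by simp
  then show ?thesis using q sw_sym sw_trans by metis
next
  case False
  obtain p' u where p': "p = p' @ [u]" using p(2) by (cases p rule: rev_cases) auto
  have "step X p a = p @ [a]" using False step_append[of X p a] by auto
  moreover have "sw X (step X (p @ [a]) u) (p' @ [u])" by (rule step_delete[OF X, of _ _ _ a]) (simp add: p')
  ultimately show ?thesis using p' by simp
qed

text \<open>If \<open>y\<close> deletes an edge of \<open>p\<close>, then either \<open>w\<close>
  does too and both routes delete two edges, or the route through \<open>y\<close> deletes and
  appends while the one through \<open>w\<close> appends and deletes.\<close>

lemma step_square_one:
  assumes X: "CAT0_cube_complex X" and p: "p \<noteq> []" and s: "square X (last p) y z w"
    and y: "sw X p (q @ [y, last p])"
  shows "sw X (step X (step X p y) z) (step X (step X p w) z)"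
proof -
  have cc: "cube_complex X" using X unfolding CAT0_cube_complex_def by simp
  let ?x = "last p"
  have s': "square X y ?x w z" using square_rot[OF square_rot[OF square_rot[OF square_flip[OF s]]]] .
  show ?thesis
  proof (cases "\<exists>q. sw X p (q @ [w, ?x])")
    case True
    then obtain q' where q': "sw X p (q' @ [w, ?x])" by blast
    then have "sw X (q @ [y, ?x]) (q' @ [w, ?x])" using y sw_sym sw_trans by metis
    then show ?thesis
    proof (rule descent_cases[OF X])
      assume "y = w"
      then show ?thesis using s unfolding square_def by auto
    next
      fix r t
      assume 2: "square X t y ?x w" "sw X (q @ [y]) (r @ [t, y])" "sw X (q' @ [w]) (r @ [t, w])"
      have "t = z" using square_unique[OF cc square_rot[OF 2(1)] s'] .
      then have "sw X (step X p y) (r @ [z, y])" "sw X (step X p w) (r @ [z, w])"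
        using step_delete[OF X y] step_delete[OF X q'] 2(2,3) sw_trans by metis+
      then show ?thesis using step_delete[OF X] sw_sym sw_trans by metis
    qed
  next
    case False
    have "step X (q @ [y]) z = (q @ [y]) @ [z]"
    proof (rule step_append)
      fix q' show "\<not> sw X (q @ [y]) (q' @ [z, last (q @ [y])])"
      proof
        assume "sw X (q @ [y]) (q' @ [z, last (q @ [y])])"
        from sw_append[OF this, of "[?x]"] have "sw X p (q' @ [z, y, ?x])"
          using y sw_trans by fastforce
        moreover have "square X z y ?x w" using square_rot[OF square_rot[OF square_flip[OF s]]] .
        ultimately have "sw X p ((q' @ [z]) @ [w, ?x])" using sw_end[of X z y ?x w q'] sw_trans by fastforce
        then show False using False by blast
      qed
    qed
    then have 1: "sw X (step X (step X p y) z) (q @ [y, z])"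
      using step_sw[OF X step_delete[OF X y], of z] by simp
    have "step X p w = p @ [w]" using False step_append[of X p w] by auto
    moreover have "sw X (p @ [w]) (q @ [y, ?x, w])" using sw_append[OF y, of "[w]"] by simp
    ultimately have "sw X (step X p w) ((q @ [y]) @ [z, w])" using sw_end[OF s', of q] sw_trans by fastforce
    then have "sw X (step X (step X p w) z) (q @ [y, z])" using step_delete[OF X] by fastforce
    with 1 show ?thesis using sw_sym sw_trans by metis
  qed
qed

text \<open>Needed for the invariance of \<open>nf\<close> under square moves. In the remaining case
  neither side shortens \<open>p\<close>, and both routes append two edges: if \<open>z\<close>
  could delete the first of them, the exchange property would make the other side shorten
  \<open>p\<close>.\<close>

lemma step_square:
  assumes X: "CAT0_cube_complex X" and p: "p \<noteq> []" and s: "square X (last p) y z w"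
  shows "sw X (step X (step X p y) z) (step X (step X p w) z)"
proof -
  have cc: "cube_complex X" using X unfolding CAT0_cube_complex_def by simp
  let ?x = "last p"
  have app: "step X (step X p y) z = p @ [y, z]"
    if s: "square X ?x y z w" and y: "\<nexists>q. sw X p (q @ [y, ?x])" and w: "\<nexists>q. sw X p (q @ [w, ?x])" for y w
  proof -
    obtain p' where p': "p = p' @ [?x]" using p by (metis append_butlast_last_id)
    have "step X p y = p @ [y]" using y step_append[of X p y] by auto
    moreover have "step X (p @ [y]) z = (p @ [y]) @ [z]"
    proof (rule step_append)
      fix q show "\<not> sw X (p @ [y]) (q @ [z, last (p @ [y])])"
      proof
        assume "sw X (p @ [y]) (q @ [z, last (p @ [y])])"
        then have "sw X (p' @ [?x, y]) (q @ [z, y])" by (subst (asm) p') simp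
        then show False
        proof (rule descent_cases[OF X])
          assume "?x = z"
          then show False using s unfolding square_def by auto
        next
          fix r t
          assume 2: "square X t ?x y z" "sw X (p' @ [?x]) (r @ [t, ?x])"
          have "t = w" using square_unique[OF cc square_rot[OF 2(1)] s] .
          then show False using 2(2) w p' by metis
        qed
      qed
    qed
    ultimately show ?thesis by simp
  qed
  consider q where "sw X p (q @ [y, ?x])" | q where "sw X p (q @ [w, ?x])"
    | "\<nexists>q. sw X p (q @ [y, ?x])" "\<nexists>q. sw X p (q @ [w, ?x])" by blast
  then show ?thesis
  proof cases
    case 1
    then show ?thesis using step_square_one[OF X p s] by blast
  next
    case 2
    then show ?thesis using step_square_one[OF X p square_flip[OF s]] sw_sym by blast
  next
    case 3
    obtain p' where p': "p = p' @ [?x]" using p by (metis append_butlast_last_id)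
    have "sw X (p' @ [?x, y, z]) (p' @ [?x, w, z])" by (rule sw_end[OF s])
    then have "sw X (p @ [y, z]) (p @ [w, z])" by (subst (1 2) p') simp
    then show ?thesis using app[OF s 3] app[OF square_flip[OF s] 3(2,1)] by simp
  qed
qed

section \<open>Normal forms and homotopy\<close>

definition nf :: "'a cube_complex \<Rightarrow> 'a list \<Rightarrow> 'a list" where
  "nf X p = foldl (step X) [hd p] (tl p)"

lemma nf_split: "nf X (l @ [x] @ m) = foldl (step X) (nf X (l @ [x])) m"
  by (cases l) (auto simp: nf_def)

lemma foldl_step_simps:
  "P \<noteq> [] \<Longrightarrow> foldl (step X) P r \<noteq> []"
  "P \<noteq> [] \<Longrightarrow> last (foldl (step X) P r) = last (last P # r)"
  by (induction r arbitrary: P) auto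

lemma foldl_step_sw:
  assumes "CAT0_cube_complex X" "sw X P Q"
  shows "sw X (foldl (step X) P r) (foldl (step X) Q r)"
  using assms(2) by (induction r arbitrary: P Q) (auto intro: step_sw[OF assms(1)])

lemma foldl_step_reduced:
  assumes "CAT0_cube_complex X" "reduced X P" "P \<noteq> []"
  shows "reduced X (foldl (step X) P r)"
  using assms(2,3) by (induction r arbitrary: P) (simp_all add: reduced_step[OF assms(1)])

lemma sw_singleton: "sw X [v] q \<Longrightarrow> q = [v]"
  by (induction rule: rtranclp_induct) (auto simp: square_move_def Cons_eq_append_conv)

lemma reduced_singleton: "reduced X [v]"
  unfolding reduced_def by (auto dest!: sw_singleton simp: backtracking_def Cons_eq_append_conv)

lemma nf_simps:
  assumes X: "CAT0_cube_complex X"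
  shows "nf X p \<noteq> []" "p \<noteq> [] \<Longrightarrow> last (nf X p) = last p" "reduced X (nf X p)"
proof -
  show "nf X p \<noteq> []" unfolding nf_def by (rule foldl_step_simps) simp
  show "reduced X (nf X p)" unfolding nf_def by (rule foldl_step_reduced[OF X reduced_singleton]) simp
  show "last (nf X p) = last p" if "p \<noteq> []"
    using that foldl_step_simps(2)[of "[hd p]" X "tl p"] unfolding nf_def by (cases p) simp_all
qed

lemma nf_elem_homotopy:
  assumes X: "CAT0_cube_complex X" and "elem_homotopy X p q"
  shows "sw X (nf X p) (nf X q)"
  using assms(2)
proof cases
  case (backtrack x y l m)
  let ?S = "nf X (l @ [x])"
  have "sw X (step X (step X ?S y) x) ?S"
    using step_back[OF X, of ?S y] nf_simps[OF X, of "l @ [x]"] by simp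
  then show ?thesis
    using foldl_step_sw[OF X, of _ ?S m] nf_split[of X l x "[y, x] @ m"] nf_split[of X l x m] backtrack by simp
next
  case (square x y z w l m)
  let ?S = "nf X (l @ [x])"
  have "square X (last ?S) y z w" using square nf_simps(2)[OF X, of "l @ [x]"] by (simp add: square_def)
  from step_square[OF X nf_simps(1)[OF X] this]
  show ?thesis
    using foldl_step_sw[OF X, of _ _ m] nf_split[of X l x "[y, z] @ m"] nf_split[of X l x "[w, z] @ m"] square by simp
qed

lemma nf_homotopy:
  assumes X: "CAT0_cube_complex X" and "equivclp (elem_homotopy X) p q"
  shows "sw X (nf X p) (nf X q)"
  using assms(2)
proof (induction rule: equivclp_induct)
  case (step y z)
  then show ?case using nf_elem_homotopy[OF X] sw_sym sw_trans by metis
qed simp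

lemma nf_reduced:
  assumes X: "CAT0_cube_complex X" and "p \<noteq> []" "reduced X p"
  shows "sw X (nf X p) p"
  using assms(2,3)
proof (induction p rule: rev_nonempty_induct)
  case (single x)
  then show ?case by (simp add: nf_def)
next
  case (snoc x xs)
  have "sw X (nf X xs) xs" using snoc reduced_prefix by blast
  moreover have "nf X (xs @ [x]) = step X (nf X xs) x"
    using snoc(1) by (simp add: nf_def)
  moreover have "step X xs x = xs @ [x]"
  proof (rule step_append)
    fix q show "\<not> sw X xs (q @ [x, last xs])"
    proof
      assume "sw X xs (q @ [x, last xs])"
      from sw_append[OF this, of "[x]"] show False using reduced_no_return[OF snoc(3)] by fastforce
    qed
  qed
  ultimately show ?case using step_sw[OF X] by metis
qed

lemma foldl_step_undo:
  assumes X: "CAT0_cube_complex X"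
  shows "reduced X P \<Longrightarrow> P \<noteq> [] \<Longrightarrow>
    sw X (foldl (step X) (foldl (step X) P r) (tl (rev (last P # r)))) P"
proof (induction r arbitrary: P)
  case (Cons a r)
  let ?P = "step X P a"
  have "tl (rev (last P # a # r)) = tl (rev (last ?P # r)) @ [last P]" by (cases r rule: rev_cases) auto
  moreover have "sw X (foldl (step X) (foldl (step X) ?P r) (tl (rev (last ?P # r)))) ?P"
    using Cons.IH[of ?P] reduced_step[OF X] Cons.prems by simp
  ultimately have "sw X (foldl (step X) (foldl (step X) P (a # r)) (tl (rev (last P # a # r)))) (step X ?P (last P))"
    using step_sw[OF X] by simp
  then show ?case using step_back[OF X Cons.prems] sw_trans by metis
qed simp

lemma edge_path_rev: "edge_path X x p y \<Longrightarrow> edge_path X y (rev p) x"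
  unfolding edge_path_def
  by (auto simp: hd_rev last_rev successively_rev elim!: successively_mono intro: adj_sym)

lemma edge_path_join:
  "edge_path X x p y \<Longrightarrow> edge_path X y q z \<Longrightarrow> edge_path X x (p @ tl q) z"
  unfolding edge_path_def
  by (cases q) (auto simp: successively_append_iff successively_Cons last_append)

text \<open>The path \<open>p\<close> followed by \<open>q\<close> backwards is null-homotopic, so
  its normal form is \<open>[v]\<close>. Replaying \<open>q\<close> from there gives the normal form
  of \<open>q\<close>; but the replay also undoes the steps taken backwards along \<open>q\<close>,
  which leaves the normal form of \<open>p\<close>.\<close>

lemma reduced_paths_sw:
  assumes X: "CAT0_cube_complex X" and p: "edge_path X v p u" "reduced X p"
    and q: "edge_path X v q u" "reduced X q"
  shows "sw X p q"
proof -
  have ne: "p \<noteq> []" "q \<noteq> []" and ends: "hd p = v" "hd q = v" "last p = u" "last q = u"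
    using p q unfolding edge_path_def by auto
  have "edge_path X v (p @ tl (rev q)) v" using edge_path_join[OF p(1) edge_path_rev[OF q(1)]] .
  then have "equivclp (elem_homotopy X) (p @ tl (rev q)) [v]"
    using X unfolding CAT0_cube_complex_def simply_connected_complex_def by blast
  then have "sw X (nf X (p @ tl (rev q))) (nf X [v])" by (rule nf_homotopy[OF X])
  moreover have "nf X (p @ tl (rev q)) = foldl (step X) (nf X p) (tl (rev q))"
    using ne by (simp add: nf_def)
  ultimately have 1: "sw X (foldl (step X) (nf X p) (tl (rev q))) [v]" by (simp add: nf_def)
  have "last (nf X p) = u" using nf_simps(2)[OF X] ne ends by simp
  moreover have "u # tl (rev q) = rev q" using ne ends by (metis hd_rev list.collapse rev_is_Nil_conv)
  ultimately have "sw X (foldl (step X) (foldl (step X) (nf X p) (tl (rev q))) (tl q)) (nf X p)"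
    using foldl_step_undo[OF X nf_simps(3)[OF X] nf_simps(1)[OF X], of p "tl (rev q)"] by simp
  moreover have "sw X (foldl (step X) (foldl (step X) (nf X p) (tl (rev q))) (tl q)) (nf X q)"
    using foldl_step_sw[OF X 1, of "tl q"] ends by (simp add: nf_def)
  ultimately have "sw X (nf X p) (nf X q)" using sw_sym sw_trans by metis
  then show ?thesis using nf_reduced[OF X] p(2) q(2) ne sw_sym sw_trans by metis
qed

section \<open>The graph metric, halfspaces and medians\<close>

definition gdist :: "'a cube_complex \<Rightarrow> 'a \<Rightarrow> 'a \<Rightarrow> nat" where
  "gdist X x y = (LEAST n. \<exists>p. edge_path X x p y \<and> length p = Suc n)"

definition side :: "'a cube_complex \<Rightarrow> 'a \<Rightarrow> 'a \<Rightarrow> 'a set" where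
  "side X u v = {z \<in> verts X. gdist X z u < gdist X z v}"

definition gconvex :: "'a cube_complex \<Rightarrow> 'a set \<Rightarrow> bool" where
  "gconvex X D \<longleftrightarrow> D \<subseteq> verts X \<and>
     (\<forall>x\<in>D. \<forall>y\<in>D. \<forall>z\<in>verts X. gdist X x z + gdist X z y = gdist X x y \<longrightarrow> z \<in> D)"

text \<open>Unlike \<open>halfspaces\<close>, this includes the empty set and
  \<open>verts X\<close>, which separate nothing.\<close>

definition ghalfspaces :: "'a cube_complex \<Rightarrow> 'a set set" where
  "ghalfspaces X = {D. gconvex X D \<and> gconvex X (verts X - D)}"

lemma adj_verts:
  assumes "cube_complex X" "adj X x y"
  shows "x \<in> verts X" "y \<in> verts X"
  using cube_complexD(1)[OF assms(1)] assms(2) unfolding adj_def by blast+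

lemma successively_crossing:
  "successively R p \<Longrightarrow> p \<noteq> [] \<Longrightarrow> hd p \<in> D \<Longrightarrow> last p \<notin> D \<Longrightarrow>
     \<exists>a\<in>set p. \<exists>b\<in>set p. R a b \<and> a \<in> D \<and> b \<notin> D"
proof (induction p)
  case (Cons a p)
  show ?case
  proof (cases "p = [] \<or> hd p \<notin> D")
    case True
    then show ?thesis using Cons by (auto simp: successively_Cons intro!: bexI[of _ "hd p"] split: if_splits)
  next
    case False
    then show ?thesis using Cons by (auto simp: successively_Cons split: if_splits)
  qed
qed simp

section \<open>Distances and geodesics\<close>

locale cat0_complex =
  fixes X :: "'a cube_complex"
  assumes X: "CAT0_cube_complex X"
begin

abbreviation V where "V \<equiv> verts X"
abbreviation d where "d \<equiv> gdist X"

lemma cc: "cube_complex X"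
  using X unfolding CAT0_cube_complex_def by simp

lemma sc: "simply_connected_complex X"
  using X unfolding CAT0_cube_complex_def by simp

lemma gdist_path:
  assumes "x \<in> V" "y \<in> V"
  obtains p where "edge_path X x p y" "length p = Suc (d x y)"
proof -
  obtain p where p: "edge_path X x p y" using sc assms unfolding simply_connected_complex_def by blast
  then have "length p = Suc (length p - 1)" unfolding edge_path_def by auto
  then have "\<exists>n p. edge_path X x p y \<and> length p = Suc n" using p by blast
  from LeastI_ex[OF this] show ?thesis using that unfolding gdist_def by blast
qed

lemma gdist_le: "edge_path X x p y \<Longrightarrow> Suc (d x y) \<le> length p"
proof -
  assume p: "edge_path X x p y"
  then obtain n where n: "length p = Suc n" unfolding edge_path_def by (cases p) auto
  then have "d x y \<le> n" unfolding gdist_def using p by (intro Least_le) blast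
  then show ?thesis using n by simp
qed

lemma geodesic_iff:
  assumes "x \<in> V" "y \<in> V"
  shows "geodesic X x p y \<longleftrightarrow> edge_path X x p y \<and> length p = Suc (d x y)"
proof -
  obtain q where "edge_path X x q y" "length q = Suc (d x y)" using gdist_path[OF assms] .
  then show ?thesis using gdist_le unfolding geodesic_def by (metis le_antisym)
qed

lemma gdist_self [simp]: "x \<in> V \<Longrightarrow> d x x = 0"
  using gdist_le[of x "[x]" x] by (auto simp: edge_path_def)

lemma gdist_eq_0: "x \<in> V \<Longrightarrow> y \<in> V \<Longrightarrow> d x y = 0 \<Longrightarrow> x = y"
  by (rule gdist_path[of x y]) (auto simp: edge_path_def length_Suc_conv)

lemma gdist_sym: 
  assumes "x \<in> V" "y \<in> V"
  shows "d x y = d y x"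
proof -
  have "d y x \<le> d x y" if "x \<in> V" "y \<in> V" for x y
  proof -
    obtain p where "edge_path X x p y" "length p = Suc (d x y)" using gdist_path[OF \<open>x \<in> V\<close> \<open>y \<in> V\<close>] .
    then show ?thesis using gdist_le[OF edge_path_rev, of x p y] by simp
  qed
  then show ?thesis using assms by (simp add: le_antisym)
qed

lemma gdist_triangle:
  assumes "x \<in> V" "y \<in> V" "z \<in> V"
  shows "d x z \<le> d x y + d y z"
proof -
  obtain p where p: "edge_path X x p y" "length p = Suc (d x y)" using gdist_path[OF assms(1,2)] .
  obtain q where q: "edge_path X y q z" "length q = Suc (d y z)" using gdist_path[OF assms(2,3)] .
  show ?thesis using gdist_le[OF edge_path_join[OF p(1) q(1)]] p(2) q(2) by simp
qed

lemma edge_path_parity: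
  assumes "edge_path X x p y" "edge_path X x q y"
  shows "even (length p) \<longleftrightarrow> even (length q)"
proof -
  have "odd (length (p @ tl (rev q)))"
    by (rule closed_path_odd[OF sc edge_path_join[OF assms(1) edge_path_rev[OF assms(2)]]])
  moreover have "q \<noteq> []" using assms unfolding edge_path_def by auto
  ultimately show ?thesis by (cases q) auto
qed

lemma edge_path_edge: "adj X u v \<Longrightarrow> edge_path X u [u, v] v"
  using adj_verts[OF cc] unfolding edge_path_def by auto

text \<open>Equality of the two distances is excluded by parity, so each edge has a nearer and a
  farther end.\<close>

lemma gdist_adj:
  assumes "x \<in> V" "adj X u v"
  shows "d x v = d x u + 1 \<or> d x u = d x v + 1"
proof -
  have uv: "u \<in> V" "v \<in> V" using adj_verts[OF cc assms(2)] by auto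
  have 1: "d x v \<le> d x u + 1" if a: "adj X u v" and u: "u \<in> V" for u v
  proof -
    obtain p where p: "edge_path X x p u" "length p = Suc (d x u)" using gdist_path[OF assms(1) u] .
    show ?thesis using gdist_le[OF edge_path_join[OF p(1) edge_path_edge[OF a]]] p(2) by simp
  qed
  obtain p where p: "edge_path X x p u" "length p = Suc (d x u)" using gdist_path[OF assms(1) uv(1)] .
  obtain q where q: "edge_path X x q v" "length q = Suc (d x v)" using gdist_path[OF assms(1) uv(2)] .
  have "d x u \<noteq> d x v"
    using edge_path_parity[OF edge_path_join[OF p(1) edge_path_edge[OF assms(2)]] q(1)] p(2) q(2) by auto
  then show ?thesis using 1[OF assms(2) uv(1)] 1[OF adj_sym[OF assms(2)] uv(2)] by linarith
qed

lemma toward: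
  assumes "x \<in> V" "y \<in> V" "x \<noteq> y"
  obtains x' where "adj X x x'" "x' \<in> V" "d x y = Suc (d x' y)"
proof -
  obtain p where p: "edge_path X x p y" "length p = Suc (d x y)" using gdist_path[OF assms(1,2)] .
  obtain x' p' where p': "p = x # x' # p'"
    using p assms(3) unfolding edge_path_def by (cases p; cases "tl p") auto
  have a: "adj X x x'" and e: "edge_path X x' (x' # p') y" using p(1) unfolding p' edge_path_def by auto
  have x': "x' \<in> V" using adj_verts[OF cc a] by simp
  have "Suc (d x' y) \<le> d x y" using gdist_le[OF e] p(2) unfolding p' by simp
  then have "d x y = Suc (d x' y)"
    using gdist_adj[OF assms(2) a] gdist_sym[OF assms(2)] assms(1) x' by auto
  then show ?thesis using that a x' by blast
qed

lemma on_geodesic_iff: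
  assumes "x \<in> V" "y \<in> V"
  shows "on_geodesic X x y m \<longleftrightarrow> m \<in> V \<and> d x m + d m y = d x y"
proof
  assume "on_geodesic X x y m"
  then obtain p where p: "edge_path X x p y" "length p = Suc (d x y)" "m \<in> set p"
    unfolding on_geodesic_def geodesic_iff[OF assms] by blast
  then have m: "m \<in> V" unfolding edge_path_def by auto
  obtain l r where lr: "p = l @ m # r" using p(3) by (meson split_list)
  have "edge_path X x (l @ [m]) m" "edge_path X m (m # r) y"
    using p(1) unfolding lr edge_path_def by (auto simp: successively_append_iff hd_append split: if_splits)
  from this[THEN gdist_le] have "d x m + d m y \<le> d x y" using p(2) unfolding lr by simp
  then show "m \<in> V \<and> d x m + d m y = d x y" using m gdist_triangle[OF assms(1) m assms(2)] by simp
next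
  assume m: "m \<in> V \<and> d x m + d m y = d x y"
  obtain p where p: "edge_path X x p m" "length p = Suc (d x m)" using gdist_path assms m by blast
  obtain q where q: "edge_path X m q y" "length q = Suc (d m y)" using gdist_path assms m by blast
  have "m \<in> set (p @ tl q)" using p(1) unfolding edge_path_def by (metis UnCI last_in_set set_append)
  then show "on_geodesic X x y m"
    using edge_path_join[OF p(1) q(1)] p(2) q(2) m
    unfolding on_geodesic_def geodesic_iff[OF assms] by (intro exI[of _ "p @ tl q"]) auto
qed

lemma geodesic_reduced:
  assumes "geodesic X x p y"
  shows "reduced X p"
  unfolding reduced_def
proof (intro allI impI notI)
  fix q assume q: "sw X p q" "backtracking q"
  then obtain l a b m where l: "q = l @ [a, b, a] @ m" unfolding backtracking_def by blast
  have "edge_path X x q y" using sw_edge_path[OF q(1) _ cc] assms unfolding geodesic_def by blast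
  then have "edge_path X x (l @ [a] @ m) y"
    unfolding l edge_path_def by (auto simp: successively_append_iff successively_Cons hd_append split: if_splits)
  then have "length p \<le> length (l @ [a] @ m)" using assms unfolding geodesic_def by blast
  then show False using sw_length[OF q(1)] l by simp
qed

text \<open>Two geodesics from \<open>v\<close> to \<open>u\<close> through \<open>a\<close> and
  through \<open>b\<close> are reduced, hence equivalent under square moves, and the exchange
  property provides the square at their end.\<close>

lemma quadrangle:
  assumes v: "v \<in> V" and a: "adj X u a" and b: "adj X u b" and ab: "a \<noteq> b"
    and da: "d v u = d v a + 1" and db: "d v u = d v b + 1"
  obtains w where "w \<in> V" "square X w a u b" "d v a = d v w + 1"
proof -
  have V: "u \<in> V" "a \<in> V" "b \<in> V" using adj_verts[OF cc] a b by blast+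
  have ext: "\<exists>p. edge_path X v (p @ [a, u]) u \<and> length (p @ [a, u]) = Suc (d v u)"
    if "adj X u a" "d v u = d v a + 1" for a
  proof -
    have aV: "a \<in> V" using adj_verts[OF cc that(1)] by simp
    obtain p where p: "edge_path X v p a" "length p = Suc (d v a)" using gdist_path[OF v aV] .
    obtain p' where "p = p' @ [a]" using p(1) unfolding edge_path_def by (metis append_butlast_last_id)
    then show ?thesis
      using edge_path_join[OF p(1) edge_path_edge[OF adj_sym[OF that(1)]]] p(2) that(2) by auto
  qed
  obtain p where p: "edge_path X v (p @ [a, u]) u" "length (p @ [a, u]) = Suc (d v u)"
    using ext[OF a da] by blast
  obtain q where q: "edge_path X v (q @ [b, u]) u" "length (q @ [b, u]) = Suc (d v u)"
    using ext[OF b db] by blast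
  have "geodesic X v (p @ [a, u]) u" "geodesic X v (q @ [b, u]) u"
    unfolding geodesic_iff[OF v V(1)] using p q by blast+
  then have "sw X (p @ [a, u]) (q @ [b, u])"
    using reduced_paths_sw[OF X p(1) _ q(1)] geodesic_reduced by blast
  then show ?thesis
  proof (rule descent_cases[OF X])
    assume "a = b"
    then show ?thesis using ab by simp
  next
    fix r w
    assume w: "square X w a u b" "sw X (p @ [a]) (r @ [w, a])"
    then have aw: "adj X w a" unfolding square_def by auto
    have wV: "w \<in> V" using adj_verts[OF cc aw] by simp
    have "edge_path X v (p @ [a]) a"
      using p(1) unfolding edge_path_def by (auto simp: successively_append_iff hd_append split: if_splits)
    then have "edge_path X v (r @ [w, a]) a" using sw_edge_path[OF w(2) _ cc] by blast
    then have "edge_path X v (r @ [w]) w"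
      unfolding edge_path_def by (auto simp: successively_append_iff hd_append split: if_splits)
    from gdist_le[OF this] have "d v w + 1 \<le> d v a" using sw_length[OF w(2)] p(2) da by simp
    then have "d v a = d v w + 1" using gdist_adj[OF v aw] by auto
    then show ?thesis using that[OF wV w(1)] by blast
  qed
qed

section \<open>Halfspaces cut out by edges\<close>

lemma side_compl:
  assumes "adj X u v"
  shows "V - side X u v = side X v u"
  using gdist_adj[OF _ assms] unfolding side_def by force

lemma side_ends: "adj X u v \<Longrightarrow> u \<in> side X u v" "adj X u v \<Longrightarrow> v \<notin> side X u v"
  using gdist_adj[of u u v] adj_verts[OF cc, of u v] unfolding side_def by auto

text \<open>Otherwise \<open>z\<close> would be equally far from \<open>b\<close> and
  \<open>e\<close>, and nearer to \<open>a\<close> and \<open>c\<close>. The quadrangle condition at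
  \<open>b\<close> then yields a square on \<open>a\<close>, \<open>b\<close>, \<open>c\<close>
  whose fourth corner is nearer to \<open>z\<close> than \<open>a\<close> is, but by
  \<open>square_unique\<close> this corner is \<open>e\<close>.\<close>

lemma side_square_subset:
  assumes s: "square X a b c e"
  shows "side X a b \<subseteq> side X e c"
proof
  fix z assume "z \<in> side X a b"
  then have z: "z \<in> V" "d z a < d z b" unfolding side_def by auto
  have ad: "adj X a b" "adj X b c" "adj X c e" "adj X e a" "a \<noteq> c" using s unfolding square_def by auto
  note dd = gdist_adj[OF z(1) ad(1)] gdist_adj[OF z(1) ad(2)] gdist_adj[OF z(1) ad(3)] gdist_adj[OF z(1) ad(4)]
  show "z \<in> side X e c"
  proof (rule ccontr)
    assume "z \<notin> side X e c"
    then have "\<not> d z e < d z c" using z(1) unfolding side_def by simp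
    then have "d z b = d z a + 1 \<and> d z b = d z c + 1 \<and> d z e = d z b"
      using z(2) dd by linarith
    then have *: "d z b = d z a + 1" "d z b = d z c + 1" "d z e = d z b" by simp_all
    obtain w where w: "square X w a b c" "d z a = d z w + 1"
      using quadrangle[OF z(1) adj_sym[OF ad(1)] ad(2) ad(5) *(1,2)] by blast
    have "w = e" using square_unique[OF cc square_rot[OF w(1)] s] .
    then show False using w(2) * by simp
  qed
qed

lemma side_square:
  assumes "square X a b c e"
  shows "side X a b = side X e c"
proof
  have "square X e c b a" using square_rot[OF square_flip[OF assms]] .
  then show "side X e c \<subseteq> side X a b" by (rule side_square_subset)
qed (rule side_square_subset[OF assms])

text \<open>A ladder of squares joins the edge from \<open>p\<close> to \<open>q\<close> to the edge
  from \<open>u\<close> to \<open>v\<close>, and \<open>side_square\<close> carries the halfspace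
  along it. Each square comes from the quadrangle condition at \<open>p\<close> as seen from
  \<open>v\<close>.\<close>

lemma side_crossing:
  assumes uv: "adj X u v"
  shows "p \<in> side X u v \<Longrightarrow> q \<notin> side X u v \<Longrightarrow> adj X p q \<Longrightarrow> side X p q = side X u v"
proof (induction "d p u" arbitrary: p q rule: less_induct)
  case less
  have V: "u \<in> V" "v \<in> V" "p \<in> V" "q \<in> V" using adj_verts[OF cc] uv less(4) by blast+
  have pu: "d p u < d p v" using less(2) unfolding side_def by auto
  have qv: "d q v < d q u" using gdist_adj[OF V(4) uv] less(3) V unfolding side_def by auto
  note dd = gdist_adj[OF V(3) uv] gdist_adj[OF V(4) uv] gdist_adj[OF V(1) less(4)] gdist_adj[OF V(2) less(4)]
  note sy = gdist_sym[OF V(3,1)] gdist_sym[OF V(3,2)] gdist_sym[OF V(4,1)] gdist_sym[OF V(4,2)]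
  have "d p v = d p u + 1 \<and> d q u = d p u + 1 \<and> d q v = d p u" using pu qv dd sy by linarith
  then have k: "d p v = d p u + 1" "d q u = d p u + 1" "d q v = d p u" by simp_all
  show ?case
  proof (cases "p = u")
    case True
    then have "q = v" using k V gdist_eq_0 by simp
    then show ?thesis using True by simp
  next
    case False
    obtain p' where p': "adj X p p'" "p' \<in> V" "d p u = Suc (d p' u)" using toward[OF V(3,1) False] .
    have p'v: "d p u = d p' v"
      using gdist_adj[OF V(2) p'(1)] gdist_adj[OF p'(2) uv] k p'(3) gdist_sym[OF V(2) p'(2)] gdist_sym[OF V(2,3)]
      by linarith
    have ne: "p' \<noteq> q" using k p'(3) by auto
    obtain q' where q': "q' \<in> V" "square X q' p' p q" "d v p' = d v q' + 1"
      by (rule quadrangle[OF V(2) p'(1) less(4) ne])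
        (use k p'v gdist_sym[OF V(2)] p'(2) V in auto)
    have a: "adj X p' q'" "adj X q q'" using q'(2) unfolding square_def by (auto intro: adj_sym)
    have "d q' v + 1 = d p u" using q'(3) p'v gdist_sym[OF V(2)] p'(2) q'(1) by simp
    then have "d q' v < d q' u"
      using k gdist_sym[OF V(1,4)] gdist_sym[OF V(1) q'(1)] gdist_adj[OF V(1) a(2)] by linarith
    then have "q' \<notin> side X u v" unfolding side_def by simp
    moreover have "p' \<in> side X u v" using p' p'v unfolding side_def by auto
    ultimately have "side X p' q' = side X u v" using less(1)[of p' q'] p'(3) a(1) by simp
    moreover have "square X p' q' q p" using square_rot[OF square_rot[OF square_rot[OF square_flip[OF q'(2)]]]] .
    then have "side X p' q' = side X p q" by (rule side_square)
    ultimately show ?thesis by simp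
  qed
qed

lemma first_crossing:
  assumes "x \<in> V" "x \<in> D" 
  shows "z \<in> V \<Longrightarrow> z \<notin> D \<Longrightarrow>
    \<exists>p q. adj X p q \<and> p \<in> D \<and> q \<notin> D \<and> d x q = d x p + 1 \<and> d x q + d q z = d x z"
proof (induction "d z x" arbitrary: z rule: less_induct)
  case less
  then have "z \<noteq> x" using assms by auto
  then obtain z' where z': "adj X z z'" "z' \<in> V" "d z x = Suc (d z' x)" using toward less(2) assms(1) by blast
  have sy: "d x z = Suc (d x z')" using z' gdist_sym assms less(2) by metis
  show ?case
  proof (cases "z' \<in> D")
    case True
    then show ?thesis using less(2,3) z' sy adj_sym[OF z'(1)] by (intro exI[of _ z'] exI[of _ z]) auto
  next
    case False
    then obtain p q where pq: "adj X p q" "p \<in> D" "q \<notin> D" "d x q = d x p + 1" "d x q + d q z' = d x z'"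
      using less(1)[of z'] z' by auto
    have q: "q \<in> V" using adj_verts[OF cc pq(1)] by simp
    have "d q z \<le> d q z' + 1" using gdist_adj[OF q z'(1)] by auto
    then have "d x q + d q z = d x z" using pq(5) sy gdist_triangle[OF assms(1) q less(2)] by simp
    then show ?thesis using pq by blast
  qed
qed

text \<open>A geodesic that left the halfspace would cross an edge from \<open>p\<close> to
  \<open>q\<close> with \<open>y\<close> nearer to \<open>q\<close>. By \<open>side_crossing\<close>
  this edge cuts out the same halfspace, so \<open>y\<close> would be outside.\<close>

lemma side_gconvex:
  assumes uv: "adj X u v"
  shows "gconvex X (side X u v)"
  unfolding gconvex_def
proof (intro conjI ballI impI)
  show "side X u v \<subseteq> V" unfolding side_def by auto
  fix x y z assume x: "x \<in> side X u v" and y: "y \<in> side X u v" and z: "z \<in> V" and xyz: "d x z + d z y = d x y"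
  show "z \<in> side X u v"
  proof (rule ccontr)
    assume nz: "z \<notin> side X u v"
    have V: "x \<in> V" "y \<in> V" using x y unfolding side_def by auto
    obtain p q where pq: "adj X p q" "p \<in> side X u v" "q \<notin> side X u v" "d x q = d x p + 1"
      "d x q + d q z = d x z" using first_crossing[OF V(1) x z nz] by blast
    have V': "p \<in> V" "q \<in> V" using adj_verts[OF cc pq(1)] by auto
    have "d q y < d p y"
      using gdist_triangle[OF V'(2) z V(2)] gdist_triangle[OF V(1) V'(1) V(2)] pq(4,5) xyz by linarith
    then have "y \<notin> side X p q" using gdist_sym V V' unfolding side_def by auto
    then show False using side_crossing[OF uv pq(2,3,1)] y by simp
  qed
qed

lemma side_ghalfspace: "adj X u v \<Longrightarrow> side X u v \<in> ghalfspaces X"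
  unfolding ghalfspaces_def using side_gconvex side_compl adj_sym by (metis (mono_tags) mem_Collect_eq)

lemma gconvexD:
  "gconvex X D \<Longrightarrow> x \<in> D \<Longrightarrow> y \<in> D \<Longrightarrow> z \<in> V \<Longrightarrow> d x z + d z y = d x y \<Longrightarrow> z \<in> D"
  unfolding gconvex_def by blast

text \<open>If a vertex of \<open>D\<close> were nearer to \<open>q\<close> than to
  \<open>p\<close>, then \<open>q\<close> would lie on a geodesic between two vertices of
  \<open>D\<close>; likewise for the complement. As any crossing edge determines the halfspace, a
  path crosses only finitely many.\<close>

lemma ghalfspace_eq_side:
  assumes D: "D \<in> ghalfspaces X" and pq: "adj X p q" "p \<in> D" "q \<notin> D"
  shows "D = side X p q"
proof -
  have V: "p \<in> V" "q \<in> V" using adj_verts[OF cc pq(1)] by auto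
  have c: "gconvex X D" "gconvex X (V - D)" using D unfolding ghalfspaces_def by auto
  have pq1: "d p q = 1" using gdist_adj[OF V(1) pq(1)] V by simp
  show ?thesis
  proof (intro Set.set_eqI iffI)
    fix z assume z: "z \<in> D"
    then have zV: "z \<in> V" using c(1) unfolding gconvex_def by auto
    have "\<not> d z p = d z q + 1"
    proof
      assume "d z p = d z q + 1"
      then have "d z q + d q p = d z p" using pq1 gdist_sym V by simp
      then have "q \<in> D" using gconvexD[OF c(1) z pq(2) V(2)] by simp
      then show False using pq(3) by simp
    qed
    then show "z \<in> side X p q" using gdist_adj[OF zV pq(1)] zV unfolding side_def by auto
  next
    fix z assume z: "z \<in> side X p q"
    then have zV: "z \<in> V" and "d z p < d z q" unfolding side_def by auto
    then have "d z p + d p q = d z q" using gdist_adj[OF zV pq(1)] pq1 by linarith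
    show "z \<in> D"
    proof (rule ccontr)
      assume "z \<notin> D"
      then have "p \<in> V - D" using gconvexD[OF c(2), of z q p] zV V pq(3) \<open>d z p + d p q = d z q\<close> by simp
      then show False using pq(2) by simp
    qed
  qed
qed

lemma ghalfspace_separation:
  assumes "x \<in> V" "y \<in> V" "x \<noteq> y"
  shows "\<exists>D\<in>ghalfspaces X. x \<in> D \<and> y \<notin> D"
proof -
  obtain x' where x': "adj X x x'" "x' \<in> V" "d x y = Suc (d x' y)" using toward[OF assms] .
  then have "y \<notin> side X x x'" using gdist_sym assms unfolding side_def by auto
  then show ?thesis using side_ghalfspace[OF x'(1)] side_ends(1)[OF x'(1)] by blast
qed

lemma finite_ghalfspace_separators:
  assumes "x \<in> V" "y \<in> V"
  shows "finite {D \<in> ghalfspaces X. x \<in> D \<and> y \<notin> D}"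
proof -
  obtain p where p: "edge_path X x p y" using gdist_path[OF assms] .
  have "{D \<in> ghalfspaces X. x \<in> D \<and> y \<notin> D} \<subseteq> (\<lambda>(u, v). side X u v) ` (set p \<times> set p)"
  proof
    fix D assume D: "D \<in> {D \<in> ghalfspaces X. x \<in> D \<and> y \<notin> D}"
    then obtain u v where "u \<in> set p" "v \<in> set p" "adj X u v" "u \<in> D" "v \<notin> D"
      using p successively_crossing[of "adj X" p D] unfolding edge_path_def by auto
    then show "D \<in> (\<lambda>(u, v). side X u v) ` (set p \<times> set p)"
      using ghalfspace_eq_side[of D u v] D by (auto intro!: rev_image_eqI[of "(u, v)"])
  qed
  then show ?thesis by (rule finite_subset) auto
qed

text \<open>Move \<open>z\<close> to a neighbour \<open>z'\<close> nearer to \<open>y\<close>. If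
  \<open>z'\<close> is also nearer to \<open>x\<close>, its median serves for \<open>z\<close>.
  Otherwise either this median is \<open>z'\<close>, and then \<open>z\<close> lies between
  \<open>x\<close> and \<open>y\<close>, or a quadrangle at \<open>z'\<close> yields a neighbour
  \<open>w\<close> of \<open>z\<close> that is nearer to both \<open>x\<close> and \<open>y\<close>,
  and the median for \<open>w\<close> serves.\<close>

lemma median_exists:
  assumes x: "x \<in> V" and y: "y \<in> V"
  shows "z \<in> V \<Longrightarrow> \<exists>m\<in>V. d x m + d m y = d x y \<and> d y m + d m z = d y z \<and> d x m + d m z = d x z"
proof (induction "d z y" arbitrary: z rule: less_induct)
  case less
  note z = less(2)
  show ?case
  proof (cases "z = y")
    case True
    then show ?thesis using y by (intro bexI[of _ y]) auto
  next
    case False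
    obtain z' where z': "adj X z z'" "z' \<in> V" "d z y = Suc (d z' y)" using toward[OF z y False] .
    obtain m where m: "m \<in> V" "d x m + d m y = d x y" "d y m + d m z' = d y z'" "d x m + d m z' = d x z'"
      using less(1)[of z'] z' by auto
    have zz': "d z' z = 1" using gdist_adj[OF z'(2) z'(1)] z'(2) by simp
    have sy: "d y z = Suc (d y z')" "d y z' = d z' y" using z' gdist_sym y z by metis+
    consider (far) "d x z = d x z' + 1" | (mz) "d x z' = d x z + 1" "m = z'" | (near) "d x z' = d x z + 1" "m \<noteq> z'"
      using gdist_adj[OF x z'(1)] by auto
    then show ?thesis
    proof cases
      case far
      have "d m z \<le> d m z' + 1" using gdist_adj[OF m(1) z'(1)] by auto
      then have "d y m + d m z = d y z" "d x m + d m z = d x z"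
        using gdist_triangle[OF y m(1) z] gdist_triangle[OF x m(1) z] m sy far by linarith+
      then show ?thesis using m by blast
    next
      case mz
      then have "d x z + d z y = d x y" using m z' sy by simp
      then show ?thesis using z by (intro bexI[of _ z]) auto
    next
      case near
      obtain t where t: "adj X z' t" "t \<in> V" "d z' m = Suc (d t m)" using toward[OF z'(2) m(1)] near by blast
      have sm: "d m z' = Suc (d m t)" using t gdist_sym m(1) z'(2) by metis
      have xt: "d x z' = d x t + 1"
        using gdist_adj[OF x t(1)] gdist_triangle[OF x m(1) t(2)] m(4) sm by linarith
      have yt: "d y z' = d y t + 1"
        using gdist_adj[OF y t(1)] gdist_triangle[OF y m(1) t(2)] m(3) sm by linarith
      have "z \<noteq> t" using yt sy by auto
      then obtain w where w: "w \<in> V" "square X w z z' t" "d x z = d x w + 1"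
        using quadrangle[OF x adj_sym[OF z'(1)] t(1) _ near(1) xt] by blast
      have a: "adj X w z" "adj X t w" using w(2) unfolding square_def by auto
      have yw: "d y z = d y w + 1"
        using gdist_adj[OF y a(1)] gdist_adj[OF y a(2)] sy yt by linarith
      have "d w y < d z y" using yw gdist_sym y z w(1) by simp
      then obtain n where n: "n \<in> V" "d x n + d n y = d x y" "d y n + d n w = d y w" "d x n + d n w = d x w"
        using less(1)[of w] w(1) by auto
      have "d n z \<le> d n w + 1" using gdist_adj[OF n(1) a(1)] by auto
      then have "d y n + d n z = d y z" "d x n + d n z = d x z"
        using gdist_triangle[OF y n(1) z] gdist_triangle[OF x n(1) z] n yw w(3) by linarith+
      then show ?thesis using n by blast
    qed
  qed
qed

text \<open>Since a halfspace and its complement are both convex, a median lies on the side of the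
  majority. By separation, this also makes it unique.\<close>

lemma vertex_median:
  assumes "x \<in> V" "y \<in> V" "z \<in> V"
  shows "vertex_median X x y z \<in> V"
    and "D \<in> ghalfspaces X \<Longrightarrow> vertex_median X x y z \<in> D \<longleftrightarrow>
      x \<in> D \<and> y \<in> D \<or> y \<in> D \<and> z \<in> D \<or> x \<in> D \<and> z \<in> D"
proof -
  let ?P = "\<lambda>m. m \<in> V \<and> d x m + d m y = d x y \<and> d y m + d m z = d y z \<and> d x m + d m z = d x z"
  have maj: "m \<in> D \<longleftrightarrow> x \<in> D \<and> y \<in> D \<or> y \<in> D \<and> z \<in> D \<or> x \<in> D \<and> z \<in> D"
    if m: "?P m" and D: "D \<in> ghalfspaces X" for m D
  proof -
    have c: "gconvex X D" "gconvex X (V - D)" using D unfolding ghalfspaces_def by simp_all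
    have "m \<in> E" if "gconvex X E" "x \<in> E \<and> y \<in> E \<or> y \<in> E \<and> z \<in> E \<or> x \<in> E \<and> z \<in> E" for E
      using that(2) gconvexD[OF that(1)] m by metis
    from this[OF c(1)] this[OF c(2)] show ?thesis using assms m by blast
  qed
  have eq: "vertex_median X x y z = (THE m. ?P m)"
    unfolding vertex_median_def
    using on_geodesic_iff[OF assms(1,2)] on_geodesic_iff[OF assms(2,3)] on_geodesic_iff[OF assms(1,3)]
    by (intro arg_cong[of _ _ The]) auto
  have "\<exists>!m. ?P m"
  proof (rule ex_ex1I)
    show "\<exists>m. ?P m" using median_exists[OF assms] by blast
    fix m n assume "?P m" "?P n"
    then show "m = n" using maj[of m] maj[of n] ghalfspace_separation[of m n] by blast
  qed
  from theI'[OF this] have P: "?P (vertex_median X x y z)" unfolding eq .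
  then show "vertex_median X x y z \<in> V" by blast
  show "vertex_median X x y z \<in> D \<longleftrightarrow> x \<in> D \<and> y \<in> D \<or> y \<in> D \<and> z \<in> D \<or> x \<in> D \<and> z \<in> D"
    if "D \<in> ghalfspaces X" using maj[OF P that] .
qed

lemma ghalfspace_subset: "D \<in> ghalfspaces X \<Longrightarrow> D \<subseteq> V"
  unfolding ghalfspaces_def gconvex_def by blast

lemma ghalfspace_compl: "D \<in> ghalfspaces X \<Longrightarrow> V - D \<in> ghalfspaces X"
  using double_diff[OF ghalfspace_subset subset_refl, of D] unfolding ghalfspaces_def by simp

section \<open>Cubical automorphisms and halfspaces\<close>

lemma gdist_image_le:
  assumes f: "inj_on f V" "f ` V \<subseteq> V" "\<And>C. C \<in> cubes X \<Longrightarrow> f ` C \<in> cubes X" and "x \<in> V" "y \<in> V"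
  shows "d (f x) (f y) \<le> d x y"
proof -
  obtain p where p: "edge_path X x p y" "length p = Suc (d x y)" using gdist_path[OF assms(4,5)] .
  have adj: "adj X (f u) (f v)" if uv: "adj X u v" for u v
  proof -
    have "f ` {u, v} \<in> cubes X" using f(3) uv unfolding adj_def by blast
    moreover have "f u \<noteq> f v"
      using inj_onD[OF f(1), of u v] adj_verts[OF cc uv] uv unfolding adj_def by blast
    ultimately show ?thesis unfolding adj_def by simp
  qed
  have "successively (adj X) (map f p)"
    using p(1) adj unfolding edge_path_def successively_map by (blast intro: successively_mono)
  then have "edge_path X (f x) (map f p) (f y)"
    using p(1) f(2) unfolding edge_path_def by (simp add: hd_map last_map) blast
  from gdist_le[OF this] show ?thesis using p(2) by simp
qed

lemma gdist_action:
  assumes "cubical_action G X \<phi>" "g \<in> carrier G" "x \<in> V" "y \<in> V"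
  shows "d (\<phi> g x) (\<phi> g y) = d x y"
proof -
  interpret group_action G V \<phi> using assms(1) unfolding cubical_action_def by simp
  have le: "d (\<phi> g x) (\<phi> g y) \<le> d x y" if g: "g \<in> carrier G" and xy: "x \<in> V" "y \<in> V" for g x y
  proof (rule gdist_image_le[OF _ _ _ xy])
    show "inj_on (\<phi> g) V" "\<phi> g ` V \<subseteq> V" using inj_prop[OF g] surj_prop[OF g] by simp_all
    show "\<phi> g ` C \<in> cubes X" if "C \<in> cubes X" for C
      using assms(1) g that unfolding cubical_action_def by blast
  qed
  have "inv\<^bsub>G\<^esub> g \<in> carrier G" using group_hom assms(2) by (simp add: group_hom_def)
  from le[OF this, of "\<phi> g x" "\<phi> g y"] have "d x y \<le> d (\<phi> g x) (\<phi> g y)"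
    using orbit_sym_aux[OF assms(2)] assms(3,4) element_image[OF assms(2)] by simp
  then show ?thesis using le[OF assms(2-4)] by simp
qed

lemma ghalfspace_pull:
  assumes "cubical_action G X \<phi>" "g \<in> carrier G" "D \<in> ghalfspaces X"
  shows "{x \<in> V. \<phi> g x \<in> D} \<in> ghalfspaces X"
proof -
  interpret group_action G V \<phi> using assms(1) unfolding cubical_action_def by simp
  have im: "\<phi> g x \<in> V" if "x \<in> V" for x using element_image[OF assms(2) that] by simp
  have pull: "gconvex X {x \<in> V. \<phi> g x \<in> D}" if D: "gconvex X D" for D
    unfolding gconvex_def
  proof (intro conjI ballI impI)
    fix x y z assume x: "x \<in> {x \<in> V. \<phi> g x \<in> D}" and y: "y \<in> {x \<in> V. \<phi> g x \<in> D}"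
      and z: "z \<in> V" and e: "d x z + d z y = d x y"
    have "d (\<phi> g x) (\<phi> g z) + d (\<phi> g z) (\<phi> g y) = d (\<phi> g x) (\<phi> g y)"
      using gdist_action[OF assms(1,2)] x y z e by simp
    then show "z \<in> {x \<in> V. \<phi> g x \<in> D}" using gconvexD[OF D _ _ im[OF z]] x y z by blast
  qed blast
  have "{x \<in> V. \<phi> g x \<in> V - D} = V - {x \<in> V. \<phi> g x \<in> D}" using im by blast
  then show ?thesis using pull[of D] pull[of "V - D"] assms(3) unfolding ghalfspaces_def by simp
qed

end

section \<open>Halfspaces under an abelian normal subgroup\<close>

lemma finite_uniform_bound:
  fixes P :: "'b \<Rightarrow> int \<Rightarrow> bool"
  assumes "finite F" "\<And>D. D \<in> F \<Longrightarrow> \<exists>N. \<forall>n\<ge>N. P D n"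
  shows "\<exists>N. \<forall>n\<ge>N. \<forall>D\<in>F. P D n"
  using assms
proof (induction F rule: finite_induct)
  case (insert D F)
  obtain N where "\<forall>n\<ge>N. \<forall>D\<in>F. P D n" using insert by auto
  moreover obtain M where "\<forall>n\<ge>M. P D n" using insert(4)[OF insertI1] by blast
  ultimately have "\<forall>n\<ge>max N M. \<forall>D\<in>insert D F. P D n" by auto
  then show ?case by blast
qed simp

lemma finite_int_bounded:
  assumes "finite (I :: int set)"
  shows "\<exists>N. \<forall>n\<ge>N. n \<notin> I"
proof -
  have "\<exists>N. \<forall>n\<ge>N. \<forall>i\<in>I. n \<noteq> i"
  proof (rule finite_uniform_bound[OF assms])
    fix i :: int
    have "\<forall>n\<ge>i + 1. n \<noteq> i" by auto
    then show "\<exists>N. \<forall>n\<ge>N. n \<noteq> i" by blast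
  qed
  then show ?thesis by blast
qed

lemma int_step:
  fixes P :: "int \<Rightarrow> bool"
  assumes "\<not> P i" "P j" "i \<le> j"
  shows "\<exists>k\<ge>i. k < j \<and> \<not> P k \<and> P (k + 1)"
  using assms(3,2)
proof (induction j rule: int_ge_induct)
  case base
  then show ?case using assms(1) by simp
next
  case (step j)
  show ?case
  proof (cases "P j")
    case True
    then obtain k where "k \<ge> i" "k < j" "\<not> P k" "P (k + 1)" using step by blast
    then show ?thesis by (intro exI[of _ k]) simp
  next
    case False
    then show ?thesis using step by (intro exI[of _ j]) simp
  qed
qed

text \<open>From here on the complex is present only through its halfspaces \<open>HH\<close>: the
  majority rule, separation of points, finiteness of separators and invariance under
  \<open>G\<close>. Identities between medians are checked halfspace by halfspace.\<close>

locale wall_action = group_action G V \<phi> for G (structure) and V :: "'x set" and \<phi> +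
  fixes m :: "'x \<Rightarrow> 'x \<Rightarrow> 'x \<Rightarrow> 'x" and HH :: "'x set set" and A and S
  assumes V_nonempty: "V \<noteq> {}"
    and med_closed: "\<lbrakk>x \<in> V; y \<in> V; z \<in> V\<rbrakk> \<Longrightarrow> m x y z \<in> V"
    and HH_subset: "D \<in> HH \<Longrightarrow> D \<subseteq> V"
    and HH_compl: "D \<in> HH \<Longrightarrow> V - D \<in> HH"
    and HH_majority: "\<lbrakk>D \<in> HH; x \<in> V; y \<in> V; z \<in> V\<rbrakk> \<Longrightarrow>
      m x y z \<in> D \<longleftrightarrow> x \<in> D \<and> y \<in> D \<or> y \<in> D \<and> z \<in> D \<or> x \<in> D \<and> z \<in> D"
    and HH_separation: "\<lbrakk>x \<in> V; y \<in> V; x \<noteq> y\<rbrakk> \<Longrightarrow> \<exists>D\<in>HH. x \<in> D \<and> y \<notin> D"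
    and HH_finite: "\<lbrakk>x \<in> V; y \<in> V\<rbrakk> \<Longrightarrow> finite {D \<in> HH. x \<in> D \<and> y \<notin> D}"
    and HH_pull: "\<lbrakk>g \<in> carrier G; D \<in> HH\<rbrakk> \<Longrightarrow> {x \<in> V. \<phi> g x \<in> D} \<in> HH"
    and A_normal: "A \<lhd> G"
    and A_commute: "\<lbrakk>a \<in> A; b \<in> A\<rbrakk> \<Longrightarrow> a \<otimes> b = b \<otimes> a"
    and S_finite: "finite S"
    and S_generates: "generate G S = A"
begin

lemma G_group: "group G"
  using group_hom by (simp add: group_hom_def)

sublocale group G by (rule G_group)

lemma A_subgroup: "subgroup A G"
  using A_normal by (rule normal_imp_subgroup)

lemma A_carrier [simp]: "a \<in> A \<Longrightarrow> a \<in> carrier G"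
  using subgroup.mem_carrier[OF A_subgroup] .

lemma A_closed [simp]:
  "\<one> \<in> A" "a \<in> A \<Longrightarrow> inv a \<in> A" "a \<in> A \<Longrightarrow> b \<in> A \<Longrightarrow> a \<otimes> b \<in> A" "a \<in> A \<Longrightarrow> a [^] (n :: int) \<in> A"
  using subgroup.one_closed[OF A_subgroup] subgroup.m_inv_closed[OF A_subgroup]
    subgroup.m_closed[OF A_subgroup] subgroup_int_pow_closed[OF A_subgroup] by auto

lemma S_subset: "s \<in> S \<Longrightarrow> s \<in> A"
  using generate.incl[of s S G] unfolding S_generates .

lemma A_conjugate: "g \<in> carrier G \<Longrightarrow> a \<in> A \<Longrightarrow> g \<otimes> a \<otimes> inv g \<in> A"
  using normal.inv_op_closed2[OF A_normal] .

lemma act_closed [simp]: "g \<in> carrier G \<Longrightarrow> x \<in> V \<Longrightarrow> \<phi> g x \<in> V"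
  using element_image by blast

lemma act_one [simp]: "x \<in> V \<Longrightarrow> \<phi> \<one> x = x"
  using id_eq_one by (metis restrict_apply')

lemma act_mult: "g \<in> carrier G \<Longrightarrow> h \<in> carrier G \<Longrightarrow> x \<in> V \<Longrightarrow> \<phi> (g \<otimes> h) x = \<phi> g (\<phi> h x)"
  using composition_rule by blast

lemma act_inv [simp]:
  "g \<in> carrier G \<Longrightarrow> x \<in> V \<Longrightarrow> \<phi> (inv g) (\<phi> g x) = x"
  "g \<in> carrier G \<Longrightarrow> x \<in> V \<Longrightarrow> \<phi> g (\<phi> (inv g) x) = x"
  using act_mult[of "inv g" g x] act_mult[of g "inv g" x] by simp_all

lemma act_commute: "a \<in> A \<Longrightarrow> b \<in> A \<Longrightarrow> x \<in> V \<Longrightarrow> \<phi> a (\<phi> b x) = \<phi> b (\<phi> a x)"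
  using act_mult A_commute A_carrier by metis

text \<open>Preimages rather than images: \<open>pull g D\<close> is the translate of
  \<open>D\<close> by the inverse of \<open>g\<close>, so \<open>pull\<close> reverses products, but
  membership simplifies without inverses.\<close>

definition pull :: "'a \<Rightarrow> 'x set \<Rightarrow> 'x set" where
  "pull g D = {x \<in> V. \<phi> g x \<in> D}"

lemma pull_HH [simp]: "g \<in> carrier G \<Longrightarrow> D \<in> HH \<Longrightarrow> pull g D \<in> HH"
  unfolding pull_def by (rule HH_pull)

lemma mem_pull [simp]: "x \<in> V \<Longrightarrow> x \<in> pull g D \<longleftrightarrow> \<phi> g x \<in> D"
  unfolding pull_def by simp

lemma pull_mult: "g \<in> carrier G \<Longrightarrow> h \<in> carrier G \<Longrightarrow> pull (g \<otimes> h) D = pull h (pull g D)"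
  unfolding pull_def by (auto simp: act_mult)

lemma pull_one: "D \<in> HH \<Longrightarrow> pull \<one> D = D"
  unfolding pull_def using HH_subset[of D] by (auto simp: subset_iff)

lemma pull_inv:
  "g \<in> carrier G \<Longrightarrow> D \<in> HH \<Longrightarrow> pull g (pull (inv g) D) = D"
  "g \<in> carrier G \<Longrightarrow> D \<in> HH \<Longrightarrow> pull (inv g) (pull g D) = D"
  using pull_mult[of "inv g" g D] pull_mult[of g "inv g" D] pull_one by simp_all

lemma pull_commute: "a \<in> A \<Longrightarrow> b \<in> A \<Longrightarrow> pull a (pull b D) = pull b (pull a D)"
  using pull_mult A_commute A_carrier by metis

lemma pull_compl: "g \<in> carrier G \<Longrightarrow> pull g (V - D) = V - pull g D"
  unfolding pull_def by auto

lemma compl_compl: "D \<in> HH \<Longrightarrow> V - (V - D) = D"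
  using HH_subset by blast

lemma act_median:
  assumes "g \<in> carrier G" "x \<in> V" "y \<in> V" "z \<in> V"
  shows "\<phi> g (m x y z) = m (\<phi> g x) (\<phi> g y) (\<phi> g z)"
proof (rule ccontr)
  assume "\<phi> g (m x y z) \<noteq> m (\<phi> g x) (\<phi> g y) (\<phi> g z)"
  then obtain D where D: "D \<in> HH" "\<phi> g (m x y z) \<in> D" "m (\<phi> g x) (\<phi> g y) (\<phi> g z) \<notin> D"
    using HH_separation[of "\<phi> g (m x y z)" "m (\<phi> g x) (\<phi> g y) (\<phi> g z)"] assms
      med_closed[OF assms(2-4)] med_closed[of "\<phi> g x" "\<phi> g y" "\<phi> g z"] by auto
  have "m x y z \<in> pull g D" using D assms med_closed by simp
  then have "m (\<phi> g x) (\<phi> g y) (\<phi> g z) \<in> D"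
    using HH_majority[of "pull g D" x y z] HH_majority[of D "\<phi> g x" "\<phi> g y" "\<phi> g z"] D assms by simp
  then show False using D by simp
qed

section \<open>Dynamics of a single element\<close>

abbreviation pw :: "'a \<Rightarrow> int \<Rightarrow> 'x \<Rightarrow> 'x" where
  "pw a n x \<equiv> \<phi> (a [^] n) x"

lemma pw_add: "a \<in> A \<Longrightarrow> x \<in> V \<Longrightarrow> pw a (i + j) x = pw a i (pw a j x)"
  using act_mult[of "a [^] i" "a [^] j" x] int_pow_mult[of a i j] by simp

lemma pw_inv: "a \<in> A \<Longrightarrow> pw (inv a) n x = pw a (- n) x"
  by (simp add: int_pow_inv int_pow_neg)

lemma pull_pw_add: "a \<in> A \<Longrightarrow> pull (a [^] (i + j :: int)) D = pull (a [^] i) (pull (a [^] j) D)"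
  using pull_mult[of "a [^] j" "a [^] i" D] int_pow_mult[of a j i] by (simp add: add.commute)

definition periodic :: "'a \<Rightarrow> 'x set \<Rightarrow> bool" where
  "periodic a D \<longleftrightarrow> (\<exists>k>0::int. pull (a [^] k) D = D)"

text \<open>With \<open>inv a\<close> in place of \<open>a\<close>, the same predicate describes the
  backward ends of the orbits.\<close>

definition ev :: "'a \<Rightarrow> 'x set \<Rightarrow> bool" where
  "ev a D \<longleftrightarrow> (\<forall>x\<in>V. \<exists>N. \<forall>n\<ge>N. pw a n x \<in> D)"

text \<open>
  Relative to \<open>a\<close>, a non-periodic halfspace or its complement is either crossed in the direction
  of \<open>a\<close> (\<open>skewered\<close>), or contains both ends of every orbit (\<open>peripheral\<close>).
\<close>

definition skewered :: "'a \<Rightarrow> 'x set \<Rightarrow> bool" where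
  "skewered a D \<longleftrightarrow> D \<in> HH \<and> ev a D \<and> ev (inv a) (V - D)"

definition peripheral :: "'a \<Rightarrow> 'x set \<Rightarrow> bool" where
  "peripheral a D \<longleftrightarrow> D \<in> HH \<and> \<not> periodic a D \<and> ev a D \<and> ev (inv a) D"

lemma ev_inv: "a \<in> A \<Longrightarrow> ev (inv a) D \<longleftrightarrow> (\<forall>x\<in>V. \<exists>N. \<forall>n\<ge>N. pw a (- n) x \<in> D)"
  unfolding ev_def by (simp add: pw_inv)

lemma periodic_multiple:
  assumes "a \<in> A" "D \<in> HH" "pull (a [^] (k :: int)) D = D"
  shows "pull (a [^] (k * int n)) D = D"
proof (induction n)
  case 0
  then show ?case using assms pull_one by simp
next
  case (Suc n)
  have "k * int (Suc n) = k + k * int n" by (simp add: algebra_simps)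
  then show ?case using Suc assms pull_pw_add[OF assms(1)] by metis
qed

lemma periodic_pull:
  assumes "a \<in> A" "b \<in> A" "periodic a D"
  shows "periodic a (pull b D)"
  using assms pull_commute A_closed(4) unfolding periodic_def by metis

lemma periodic_pull_iff: "a \<in> A \<Longrightarrow> b \<in> A \<Longrightarrow> D \<in> HH \<Longrightarrow> periodic a (pull b D) \<longleftrightarrow> periodic a D"
  using periodic_pull[of a b D] periodic_pull[of a "inv b" "pull b D"] pull_inv(2)[of b D] by auto

lemma ev_pull:
  assumes "a \<in> A" "b \<in> A" "ev a D"
  shows "ev a (pull b D)"
  unfolding ev_def
proof
  fix x assume x: "x \<in> V"
  then obtain N where "\<forall>n\<ge>N. pw a n (\<phi> b x) \<in> D" using assms unfolding ev_def by fastforce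
  then have "\<forall>n\<ge>N. pw a n x \<in> pull b D" using act_commute[of _ b x] x assms by simp
  then show "\<exists>N. \<forall>n\<ge>N. pw a n x \<in> pull b D" by blast
qed

lemma skewered_pull: "a \<in> A \<Longrightarrow> b \<in> A \<Longrightarrow> skewered a D \<Longrightarrow> skewered a (pull b D)"
  unfolding skewered_def using ev_pull[of a b D] ev_pull[of "inv a" b "V - D"] pull_compl[of b D] by simp

lemma peripheral_pull: "a \<in> A \<Longrightarrow> b \<in> A \<Longrightarrow> peripheral a D \<Longrightarrow> peripheral a (pull b D)"
  unfolding peripheral_def
  using ev_pull[of a b D] ev_pull[of "inv a" b D] periodic_pull_iff[of a b D] by simp

lemma skewered_inv: "a \<in> A \<Longrightarrow> skewered a D \<Longrightarrow> skewered (inv a) (V - D)"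
  unfolding skewered_def using compl_compl[of D] HH_compl[of D] by simp

lemma skewered_pow:
  assumes "a \<in> A" "skewered a D" "k > 0"
  shows "skewered (a [^] (k :: int)) D"
proof -
  have ev: "ev (b [^] k) D" if b: "b \<in> A" and e: "ev b D" for b D
    unfolding ev_def
  proof
    fix x assume "x \<in> V"
    then obtain N where N: "\<forall>n\<ge>N. pw b n x \<in> D" using e unfolding ev_def by blast
    have "pw (b [^] k) n x \<in> D" if "n \<ge> max 0 N" for n
    proof -
      have "1 * n \<le> k * n" using assms(3) that by (intro mult_right_mono) auto
      then show ?thesis using N that by (simp add: int_pow_pow b)
    qed
    then show "\<exists>N. \<forall>n\<ge>N. pw (b [^] k) n x \<in> D" by blast
  qed
  show ?thesis
    using assms ev[of a D] ev[of "inv a" "V - D"] unfolding skewered_def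
    by (simp add: int_pow_inv)
qed

lemma ev_disjoint: "ev a D \<Longrightarrow> \<not> ev a (V - D)"
proof
  assume "ev a D" "ev a (V - D)"
  moreover obtain x where "x \<in> V" using V_nonempty by blast
  ultimately obtain N M where "\<forall>n\<ge>N. pw a n x \<in> D" "\<forall>n\<ge>M. pw a n x \<in> V - D" unfolding ev_def by blast
  then have "pw a (max N M) x \<in> D" "pw a (max N M) x \<in> V - D"
    by (meson max.cobounded1, meson max.cobounded2)
  then show False by blast
qed

text \<open>Multiples of a period are arbitrarily late times, so \<open>V\<close> is the only
  periodic halfspace that contains the forward ends of all orbits.\<close>

lemma periodic_ev:
  assumes "a \<in> A" "D \<in> HH" "periodic a D" "ev a D" "x \<in> V"
  shows "x \<in> D"
proof -
  obtain k where k: "k > 0" "pull (a [^] (k::int)) D = D" using assms(3) unfolding periodic_def by blast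
  obtain N where N: "\<forall>n\<ge>N. pw a n x \<in> D" using assms unfolding ev_def by blast
  have "1 * int (nat N) \<le> k * int (nat N)" using k by (intro mult_right_mono) auto
  moreover have "N \<le> int (nat N)" by simp
  ultimately have "N \<le> k * int (nat N)" by linarith
  then have "pw a (k * int (nat N)) x \<in> D" using N by blast
  then show ?thesis using periodic_multiple[OF assms(1,2) k(2), of "nat N"] mem_pull[OF assms(5)] by metis
qed

lemma skewered_not_periodic:
  assumes "a \<in> A" "skewered a D"
  shows "\<not> periodic a D"
proof
  assume "periodic a D"
  moreover obtain x where x: "x \<in> V" using V_nonempty by blast
  ultimately have *: "x \<in> D" if "x \<in> V" for x using periodic_ev[OF assms(1)] assms(2) that unfolding skewered_def by blast
  obtain N where "\<forall>n\<ge>N. pw (inv a) n x \<in> V - D" using assms x unfolding skewered_def ev_def by blast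
  then show False using *[of "pw (inv a) N x"] assms x by auto
qed

text \<open>Without periodicity, different \<open>n\<close> give different halfspaces
  \<open>pull (a [^] n) D\<close>, all of which separate \<open>x\<close> from
  \<open>y\<close>.\<close>

lemma finite_crossings:
  assumes a: "a \<in> A" and D: "D \<in> HH" and np: "\<not> periodic a D" and xy: "x \<in> V" "y \<in> V"
  shows "finite {n::int. pw a n x \<in> D \<and> pw a n y \<notin> D}" (is "finite ?I")
proof (rule finite_imageD)
  show "finite ((\<lambda>n. pull (a [^] n) D) ` ?I)"
    by (rule finite_subset[OF _ HH_finite[OF xy]]) (use a D xy in auto)
  have "False" if "pull (a [^] i) D = pull (a [^] j) D" "i < j" for i j :: int
  proof -
    have "pull (a [^] (j - i)) D = pull (a [^] (- i)) (pull (a [^] j) D)"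
      using pull_pw_add[OF a, of "- i" j D] by simp
    also have "\<dots> = pull (a [^] (0 :: int)) D"
      unfolding that(1)[symmetric] using pull_pw_add[OF a, of "- i" i D] by simp
    also have "\<dots> = D" using pull_one[OF D] by simp
    finally show False using np that(2) unfolding periodic_def by auto
  qed
  then show "inj_on (\<lambda>n. pull (a [^] n) D) ?I"
    unfolding inj_on_def by (metis linorder_neq_iff)
qed

text \<open>Comparing \<open>x0\<close> with \<open>\<phi> a x0\<close> by
  \<open>finite_crossings\<close>, the orbit of \<open>x0\<close> changes sides only finitely often
  in forward time; comparing \<open>x0\<close> with any other point shows that all orbits end on the
  same side.\<close>

lemma ev_dichotomy:
  assumes a: "a \<in> A" and D: "D \<in> HH" and np: "\<not> periodic a D"
  shows "ev a D \<or> ev a (V - D)"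
proof -
  obtain x0 where x0: "x0 \<in> V" using V_nonempty by blast
  let ?x1 = "\<phi> a x0"
  have x1: "?x1 \<in> V" using a x0 by simp
  have "finite ({n::int. pw a n x0 \<in> D \<and> pw a n ?x1 \<notin> D} \<union> {n::int. pw a n ?x1 \<in> D \<and> pw a n x0 \<notin> D})"
    using finite_crossings[OF a D np] x0 x1 by blast
  from finite_int_bounded[OF this]
  obtain N where N: "\<forall>n\<ge>N. pw a n x0 \<in> D \<longleftrightarrow> pw a n ?x1 \<in> D" by blast
  have const: "pw a n x0 \<in> D \<longleftrightarrow> pw a N x0 \<in> D" if "n \<ge> N" for n
    using that
  proof (induction n rule: int_ge_induct)
    case (step n)
    then show ?case using N pw_add[OF a x0, of n 1] a by simp
  qed simp
  have eq: "\<exists>M. \<forall>n\<ge>M. pw a n x \<in> D \<longleftrightarrow> pw a N x0 \<in> D" if x: "x \<in> V" for x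
  proof -
    have "finite ({n::int. pw a n x0 \<in> D \<and> pw a n x \<notin> D} \<union> {n::int. pw a n x \<in> D \<and> pw a n x0 \<notin> D})"
      using finite_crossings[OF a D np] x0 x by blast
    from finite_int_bounded[OF this]
    obtain M where M: "\<forall>n\<ge>M. pw a n x0 \<in> D \<longleftrightarrow> pw a n x \<in> D" by blast
    have "pw a n x \<in> D \<longleftrightarrow> pw a N x0 \<in> D" if n: "n \<ge> max N M" for n
      using const[of n] M[rule_format, of n] n by linarith
    then show ?thesis by blast
  qed
  show ?thesis
  proof (cases "pw a N x0 \<in> D")
    case True
    then show ?thesis using eq unfolding ev_def by simp
  next
    case False
    then have "ev a (V - D)" using eq a unfolding ev_def by simp
    then show ?thesis by blast
  qed
qed

lemma periodic_inv:
  assumes "a \<in> A" "D \<in> HH" "periodic a D"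
  shows "periodic (inv a) D"
proof -
  obtain k where k: "k > 0" "pull (a [^] (k::int)) D = D" using assms unfolding periodic_def by blast
  have "pull (a [^] (- k)) (pull (a [^] k) D) = D"
    using pull_pw_add[OF assms(1), of "- k" k D] pull_one[OF assms(2)] by simp
  then have "pull (inv a [^] k) D = D" using k assms by (simp add: int_pow_inv int_pow_neg)
  then show ?thesis using k unfolding periodic_def by blast
qed

lemma periodic_compl:
  assumes "a \<in> A" "periodic a D"
  shows "periodic a (V - D)"
  using assms pull_compl[of _ D] unfolding periodic_def by (metis A_carrier A_closed(4))

lemma trichotomy:
  assumes a: "a \<in> A" and D: "D \<in> HH"
  shows "periodic a D \<or> peripheral a D \<or> peripheral a (V - D) \<or> skewered a D \<or> skewered a (V - D)"
proof (cases "periodic a D")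
  case False
  have np: "\<not> periodic (inv a) D" "\<not> periodic a (V - D)"
    using False periodic_inv[of "inv a" D] periodic_compl[of a "V - D"] compl_compl[OF D] a D by auto
  show ?thesis
    using ev_dichotomy[OF a D False] ev_dichotomy[OF A_closed(2)[OF a] D np(1)] False np(2) D HH_compl[OF D]
      compl_compl[OF D]
    unfolding peripheral_def skewered_def by auto
qed blast

text \<open>The hypothesis covers skewered halfspaces as well as complements of peripheral ones. The
  orbit of \<open>x\<close> leaves such a halfspace between times \<open>j\<close> and
  \<open>j + 1\<close> for some \<open>j \<ge> 0\<close>, so the halfspace is a translate of one of
  the finitely many that separate \<open>x\<close> from \<open>\<phi> a x\<close>. Only finitely
  many \<open>j\<close> occur for each of these, since the backward orbit ends outside.\<close>

lemma finite_strip: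
  assumes a: "a \<in> A" and x: "x \<in> V"
  shows "finite {D \<in> HH. ev (inv a) (V - D) \<and> x \<in> D \<and> (\<exists>n\<ge>0. pw a n x \<notin> D)}" (is "finite ?P")
proof -
  let ?T = "{D \<in> {D \<in> HH. x \<in> D \<and> \<phi> a x \<notin> D}. ev (inv a) (V - D)}"
  let ?J = "\<lambda>D. {j::int. j \<ge> 0 \<and> pw a (- j) x \<in> D}"
  have J: "finite (?J D)" if "D \<in> ?T" for D
  proof -
    have "\<exists>N. \<forall>n\<ge>N. pw a (- n) x \<in> V - D" using that x ev_inv[OF a, of "V - D"] by blast
    then obtain N where N: "\<forall>n\<ge>N. pw a (- n) x \<in> V - D" ..
    have "?J D \<subseteq> {0..N}"
    proof
      fix j assume "j \<in> ?J D"
      then have "\<not> j \<ge> N" "j \<ge> 0" using N by auto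
      then show "j \<in> {0..N}" by simp
    qed
    then show ?thesis by (rule finite_subset) simp
  qed
  have "finite ?T" by (rule rev_finite_subset[OF HH_finite[OF x, of "\<phi> a x"]]) (use a x in auto)
  then have "finite (\<Union>D\<in>?T. (\<lambda>j. pull (a [^] (- j)) D) ` ?J D)" using J by blast
  moreover have "?P \<subseteq> (\<Union>D\<in>?T. (\<lambda>j. pull (a [^] (- j)) D) ` ?J D)"
  proof
    fix D assume D: "D \<in> ?P"
    then obtain n where "n \<ge> 0" "pw a n x \<notin> D" by blast
    then obtain j where j: "j \<ge> 0" "pw a j x \<in> D" "pw a (j + 1) x \<notin> D"
      using int_step[of "\<lambda>n. pw a n x \<notin> D" 0 n] D x by auto
    let ?D = "pull (a [^] j) D"
    have DH: "D \<in> HH" using D by blast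
    have "ev (inv a) (V - ?D)" using ev_pull[of "inv a" "a [^] j" "V - D"] pull_compl[of "a [^] j" D] D a by simp
    then have 1: "?D \<in> ?T" using DH j a x pw_add[OF a x, of j 1] by simp
    have 2: "pull (a [^] (- j)) ?D = D"
      using pull_pw_add[OF a, of "- j" j D] pull_one[OF DH] by simp
    have "pw a j (pw a (- j) x) = x" using pw_add[OF a x, of j "- j"] x by simp
    then have "j \<in> ?J ?D" using j(1) D a x by simp
    then have "D \<in> (\<lambda>j. pull (a [^] (- j)) ?D) ` ?J ?D" using 2 by (intro rev_image_eqI) auto
    then show "D \<in> (\<Union>D\<in>?T. (\<lambda>j. pull (a [^] (- j)) D) ` ?J D)" using 1 by blast
  qed
  ultimately show ?thesis by (rule rev_finite_subset)
qed

text \<open>The point is that one \<open>N\<close> serves infinitely many halfspaces. Exceptional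
  are only those that separate \<open>y\<close> from \<open>z\<close> or belong to the strip of
  \<open>z\<close>, finitely many; for all others any \<open>n \<ge> 0\<close> will do.\<close>

lemma push:
  assumes a: "a \<in> A" and y: "y \<in> V" and z: "z \<in> V"
  shows "\<exists>N\<ge>0. \<forall>n\<ge>N. \<forall>D. skewered a D \<and> y \<in> D \<longrightarrow> pw a n z \<in> D"
proof -
  let ?P = "{D. skewered a D \<and> y \<in> D \<and> (\<exists>n\<ge>0. pw a n z \<notin> D)}"
  have "finite ({D \<in> HH. y \<in> D \<and> z \<notin> D} \<union> {D \<in> HH. ev (inv a) (V - D) \<and> z \<in> D \<and> (\<exists>n\<ge>0. pw a n z \<notin> D)})"
    using HH_finite[OF y z] finite_strip[OF a z] by blast
  moreover have "?P \<subseteq> {D \<in> HH. y \<in> D \<and> z \<notin> D} \<union> {D \<in> HH. ev (inv a) (V - D) \<and> z \<in> D \<and> (\<exists>n\<ge>0. pw a n z \<notin> D)}"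
    unfolding skewered_def by blast
  ultimately have "finite ?P" by (rule rev_finite_subset)
  then have "\<exists>N. \<forall>n\<ge>N. \<forall>D\<in>?P. pw a n z \<in> D"
    by (rule finite_uniform_bound) (use z in \<open>auto simp: skewered_def ev_def\<close>)
  then obtain N where N: "\<forall>n\<ge>N. \<forall>D\<in>?P. pw a n z \<in> D" by blast
  have "\<forall>n\<ge>max 0 N. \<forall>D. skewered a D \<and> y \<in> D \<longrightarrow> pw a n z \<in> D"
  proof (intro allI impI)
    fix n D assume n: "max 0 N \<le> n" and D: "skewered a D \<and> y \<in> D"
    show "pw a n z \<in> D"
    proof (cases "D \<in> ?P")
      case True
      then show ?thesis using N n by simp
    next
      case False
      then show ?thesis using D n by auto
    qed
  qed
  then show ?thesis by (intro exI[of _ "max 0 N"]) simp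
qed

lemma push_back:
  assumes a: "a \<in> A" and y: "y \<in> V" and z: "z \<in> V"
  shows "\<exists>N\<ge>0. \<forall>n\<ge>N. \<forall>D. skewered a D \<and> y \<notin> D \<longrightarrow> pw a (- n) z \<notin> D"
proof -
  obtain N where N: "N \<ge> 0" "\<forall>n\<ge>N. \<forall>D. skewered (inv a) D \<and> y \<in> D \<longrightarrow> pw (inv a) n z \<in> D"
    using push[of "inv a" y z] a y z by auto
  have "pw a (- n) z \<notin> D" if n: "n \<ge> N" and D: "skewered a D" "y \<notin> D" for n D
  proof -
    have "pw (inv a) n z \<in> V - D" using N(2) n skewered_inv[OF a D(1)] D(2) y by blast
    then show ?thesis using pw_inv[OF a] by simp
  qed
  then show ?thesis using N(1) by blast
qed

text \<open>The peripheral halfspaces without \<open>x\<close> are finitely many, and for large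
  \<open>n\<close> they contain both outer points. One with \<open>x\<close> contains at least one
  outer point: otherwise its translate by \<open>a [^] n\<close> would contain neither
  \<open>x\<close> nor \<open>pw a (2 * n) x\<close>, although it is peripheral as well.\<close>

lemma peripheral_step:
  assumes a: "a \<in> A" and x: "x \<in> V"
  shows "\<exists>n. \<forall>D. peripheral a D \<longrightarrow> m (pw a (- n) x) x (pw a n x) \<in> D"
proof -
  let ?P = "{D. peripheral a D \<and> x \<notin> D}"
  let ?T = "{D \<in> HH. ev (inv a) (V - D) \<and> x \<in> D \<and> (\<exists>n\<ge>0. pw a n x \<notin> D)}"
  have "?P \<subseteq> (\<lambda>D. V - D) ` ?T"
  proof
    fix D assume D: "D \<in> ?P"
    then have DH: "D \<in> HH" "ev a D" "ev (inv a) D" unfolding peripheral_def by auto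
    obtain N where "\<forall>n\<ge>N. pw a n x \<in> D" using DH x unfolding ev_def by blast
    then have "pw a (max 0 N) x \<notin> V - D" by simp
    moreover have "max 0 N \<ge> 0" by simp
    ultimately have "\<exists>n\<ge>0. pw a n x \<notin> V - D" by blast
    then have "V - D \<in> ?T" using HH_compl[OF DH(1)] compl_compl[OF DH(1)] DH(3) D x by simp
    then show "D \<in> (\<lambda>D. V - D) ` ?T" by (rule rev_image_eqI) (simp only: compl_compl[OF DH(1)])
  qed
  then have "finite ?P" using finite_strip[OF a x] finite_surj by blast
  then have "\<exists>N. \<forall>n\<ge>N. \<forall>D\<in>?P. pw a n x \<in> D \<and> pw a (- n) x \<in> D"
  proof (rule finite_uniform_bound)
    fix D assume "D \<in> ?P"
    then have "ev a D" "ev (inv a) D" unfolding peripheral_def by simp_all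
    then have "\<exists>N. \<forall>n\<ge>N. pw a n x \<in> D" "\<exists>N. \<forall>n\<ge>N. pw a (- n) x \<in> D"
      using x ev_inv[OF a, of D] unfolding ev_def by blast+
    then obtain N M where "\<forall>n\<ge>N. pw a n x \<in> D" "\<forall>n\<ge>M. pw a (- n) x \<in> D" by (elim exE)
    then have "\<forall>n\<ge>max N M. pw a n x \<in> D \<and> pw a (- n) x \<in> D" by simp
    then show "\<exists>N. \<forall>n\<ge>N. pw a n x \<in> D \<and> pw a (- n) x \<in> D" by blast
  qed
  then obtain N where N: "\<forall>n\<ge>N. \<forall>D\<in>?P. pw a n x \<in> D \<and> pw a (- n) x \<in> D" by blast
  \<comment> \<open>Nonnegativity of \<open>n\<close> ensures that \<open>2 * n\<close> is also
    beyond the bound.\<close>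
  define n where "n = max 0 N"
  have n: "n \<ge> N" "2 * n \<ge> N" unfolding n_def by auto
  have "m (pw a (- n) x) x (pw a n x) \<in> D" if D: "peripheral a D" for D
  proof -
    have DH: "D \<in> HH" using D unfolding peripheral_def by simp
    have "x \<notin> D \<Longrightarrow> pw a n x \<in> D \<and> pw a (- n) x \<in> D" using N n(1) D by blast
    moreover have "pw a n x \<in> D \<or> pw a (- n) x \<in> D"
    proof (rule ccontr)
      assume neg: "\<not> (pw a n x \<in> D \<or> pw a (- n) x \<in> D)"
      let ?D = "pull (a [^] (- n)) D"
      have "?D \<in> ?P" using neg peripheral_pull[OF a _ D, of "a [^] (- n)"] a x by simp
      then have "pw a (2 * n) x \<in> ?D" using N n(2) by blast
      moreover have "pw a (- n) (pw a (2 * n) x) = pw a n x" using pw_add[OF a x, of "- n" "2 * n"] by simp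
      ultimately show False using neg a x by simp
    qed
    ultimately show ?thesis using HH_majority[OF DH, of "pw a (- n) x" x "pw a n x"] a x by auto
  qed
  then show ?thesis by blast
qed

section \<open>Splitting of orbits\<close>

definition separators :: "'x \<Rightarrow> 'x set set" where
  "separators x = (\<Union>s\<in>S. {D \<in> HH. x \<in> D \<and> \<phi> s x \<notin> D} \<union> {D \<in> HH. \<phi> s x \<in> D \<and> x \<notin> D})"

lemma finite_separators: "x \<in> V \<Longrightarrow> finite (separators x)"
  unfolding separators_def using S_finite HH_finite S_subset by auto

text \<open>Since \<open>A\<close> is finitely generated, only finitely many \<open>A\<close>-orbits of halfspaces split a given \<open>A\<close>-orbit.\<close>

lemma split_orbit:
  assumes x: "x \<in> V" and D: "D \<in> HH" and ab: "a \<in> A" "b \<in> A" "\<phi> a x \<in> D" "\<phi> b x \<notin> D"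
  shows "\<exists>c\<in>A. pull c D \<in> separators x"
proof (rule ccontr)
  assume no: "\<not> (\<exists>c\<in>A. pull c D \<in> separators x)"
  have step: "\<phi> (c \<otimes> s) x \<in> D \<longleftrightarrow> \<phi> c x \<in> D" if s: "s \<in> S" and c: "c \<in> A" for s c
  proof -
    have "s \<in> A" using S_subset s .
    then have e: "\<phi> (c \<otimes> s) x = \<phi> c (\<phi> s x)" using act_mult c x by simp
    have "pull c D \<notin> separators x" using no c by blast
    moreover have "pull c D \<in> HH" using c D by simp
    ultimately have "\<phi> s x \<in> pull c D \<longleftrightarrow> x \<in> pull c D"
      using s unfolding separators_def by blast
    then have "\<phi> c (\<phi> s x) \<in> D \<longleftrightarrow> \<phi> c x \<in> D" using x \<open>s \<in> A\<close> by simp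
    then show ?thesis unfolding e .
  qed
  have "h \<in> A \<and> (\<forall>c\<in>A. \<phi> (c \<otimes> h) x \<in> D \<longleftrightarrow> \<phi> c x \<in> D)" if "h \<in> generate G S" for h
    using that
  proof (induction h rule: generate.induct)
    case one
    then show ?case by simp
  next
    case (incl h)
    then show ?case using step S_subset by simp
  next
    case (inv h)
    have h: "h \<in> A" using S_subset inv .
    have "\<phi> (c \<otimes> inv h) x \<in> D \<longleftrightarrow> \<phi> c x \<in> D" if "c \<in> A" for c
      using step[OF inv, of "c \<otimes> inv h"] that h by (simp add: m_assoc)
    then show ?case using h by simp
  next
    case (eng h1 h2)
    then have h: "h1 \<in> A" "h2 \<in> A" by auto
    have "\<phi> (c \<otimes> (h1 \<otimes> h2)) x \<in> D \<longleftrightarrow> \<phi> c x \<in> D" if c: "c \<in> A" for c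
    proof -
      have "\<phi> (c \<otimes> h1 \<otimes> h2) x \<in> D \<longleftrightarrow> \<phi> (c \<otimes> h1) x \<in> D" using eng(4) c h by simp
      also have "\<dots> \<longleftrightarrow> \<phi> c x \<in> D" using eng(3) c by simp
      finally show ?thesis using c h by (simp add: m_assoc)
    qed
    then show ?case using h by simp
  qed
  then have "\<forall>h\<in>A. \<phi> h x \<in> D \<longleftrightarrow> x \<in> D" using S_generates x by (metis A_carrier A_closed(1) act_one l_one)
  then show False using ab by blast
qed

text \<open>Starting from any \<open>x\<close>, \<open>peripheral_step\<close> is applied once for
  each bad member of \<open>separators x\<close>. The medians are formed within one orbit, so a
  halfspace that contains a whole orbit keeps doing so and no progress is lost. Other peripheral
  halfspaces either have a translate among the separators or contain the whole orbit of
  \<open>x\<close>.\<close>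

lemma exists_core_point:
  obtains y where "y \<in> V" "\<And>a D. a \<in> A \<Longrightarrow> peripheral a D \<Longrightarrow> y \<in> D"
proof -
  obtain x where x: "x \<in> V" using V_nonempty by blast
  have "\<exists>y\<in>V. (\<forall>D\<in>HH. (\<forall>b\<in>A. \<phi> b x \<in> D) \<longrightarrow> (\<forall>b\<in>A. \<phi> b y \<in> D)) \<and>
      (\<forall>D\<in>F. \<forall>a\<in>A. peripheral a D \<longrightarrow> (\<forall>b\<in>A. \<phi> b y \<in> D))"
    if "F \<subseteq> separators x" for F
    using finite_subset[OF that finite_separators[OF x]]
  proof (induction F rule: finite_induct)
    case empty
    then show ?case using x by auto
  next
    case (insert D0 F)
    then obtain y where y: "y \<in> V" "\<forall>D\<in>HH. (\<forall>b\<in>A. \<phi> b x \<in> D) \<longrightarrow> (\<forall>b\<in>A. \<phi> b y \<in> D)"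
      "\<forall>D\<in>F. \<forall>a\<in>A. peripheral a D \<longrightarrow> (\<forall>b\<in>A. \<phi> b y \<in> D)" by blast
    show ?case
    proof (cases "\<exists>a\<in>A. peripheral a D0")
      case False
      then show ?thesis using y by auto
    next
      case True
      then obtain a where a: "a \<in> A" "peripheral a D0" by blast
      obtain n where n: "\<forall>D. peripheral a D \<longrightarrow> m (pw a (- n) y) y (pw a n y) \<in> D"
        using peripheral_step[OF a(1) y(1)] by blast
      let ?z = "m (pw a (- n) y) y (pw a n y)"
      have z: "?z \<in> V" using med_closed a y by simp
      have const: "\<forall>b\<in>A. \<phi> b ?z \<in> D" if D: "D \<in> HH" and c: "\<forall>b\<in>A. \<phi> b y \<in> D" for D
      proof
        fix b assume b: "b \<in> A"
        have "\<phi> b (pw a k y) \<in> D" for k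
          using c act_mult[of b "a [^] k" y] a y b by (metis A_carrier A_closed(3,4))
        then show "\<phi> b ?z \<in> D"
          using act_median[of b "pw a (- n) y" y "pw a n y"] HH_majority[OF D] c a b y by simp
      qed
      have "\<phi> b ?z \<in> D0" if b: "b \<in> A" for b
        using n peripheral_pull[OF a(1) b a(2)] z by (metis mem_pull)
      then show ?thesis
        using y const z unfolding peripheral_def by (intro bexI[of _ ?z]) auto
    qed
  qed
  from this[OF subset_refl] obtain y where y: "y \<in> V"
    "\<forall>D\<in>HH. (\<forall>b\<in>A. \<phi> b x \<in> D) \<longrightarrow> (\<forall>b\<in>A. \<phi> b y \<in> D)"
    "\<forall>D\<in>separators x. \<forall>a\<in>A. peripheral a D \<longrightarrow> (\<forall>b\<in>A. \<phi> b y \<in> D)" by blast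
  have "y \<in> D" if a: "a \<in> A" and D: "peripheral a D" for a D
  proof (cases "\<exists>c\<in>A. pull c D \<in> separators x")
    case True
    then obtain c where c: "c \<in> A" "pull c D \<in> separators x" by blast
    then have "\<phi> (inv c) y \<in> pull c D"
      using y(3) peripheral_pull[OF a c(1) D] a A_closed(2)[OF c(1)] by blast
    then show ?thesis using c y(1) by simp
  next
    case False
    have DH: "D \<in> HH" "ev a D" using D unfolding peripheral_def by auto
    obtain N where "pw a N x \<in> D" using DH(2) x unfolding ev_def by blast
    then have "\<forall>b\<in>A. \<phi> b x \<in> D" using split_orbit[OF x DH(1)] a False by (meson A_closed(4))
    then have "\<phi> \<one> y \<in> D" using y(2) DH(1) A_closed(1) by blast
    then show ?thesis using y(1) by simp
  qed
  then show ?thesis using that y(1) by blast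
qed

section \<open>A common exponent for skewered halfspaces\<close>

lemma skewered_cross:
  assumes "a \<in> A" "skewered a D" "x \<in> V"
  shows "\<exists>j. pw a j x \<notin> D \<and> pw a (j + 1) x \<in> D"
proof -
  obtain N where N: "\<forall>n\<ge>N. pw a n x \<in> D" using assms unfolding skewered_def ev_def by blast
  have "\<exists>M. \<forall>n\<ge>M. pw a (- n) x \<in> V - D" using assms ev_inv[OF assms(1), of "V - D"] unfolding skewered_def by blast
  then obtain M where M: "\<forall>n\<ge>M. pw a (- n) x \<in> V - D" by blast
  have "pw a (- max M (- N)) x \<notin> D" "pw a N x \<in> D" "- max M (- N) \<le> N" using N M by auto
  from int_step[of "\<lambda>n. pw a n x \<in> D", OF this] show ?thesis by blast
qed

lemma pull_pow_eq:
  assumes "a \<in> A" "c \<in> A" "pull (a [^] (p :: int)) D = pull (c [^] (q :: int)) D"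
  shows "pull (a [^] (p * int n)) D = pull (c [^] (q * int n)) D"
proof (induction n)
  case (Suc n)
  have e: "p * int (Suc n) = p + p * int n" "q * int (Suc n) = q * int n + q" by (simp_all add: algebra_simps)
  have "pull (a [^] (p * int (Suc n))) D = pull (a [^] p) (pull (c [^] (q * int n)) D)"
    unfolding e pull_pw_add[OF assms(1)] Suc ..
  also have "\<dots> = pull (c [^] (q * int n)) (pull (a [^] p) D)"
    by (rule pull_commute) (use assms in simp_all)
  also have "\<dots> = pull (c [^] (q * int (Suc n))) D"
    unfolding e pull_pw_add[OF assms(2)] assms(3) ..
  finally show ?case .
qed simp

text \<open>
  If \<open>c\<close> skewers \<open>D\<close>, then \<open>c\<close> generates a finite-index subgroup of \<open>A\<close> modulo the stabiliser of \<open>D\<close>.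
\<close>

lemma skewered_commensurable:
  assumes c: "c \<in> A" "skewered c D"
  shows "\<exists>k>0. \<forall>a\<in>A. \<exists>q::int. pull (a [^] (k :: int)) D = pull (c [^] q) D"
proof -
  obtain y where y: "y \<in> V" using V_nonempty by blast
  have DH: "D \<in> HH" using c unfolding skewered_def by simp
  let ?T = "{D \<in> HH. \<phi> c y \<in> D \<and> y \<notin> D}"
  have fT: "finite ?T" using HH_finite c y by simp
  \<comment> \<open>The pigeonhole principle yields an exponent of \<open>a\<close> that is at most
    \<open>card ?T\<close> but depends on \<open>a\<close>; the factorial is a multiple of all of
    them.\<close>
  have "\<exists>q::int. pull (a [^] (fact (card ?T) :: int)) D = pull (c [^] q) D" if a: "a \<in> A" for a
  proof -
    \<comment> \<open>A power of \<open>c\<close> moves any translate of \<open>D\<close> to a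
      halfspace that separates \<open>y\<close> from \<open>\<phi> c y\<close>.\<close>
    have "\<exists>j::int. pull (c [^] j) (pull (a [^] int i) D) \<in> ?T" for i :: nat
    proof -
      obtain j where "pw c j y \<notin> pull (a [^] int i) D" "pw c (j + 1) y \<in> pull (a [^] int i) D"
        using skewered_cross[OF c(1) skewered_pull[OF c(1) _ c(2)] y] a by (meson A_closed(4))
      then have "pull (c [^] j) (pull (a [^] int i) D) \<in> ?T"
        using DH a c(1) y pw_add[OF c(1) y, of j 1] by simp
      then show ?thesis by blast
    qed
    then obtain j :: "nat \<Rightarrow> int" where j: "\<And>i. pull (c [^] j i) (pull (a [^] int i) D) \<in> ?T" by metis
    have "\<not> inj_on (\<lambda>i. pull (c [^] j i) (pull (a [^] int i) D)) {0..card ?T}"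
    proof
      assume "inj_on (\<lambda>i. pull (c [^] j i) (pull (a [^] int i) D)) {0..card ?T}"
      then have "card {0..card ?T} \<le> card ?T" by (rule card_inj_on_le) (use j fT in auto)
      then show False by simp
    qed
    then obtain u v where uv: "u \<le> card ?T" "v \<le> card ?T" "u \<noteq> v"
      "pull (c [^] j u) (pull (a [^] int u) D) = pull (c [^] j v) (pull (a [^] int v) D)"
      unfolding inj_on_def by auto
    obtain i i' where i: "i \<le> card ?T" "i' \<le> card ?T" "i < i'"
      "pull (c [^] j i) (pull (a [^] int i) D) = pull (c [^] j i') (pull (a [^] int i') D)"
    proof (cases "u < v")
      case True
      then show ?thesis using that[OF uv(1,2) _ uv(4)] by blast
    next
      case False
      then have "v < u" using uv(3) by simp
      then show ?thesis using that[OF uv(2,1) _ uv(4)[symmetric]] by blast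
    qed
    let ?p = "i' - i" and ?q = "j i - j i'"
    have "pull (a [^] int ?p) D = pull (c [^] ?q) D"
    proof -
      have "pull (a [^] (- int i)) (pull (c [^] (- j i')) (pull (c [^] j i) (pull (a [^] int i) D)))
        = pull (a [^] (- int i)) (pull (c [^] (- j i')) (pull (c [^] j i') (pull (a [^] int i') D)))"
        using i(4) by simp
      moreover have "pull (c [^] (- j i')) (pull (c [^] j i') (pull (a [^] int i') D)) = pull (a [^] int i') D"
        using pull_pw_add[OF c(1), of "- j i'" "j i'" "pull (a [^] int i') D"] pull_one DH a by simp
      moreover have "pull (a [^] (- int i)) (pull (a [^] int i') D) = pull (a [^] int ?p) D"
        using pull_pw_add[OF a, of "- int i" "int i'" D] i(3) by (simp add: of_nat_diff)
      moreover have "pull (c [^] (- j i')) (pull (c [^] j i) (pull (a [^] int i) D)) = pull (c [^] ?q) (pull (a [^] int i) D)"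
        using pull_pw_add[OF c(1), of "- j i'" "j i" "pull (a [^] int i) D"] by simp
      moreover have "pull (a [^] (- int i)) (pull (c [^] ?q) (pull (a [^] int i) D)) = pull (c [^] ?q) D"
        using pull_commute[of "a [^] (- int i)" "c [^] ?q"] a c(1)
          pull_pw_add[OF a, of "- int i" "int i" D] pull_one[OF DH] by simp
      ultimately show ?thesis by simp
    qed
    note eq = this
    have "?p dvd fact (card ?T)" using i by (intro dvd_fact) auto
    then obtain t where t: "fact (card ?T) = ?p * t" by (elim dvdE)
    have "(fact (card ?T) :: int) = int (fact (card ?T))" by (simp only: of_nat_fact)
    also have "\<dots> = int ?p * int t" unfolding t by (rule of_nat_mult)
    finally have "(fact (card ?T) :: int) = int ?p * int t" .
    then show ?thesis using pull_pow_eq[OF a c(1) eq, of t] by (metis (no_types))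
  qed
  moreover have "(fact (card ?T) :: int) > 0" by (rule fact_gt_zero)
  ultimately show ?thesis by blast
qed

text \<open>A fixed power of each \<open>a\<close> acts on \<open>D\<close> like a power of
  \<open>c\<close>, so \<open>push\<close> for the single element \<open>c\<close> controls all
  \<open>a\<close> at once.\<close>

lemma skewered_uniform:
  assumes c: "c \<in> A" "skewered c D" and y: "y \<in> V"
  shows "\<exists>k>0::int. \<forall>N. k dvd N \<and> N > 0 \<longrightarrow>
    (\<forall>a\<in>A. skewered a D \<longrightarrow> (\<forall>b\<in>A. \<phi> b y \<in> D \<longrightarrow> pw a N (\<phi> b y) \<in> D))"
proof -
  have DH: "D \<in> HH" using c unfolding skewered_def by simp
  obtain k where k: "k > 0" "\<forall>a\<in>A. \<exists>q::int. pull (a [^] (k :: int)) D = pull (c [^] q) D"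
    using skewered_commensurable[OF c] by blast
  obtain M0 where "\<forall>n\<ge>M0. \<forall>D. skewered c D \<and> y \<in> D \<longrightarrow> pw c n y \<in> D"
    using push[OF c(1) y y] by blast
  then have "\<forall>n\<ge>max 1 M0. \<forall>D. skewered c D \<and> y \<in> D \<longrightarrow> pw c n y \<in> D" by simp
  then obtain M where M: "M > 0" "\<forall>n\<ge>M. \<forall>D. skewered c D \<and> y \<in> D \<longrightarrow> pw c n y \<in> D"
    by (metis less_max_iff_disj zero_less_one)
  have "pw a N (\<phi> b y) \<in> D"
    if N: "k * M dvd N" "N > 0" and a: "a \<in> A" "skewered a D" and b: "b \<in> A" "\<phi> b y \<in> D" for N a b
  proof -
    obtain l where l: "N = k * M * l" using N(1) by (elim dvdE)
    then have "l > 0" using N(2) k(1) M(1) by (metis zero_less_mult_pos mult_pos_pos)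
    obtain q :: int where q: "pull (a [^] k) D = pull (c [^] q) D" using k(2) a(1) by blast
    have pq: "pull (a [^] (k * n)) D = pull (c [^] (q * n)) D" if "n \<ge> 0" for n
      using pull_pow_eq[OF a(1) c(1) q, of "nat n"] that by simp
    \<comment> \<open>If \<open>q\<close> were 0, then \<open>D\<close> would be periodic under
      \<open>a\<close>; if it were negative, points entering \<open>D\<close> under \<open>a\<close>
      would have to do so along the backward orbit of \<open>c\<close>, which ends outside.\<close>
    have "q > 0"
    proof (rule ccontr)
      assume q0: "\<not> q > 0"
      obtain R where R: "\<forall>n\<ge>R. pw a n y \<in> D" using a(2) y unfolding skewered_def ev_def by blast
      have inD: "pw c (q * n) y \<in> D" if "n \<ge> max 0 R" for n
      proof -
        have "1 * n \<le> k * n" using k(1) that by (intro mult_right_mono) auto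
        then have "y \<in> pull (a [^] (k * n)) D" using R that y by simp
        then show ?thesis using pq[of n] that y by simp
      qed
      show False
      proof (cases "q = 0")
        case True
        then have "pull (a [^] k) D = D" using q pull_one[OF DH] by simp
        then have "periodic a D" using k(1) unfolding periodic_def by blast
        then show False using skewered_not_periodic[OF a] by simp
      next
        case False
        obtain R' where R': "\<forall>n\<ge>R'. pw c (- n) y \<in> V - D"
          using c(2) y ev_inv[OF c(1), of "V - D"] unfolding skewered_def by blast
        let ?n = "max (max 0 R) R'"
        have "1 * ?n \<le> (- q) * ?n" using q0 False by (intro mult_right_mono) auto
        then have "pw c (- ((- q) * ?n)) y \<in> V - D"
          by (intro R'[rule_format]) linarith
        then show False using inD[of ?n] by simp
      qed
    qed
    have "1 * (M * l) \<le> q * (M * l)" using \<open>q > 0\<close> M(1) \<open>l > 0\<close> by (intro mult_right_mono) auto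
    moreover have "M * 1 \<le> M * l" using M(1) \<open>l > 0\<close> by (intro mult_left_mono) auto
    ultimately have "q * (M * l) \<ge> M" by simp
    then have "pw c (q * (M * l)) y \<in> pull b D"
      using M(2) skewered_pull[OF c(1) b(1) c(2)] b(2) y by simp
    then have "\<phi> b y \<in> pull (c [^] (q * (M * l))) D"
      using act_commute[of b "c [^] (q * (M * l))" y] b(1) c(1) y by simp
    moreover have "pull (c [^] (q * (M * l))) D = pull (a [^] N) D"
      using pq[of "M * l"] M(1) \<open>l > 0\<close> l by (simp add: mult.assoc)
    ultimately show ?thesis using b(1) y by simp
  qed
  \<comment> \<open>The factor \<open>k\<close> permits the passage from \<open>a\<close> to
    \<open>c\<close>, and the factor \<open>M\<close> makes the exponent of \<open>c\<close> large
    enough for \<open>push\<close>.\<close>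
  then show ?thesis using k(1) M(1) by (intro exI[of _ "k * M"]) auto
qed

text \<open>The moduli of finitely many representatives are multiplied. Quantifying over
  \<open>b\<close> in the induction makes the claim invariant under translation by \<open>A\<close>,
  so that one representative of each orbit of halfspaces is enough.\<close>

lemma exists_uniform_exponent:
  assumes y: "y \<in> V"
  shows "\<exists>N>0::int. \<forall>a\<in>A. \<forall>D. skewered a D \<and> y \<in> D \<longrightarrow> pw a N y \<in> D"
proof -
  have "\<exists>N>0::int. \<forall>D\<in>F. \<forall>a\<in>A. skewered a D \<longrightarrow> (\<forall>M. N dvd M \<and> M > 0 \<longrightarrow> (\<forall>b\<in>A. \<phi> b y \<in> D \<longrightarrow> pw a M (\<phi> b y) \<in> D))"
    if "F \<subseteq> separators y" for F
    using finite_subset[OF that finite_separators[OF y]]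
  proof (induction F rule: finite_induct)
    case empty
    then show ?case by (intro exI[of _ 1]) simp
  next
    case (insert D F)
    then obtain N where N: "N > 0" "\<forall>D\<in>F. \<forall>a\<in>A. skewered a D \<longrightarrow>
      (\<forall>M. N dvd M \<and> M > 0 \<longrightarrow> (\<forall>b\<in>A. \<phi> b y \<in> D \<longrightarrow> pw a M (\<phi> b y) \<in> D))" by blast
    show ?case
    proof (cases "\<exists>c\<in>A. skewered c D")
      case True
      then obtain k where k: "k > 0" "\<forall>N. k dvd N \<and> N > 0 \<longrightarrow>
        (\<forall>a\<in>A. skewered a D \<longrightarrow> (\<forall>b\<in>A. \<phi> b y \<in> D \<longrightarrow> pw a N (\<phi> b y) \<in> D))"
        using skewered_uniform y by blast
      have "k dvd M \<and> N dvd M" if "N * k dvd M" for M using that by (meson dvd_mult_left dvd_mult_right)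
      then show ?thesis using N k by (intro exI[of _ "N * k"]) auto
    next
      case False
      then show ?thesis using N by auto
    qed
  qed
  from this[OF subset_refl] obtain N where N: "N > 0" "\<forall>D\<in>separators y. \<forall>a\<in>A. skewered a D \<longrightarrow>
    (\<forall>M. N dvd M \<and> M > 0 \<longrightarrow> (\<forall>b\<in>A. \<phi> b y \<in> D \<longrightarrow> pw a M (\<phi> b y) \<in> D))" by blast
  have "pw a N y \<in> D" if a: "a \<in> A" and D: "skewered a D" "y \<in> D" for a D
  proof -
    obtain j where "pw a j y \<notin> D" using skewered_cross[OF a D(1) y] by blast
    moreover have "D \<in> HH" using D unfolding skewered_def by simp
    ultimately obtain c where c: "c \<in> A" "pull c D \<in> separators y"
      using split_orbit[OF y, of D \<one> "a [^] j"] a D y by auto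
    have "\<phi> (inv c) y \<in> pull c D" using c D y by simp
    then have "pw a N (\<phi> (inv c) y) \<in> pull c D"
      using N c a skewered_pull[OF a c(1) D(1)] by (meson A_closed(2) dvd_refl)
    then have "\<phi> c (pw a N (\<phi> (inv c) y)) \<in> D" using a c y by simp
    then show ?thesis using act_commute[of c "a [^] N" "\<phi> (inv c) y"] a c y by simp
  qed
  then show ?thesis using N(1) by blast
qed

end

section \<open>The core and its product structure\<close>

locale core_action = wall_action G V \<phi> m HH A S
  for G (structure) and V :: "'x set" and \<phi> m HH A S +
  fixes y0 :: 'x and N :: int
  assumes y0_V: "y0 \<in> V"
    and y0_peripheral: "a \<in> A \<Longrightarrow> peripheral a D \<Longrightarrow> y0 \<in> D"
    and N_pos: "N > 0"
    and y0_skewered: "a \<in> A \<Longrightarrow> skewered a D \<Longrightarrow> y0 \<in> D \<Longrightarrow> pw a N y0 \<in> D"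
begin

definition core :: "'x set" where
  "core = {y \<in> V. \<forall>a\<in>A. \<forall>D. (peripheral a D \<longrightarrow> y \<in> D) \<and> (skewered a D \<longrightarrow> y \<in> D \<longrightarrow> pw a N y \<in> D)}"

definition A_skewered :: "'x set \<Rightarrow> bool" where
  "A_skewered D \<longleftrightarrow> (\<exists>a\<in>A. skewered a D)"

definition A_periodic :: "'x set \<Rightarrow> bool" where
  "A_periodic D \<longleftrightarrow> D \<in> HH \<and> (\<forall>a\<in>A. periodic a D)"

lemma core_V: "y \<in> core \<Longrightarrow> y \<in> V"
  unfolding core_def by simp

lemma core_peripheral: "y \<in> core \<Longrightarrow> a \<in> A \<Longrightarrow> peripheral a D \<Longrightarrow> y \<in> D"
  unfolding core_def by simp

lemma core_skewered: "y \<in> core \<Longrightarrow> a \<in> A \<Longrightarrow> skewered a D \<Longrightarrow> y \<in> D \<Longrightarrow> pw a N y \<in> D"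
  unfolding core_def by simp

lemma y0_core: "y0 \<in> core"
  unfolding core_def using y0_V y0_peripheral y0_skewered by simp

lemma A_skewered_HH: "A_skewered D \<Longrightarrow> D \<in> HH"
  unfolding A_skewered_def skewered_def by blast

lemma A_periodic_HH: "A_periodic D \<Longrightarrow> D \<in> HH"
  unfolding A_periodic_def by blast

text \<open>Both conditions pass to medians by majority: the two points that put the median into
  \<open>D\<close> have images that put its image there.\<close>

lemma core_median:
  assumes "x \<in> core" "y \<in> core" "z \<in> core"
  shows "m x y z \<in> core"
proof -
  note V = core_V[OF assms(1)] core_V[OF assms(2)] core_V[OF assms(3)]
  have "m x y z \<in> D" if a: "a \<in> A" and D: "peripheral a D" for a D
  proof -
    have "D \<in> HH" using D unfolding peripheral_def by simp
    moreover have "x \<in> D" "y \<in> D" using core_peripheral assms a D by blast+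
    ultimately show ?thesis using HH_majority[of D x y z] V by blast
  qed
  moreover have "pw a N (m x y z) \<in> D" if a: "a \<in> A" and D: "skewered a D" and mD: "m x y z \<in> D" for a D
  proof -
    have DH: "D \<in> HH" using D unfolding skewered_def by simp
    have "x \<in> D \<Longrightarrow> pw a N x \<in> D" "y \<in> D \<Longrightarrow> pw a N y \<in> D" "z \<in> D \<Longrightarrow> pw a N z \<in> D"
      using core_skewered assms a D by blast+
    then have "m (pw a N x) (pw a N y) (pw a N z) \<in> D"
      using HH_majority[OF DH V] HH_majority[OF DH, of "pw a N x" "pw a N y" "pw a N z"] mD V a by auto
    then show ?thesis using act_median[of "a [^] N" x y z] V a by simp
  qed
  ultimately show ?thesis unfolding core_def using med_closed[OF V] by simp
qed

text \<open>The inverse stands on the left to match \<open>pull\<close>: what \<open>a\<close> does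
  to \<open>D\<close>, \<open>conjugate g a\<close> does to \<open>pull g D\<close>.\<close>

definition conjugate :: "'a \<Rightarrow> 'a \<Rightarrow> 'a" where
  "conjugate g a = inv g \<otimes> a \<otimes> g"

lemma conj_A: "g \<in> carrier G \<Longrightarrow> a \<in> A \<Longrightarrow> conjugate g a \<in> A"
  unfolding conjugate_def using A_conjugate[of "inv g" a] by simp

lemma conj_inverse:
  assumes "g \<in> carrier G" "a \<in> carrier G"
  shows "conjugate g (conjugate (inv g) a) = a"
proof -
  have "inv g \<otimes> (g \<otimes> (a \<otimes> (inv g \<otimes> g))) = a" using assms by (simp flip: m_assoc[of "inv g" g])
  then show ?thesis unfolding conjugate_def using assms by (simp add: m_assoc)
qed

lemma cancel_inv: "g \<in> carrier G \<Longrightarrow> x \<in> carrier G \<Longrightarrow> g \<otimes> (inv g \<otimes> x) = x"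
  by (simp flip: m_assoc)

lemma mult_conj: "g \<in> carrier G \<Longrightarrow> a \<in> carrier G \<Longrightarrow> g \<otimes> conjugate g a = a \<otimes> g"
  unfolding conjugate_def by (simp add: m_assoc cancel_inv)

lemma conj_int_pow:
  assumes g: "g \<in> carrier G" and a: "a \<in> carrier G"
  shows "conjugate g a [^] (n :: int) = conjugate g (a [^] n)"
proof -
  have c: "conjugate g a \<in> carrier G" using assms unfolding conjugate_def by simp
  have nat: "conjugate g a [^] (n :: nat) = conjugate g (a [^] n)" for n
  proof (induction n)
    case 0
    then show ?case unfolding conjugate_def using g by simp
  next
    case (Suc n)
    have "conjugate g (a [^] n) \<otimes> conjugate g a = conjugate g (a [^] n \<otimes> a)"
      unfolding conjugate_def using assms by (simp add: m_assoc cancel_inv)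
    then show ?case using Suc by simp
  qed
  show ?thesis
  proof (cases n rule: int_cases2)
    case (nonneg k)
    then show ?thesis using nat by (simp add: int_pow_int)
  next
    case (nonpos k)
    have "inv (conjugate g (a [^] k)) = conjugate g (inv (a [^] k))"
      unfolding conjugate_def using assms by (simp add: inv_mult_group m_assoc)
    then show ?thesis using nat nonpos c a by (simp add: int_pow_neg_int)
  qed
qed

lemma act_conj_pow:
  assumes "g \<in> carrier G" "a \<in> A" "x \<in> V"
  shows "\<phi> g (pw (conjugate g a) n x) = pw a n (\<phi> g x)"
proof -
  have "g \<otimes> conjugate g (a [^] n) = a [^] n \<otimes> g" using mult_conj assms by simp
  moreover have "conjugate g (a [^] n) \<in> carrier G" unfolding conjugate_def using assms by simp
  ultimately show ?thesis using act_mult[of g "conjugate g (a [^] n)" x] act_mult[of "a [^] n" g x]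
      conj_int_pow[of g a n] assms by simp
qed

lemma conj_inv: "g \<in> carrier G \<Longrightarrow> a \<in> carrier G \<Longrightarrow> conjugate g (inv a) = inv (conjugate g a)"
  unfolding conjugate_def by (simp add: inv_mult_group m_assoc)

lemma ev_conj:
  assumes "g \<in> carrier G" "a \<in> A" "ev a D"
  shows "ev (conjugate g a) (pull g D)"
  unfolding ev_def
proof
  fix x assume x: "x \<in> V"
  then have "\<exists>M. \<forall>n\<ge>M. pw a n (\<phi> g x) \<in> D" using assms unfolding ev_def by simp
  moreover have "pw (conjugate g a) n x \<in> pull g D \<longleftrightarrow> pw a n (\<phi> g x) \<in> D" for n
    using act_conj_pow[OF assms(1,2) x] conj_A[OF assms(1,2)] assms x by simp
  ultimately show "\<exists>M. \<forall>n\<ge>M. pw (conjugate g a) n x \<in> pull g D" by simp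
qed

lemma periodic_conj:
  assumes "g \<in> carrier G" "a \<in> A" "periodic a D"
  shows "periodic (conjugate g a) (pull g D)"
proof -
  obtain k where k: "k > 0" "pull (a [^] (k::int)) D = D" using assms(3) unfolding periodic_def by blast
  have c: "conjugate g (a [^] k) \<in> carrier G" unfolding conjugate_def using assms by simp
  have "pull (conjugate g a [^] k) (pull g D) = pull (g \<otimes> conjugate g (a [^] k)) D"
    using conj_int_pow[of g a k] pull_mult[of g "conjugate g (a [^] k)" D] assms c by simp
  also have "\<dots> = pull (a [^] k \<otimes> g) D" using mult_conj[of g "a [^] k"] assms by simp
  also have "\<dots> = pull g D" using pull_mult[of "a [^] k" g D] k assms by simp
  finally show ?thesis using k unfolding periodic_def by blast
qed

lemma skewered_conj:
  assumes "g \<in> carrier G" "a \<in> A" "skewered a D"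
  shows "skewered (conjugate g a) (pull g D)"
  using assms ev_conj[of g a D] ev_conj[of g "inv a" "V - D"] pull_compl[of g D] conj_inv[of g a]
  unfolding skewered_def by simp

lemma peripheral_conj:
  assumes "g \<in> carrier G" "a \<in> A" "peripheral a D"
  shows "peripheral (conjugate g a) (pull g D)"
proof -
  have DH: "D \<in> HH" and np: "\<not> periodic a D" using assms unfolding peripheral_def by auto
  have "\<not> periodic (conjugate g a) (pull g D)"
  proof
    assume "periodic (conjugate g a) (pull g D)"
    from periodic_conj[OF inv_closed[OF assms(1)] conj_A[OF assms(1,2)] this]
    show False using np conj_inverse[of "inv g" a] pull_inv(2)[OF assms(1) DH] assms by simp
  qed
  then show ?thesis
    using assms ev_conj[of g a D] ev_conj[of g "inv a" D] conj_inv[of g a] unfolding peripheral_def by simp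
qed

text \<open>Conjugation by \<open>g\<close> permutes the pairs of \<open>a\<close> and
  \<open>D\<close> over which \<open>core\<close> quantifies, and \<open>N\<close> does not depend
  on them.\<close>

lemma core_act:
  assumes g: "g \<in> carrier G" and y: "y \<in> core"
  shows "\<phi> g y \<in> core"
proof -
  note yV = core_V[OF y]
  have "\<phi> g y \<in> D" if a: "a \<in> A" and D: "peripheral a D" for a D
    using core_peripheral[OF y conj_A[OF g a] peripheral_conj[OF g a D]] yV by simp
  moreover have "pw a N (\<phi> g y) \<in> D" if a: "a \<in> A" and D: "skewered a D" and "\<phi> g y \<in> D" for a D
    using core_skewered[OF y conj_A[OF g a] skewered_conj[OF g a D]] that yV
      act_conj_pow[OF g a yV, of N] conj_A[OF g a] by simp
  ultimately show ?thesis unfolding core_def using yV g by simp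
qed

lemma A_skewered_pull: "g \<in> carrier G \<Longrightarrow> A_skewered D \<Longrightarrow> A_skewered (pull g D)"
  unfolding A_skewered_def using skewered_conj conj_A by blast

lemma A_periodic_pull:
  assumes "g \<in> carrier G" "A_periodic D"
  shows "A_periodic (pull g D)"
proof -
  have "periodic a (pull g D)" if a: "a \<in> A" for a
    using periodic_conj[OF assms(1), of "conjugate (inv g) a" D] conj_A[of "inv g" a] conj_inverse[of g a]
      assms a unfolding A_periodic_def by simp
  then show ?thesis using assms unfolding A_periodic_def by simp
qed

lemma A_skewered_compl: "A_skewered D \<Longrightarrow> A_skewered (V - D)"
  unfolding A_skewered_def using skewered_inv A_closed(2) by blast

lemma A_periodic_compl: "A_periodic D \<Longrightarrow> A_periodic (V - D)"
  unfolding A_periodic_def using periodic_compl HH_compl by blast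

text \<open>A peripheral halfspace contains the whole core, so only two kinds are left to cut
  it.\<close>

lemma core_classification:
  assumes D: "D \<in> HH"
  shows "A_skewered D \<or> A_periodic D \<or> core \<subseteq> D \<or> core \<inter> D = {}"
proof (cases "\<forall>a\<in>A. periodic a D")
  case True
  then show ?thesis using D unfolding A_periodic_def by blast
next
  case False
  then obtain a where a: "a \<in> A" "\<not> periodic a D" by blast
  then consider "peripheral a D" | "peripheral a (V - D)" | "skewered a D" | "skewered a (V - D)"
    using trichotomy[OF a(1) D] by blast
  then show ?thesis
  proof cases
    case 1
    then show ?thesis using core_peripheral a(1) by blast
  next
    case 2
    then show ?thesis using core_peripheral a(1) by blast
  next
    case 3
    then show ?thesis using a(1) unfolding A_skewered_def by blast
  next
    case 4
    then have "A_skewered (V - D)" using a(1) unfolding A_skewered_def by blast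
    then show ?thesis using A_skewered_compl compl_compl[OF D] by metis
  qed
qed

lemma core_eqI:
  assumes "x \<in> core" "y \<in> core"
    and "\<And>D. A_skewered D \<Longrightarrow> x \<in> D \<longleftrightarrow> y \<in> D" and "\<And>D. A_periodic D \<Longrightarrow> x \<in> D \<longleftrightarrow> y \<in> D"
  shows "x = y"
proof (rule ccontr)
  assume "x \<noteq> y"
  then obtain D where "D \<in> HH" "x \<in> D" "y \<notin> D" using HH_separation core_V assms by metis
  then show False using core_classification[of D] assms by blast
qed

section \<open>Generic elements of \<open>A\<close>\<close>

lemma periodic_mult:
  assumes a: "a \<in> A" and b: "b \<in> A" and D: "D \<in> HH" and "periodic a D" "periodic b D"
  shows "periodic (a \<otimes> b) D"
proof -
  obtain k l where k: "k > 0" "pull (a [^] (k::int)) D = D" and l: "l > 0" "pull (b [^] (l::int)) D = D"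
    using assms(4,5) unfolding periodic_def by blast
  have "pull (a [^] (k * l)) D = D" using periodic_multiple[OF a D k(2), of "nat l"] l(1) by simp
  moreover have "pull (b [^] (k * l)) D = D"
    using periodic_multiple[OF b D l(2), of "nat k"] k(1) by (simp add: mult.commute)
  moreover have "(a \<otimes> b) [^] (k * l) = a [^] (k * l) \<otimes> b [^] (k * l)"
    using int_pow_mult_distrib A_commute a b by simp
  ultimately have "pull ((a \<otimes> b) [^] (k * l)) D = D" using pull_mult a b by simp
  then show ?thesis using k(1) l(1) unfolding periodic_def by (intro exI[of _ "k * l"]) simp
qed

lemma periodic_root:
  assumes "a \<in> A" "periodic (a [^] (k :: int)) D" "k > 0"
  shows "periodic a D"
proof -
  obtain l where l: "l > 0" "pull ((a [^] k) [^] (l :: int)) D = D" using assms(2) unfolding periodic_def by blast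
  then have "pull (a [^] (k * l)) D = D" using assms(1) by (simp add: int_pow_pow)
  then show ?thesis using l(1) assms(3) unfolding periodic_def by (intro exI[of _ "k * l"]) simp
qed

lemma A_skewered_split:
  assumes "A_skewered D" "x \<in> V"
  shows "\<exists>a\<in>A. \<exists>b\<in>A. \<phi> a x \<in> D \<and> \<phi> b x \<notin> D"
  using assms skewered_cross A_closed(4) unfolding A_skewered_def by blast

text \<open>
  The elements acting periodically on a given halfspace form an isolated subgroup, and only finitely
  many such subgroups occur for skewered halfspaces; so \<open>A\<close> is not their union.
\<close>

lemma exists_generic:
  obtains c where "c \<in> A" "\<And>D. A_skewered D \<Longrightarrow> \<not> periodic c D"
proof -
  have "\<exists>c\<in>A. \<forall>D\<in>F. \<not> periodic c D" if "F \<subseteq> separators y0" "\<forall>D\<in>F. A_skewered D" for F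
    using finite_subset[OF that(1) finite_separators[OF y0_V]] that(2)
  proof (induction F rule: finite_induct)
    case empty
    then show ?case using A_closed(1) by blast
  next
    case (insert D0 F)
    then obtain c where c: "c \<in> A" "\<forall>D\<in>F. \<not> periodic c D" by auto
    have H: "\<And>D. D \<in> insert D0 F \<Longrightarrow> D \<in> HH" using insert(4) A_skewered_HH by blast
    obtain b where b: "b \<in> A" "skewered b D0" using insert(4) unfolding A_skewered_def by auto
    then have nb: "\<not> periodic b D0" using skewered_not_periodic by blast
    show ?case
    proof (cases "periodic c D0")
      case False
      then show ?thesis using c by blast
    next
      case True
      \<comment> \<open>On \<open>D0\<close> no \<open>?e i\<close> is periodic, because
        \<open>c\<close> is and \<open>b\<close> is not. On each \<open>D\<close> in
        \<open>F\<close> at most one is, because the quotient of two would be a nonzero power of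
        \<open>c\<close>. Hence some \<open>i\<close> works for all.\<close>
      let ?e = "\<lambda>i::nat. c [^] int i \<otimes> b"
      have e: "?e i \<in> A" for i using b c by simp
      have "finite {i. periodic (?e i) D}" if D: "D \<in> F" for D
      proof -
        have False if "periodic (?e i) D" "periodic (?e j) D" "i < j" for i j
        proof -
          have "periodic (?e j \<otimes> inv (?e i)) D"
            using periodic_mult[OF e A_closed(2)[OF e]] periodic_inv[OF e] that H D by blast
          moreover have "?e j \<otimes> inv (?e i) = c [^] (int j - int i)"
          proof -
            have "?e j \<otimes> inv (?e i) = c [^] int j \<otimes> (b \<otimes> (inv b \<otimes> inv (c [^] int i)))"
              using b(1) c(1) by (simp add: inv_mult_group m_assoc)
            also have "\<dots> = c [^] int j \<otimes> c [^] (- int i)"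
              using b(1) c(1) cancel_inv[of b "inv (c [^] int i)"] by (simp add: int_pow_neg)
            finally show ?thesis using int_pow_mult[of c "int j" "- int i"] c(1) by simp
          qed
          ultimately have "periodic c D" using periodic_root[OF c(1), of "int j - int i" D] that(3) by simp
          then show False using c(2) D by blast
        qed
        then have "\<And>i j. i \<in> {i. periodic (?e i) D} \<Longrightarrow> j \<in> {i. periodic (?e i) D} \<Longrightarrow> i = j"
          by (metis linorder_neq_iff mem_Collect_eq)
        then show ?thesis by (metis finite.simps is_singletonI' is_singleton_def finite_insert finite.emptyI)
      qed
      then have "finite (\<Union>D\<in>F. {i. periodic (?e i) D})" using insert(1) by blast
      then obtain i where i: "i \<notin> (\<Union>D\<in>F. {i. periodic (?e i) D})" using ex_new_if_finite infinite_UNIV_nat by blast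
      have "\<not> periodic (?e i) D0"
      proof
        assume "periodic (?e i) D0"
        moreover have "periodic (c [^] (- int i)) D0"
        proof -
          obtain k where k: "k > 0" "pull (c [^] (k::int)) D0 = D0" using True unfolding periodic_def by blast
          have "pull (c [^] (k * int i)) D0 = D0" using periodic_multiple[OF c(1) _ k(2)] H by simp
          then have "pull (c [^] (- int i * k)) D0 = D0"
            using pull_pw_add[OF c(1), of "- (k * int i)" "k * int i" D0] pull_one[of D0] H
            by (simp add: mult.commute)
          then have "pull ((c [^] (- int i)) [^] k) D0 = D0" using c(1) by (simp add: int_pow_pow)
          then show ?thesis using k(1) unfolding periodic_def by blast
        qed
        ultimately have "periodic (c [^] (- int i) \<otimes> ?e i) D0"
          using periodic_mult[OF A_closed(4)[OF c(1)] e] H by blast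
        moreover have "c [^] (- int i) \<otimes> ?e i = b"
          using b(1) c(1) by (simp add: int_pow_neg flip: m_assoc)
        ultimately show False using nb by simp
      qed
      then show ?thesis using i e by blast
    qed
  qed
  moreover have "{D \<in> separators y0. A_skewered D} \<subseteq> separators y0" "\<forall>D\<in>{D \<in> separators y0. A_skewered D}. A_skewered D"
    by simp_all
  ultimately obtain c where "c \<in> A" "\<forall>D\<in>{D \<in> separators y0. A_skewered D}. \<not> periodic c D" by meson
  then have c: "c \<in> A" "\<And>D. D \<in> separators y0 \<Longrightarrow> A_skewered D \<Longrightarrow> \<not> periodic c D" by simp_all
  have "\<not> periodic c D" if D: "A_skewered D" for D
  proof -
    obtain b where b: "b \<in> A" "pull b D \<in> separators y0"
      using split_orbit[OF y0_V A_skewered_HH[OF D]] A_skewered_split[OF D y0_V] by blast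
    then have "\<not> periodic c (pull b D)" using c(2) A_skewered_pull[OF _ D] by simp
    then show ?thesis using periodic_pull[OF c(1) b(1)] by blast
  qed
  then show ?thesis using that c(1) by blast
qed

text \<open>The orbit of \<open>y0\<close> lies in the core and meets both sides of
  \<open>D\<close>, which rules out the peripheral cases.\<close>

lemma generic_skewered:
  assumes c: "c \<in> A" and D: "A_skewered D" "\<not> periodic c D"
  shows "skewered c D \<or> skewered c (V - D)"
proof -
  obtain a b where ab: "a \<in> A" "b \<in> A" "\<phi> a y0 \<in> D" "\<phi> b y0 \<notin> D" using A_skewered_split[OF D(1) y0_V] by blast
  have co: "\<phi> a y0 \<in> core" "\<phi> b y0 \<in> core" using core_act y0_core ab by simp_all
  have "\<not> peripheral c D" using core_peripheral[OF co(2) c] ab(4) by blast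
  moreover have "\<not> peripheral c (V - D)" using core_peripheral[OF co(1) c] ab(3) by blast
  ultimately show ?thesis using trichotomy[OF c A_skewered_HH[OF D(1)]] D(2) by blast
qed

text \<open>Generators are added one at a time. As \<open>A\<close> is abelian, a period of
  \<open>D\<close> under the new generator \<open>t\<close> is a period of all its translates, so
  finitely many powers of \<open>t\<close> suffice to close up the set.\<close>

lemma finite_perd_orbit:
  assumes D: "A_periodic D"
  shows "finite ((\<lambda>b. pull b D) ` A)"
proof -
  let ?O = "(\<lambda>b. pull b D) ` A"
  have DH: "D \<in> HH" using D by (rule A_periodic_HH)
  have OH: "E \<in> HH" if "E \<in> ?O" for E using that DH by auto
  have Opull: "pull a E \<in> ?O" if E: "E \<in> ?O" and a: "a \<in> A" for a E
  proof -
    obtain b where "b \<in> A" "E = pull b D" using E by blast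
    then show ?thesis using pull_mult[of b a D] a by (metis A_carrier A_closed(3) image_eqI)
  qed
  have "\<exists>P. finite P \<and> D \<in> P \<and> P \<subseteq> ?O \<and> (\<forall>s\<in>F. \<forall>E\<in>P. pull s E \<in> P)" if "F \<subseteq> S" for F
    using finite_subset[OF that S_finite] that
  proof (induction F rule: finite_induct)
    case empty
    have "D \<in> ?O" using pull_one[OF DH] A_closed(1) by (metis image_eqI)
    then show ?case by (intro exI[of _ "{D}"]) auto
  next
    case (insert t F)
    then obtain P where P: "finite P" "D \<in> P" "P \<subseteq> ?O" "\<forall>s\<in>F. \<forall>E\<in>P. pull s E \<in> P" by auto
    have t: "t \<in> A" using insert(4) S_subset by simp
    have s: "s \<in> A" if "s \<in> F" for s using insert(4) S_subset that by blast
    obtain k where k: "k > 0" "pull (t [^] (k::int)) D = D" using D t unfolding A_periodic_def periodic_def by blast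
    have kE: "pull (t [^] k) E = E" if E: "E \<in> P" for E
    proof -
      obtain b where "b \<in> A" "E = pull b D" using E P(3) by blast
      then show ?thesis using pull_commute[of "t [^] k" b D] t k(2) by simp
    qed
    let ?P = "\<Union>i\<in>{0..<k}. pull (t [^] i) ` P"
    have f1: "finite ?P" using P(1) by blast
    have "pull (t [^] (0::int)) D = D" using pull_one[OF DH] by simp
    then have "D \<in> pull (t [^] (0::int)) ` P" using P(2) by (metis image_eqI)
    then have f2: "D \<in> ?P" using k(1) by (intro UN_I[of 0]) auto
    have f3: "?P \<subseteq> ?O"
    proof
      fix E assume "E \<in> ?P"
      then obtain i E' where "E' \<in> P" "E = pull (t [^] (i::int)) E'" by blast
      then show "E \<in> ?O" using Opull[of E' "t [^] i"] P(3) t by (simp add: subset_iff)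
    qed
    have f4: "pull r E \<in> ?P" if r: "r \<in> insert t F" and E: "E \<in> ?P" for r E
    proof -
      obtain i E' where i: "0 \<le> i" "i < k" "E' \<in> P" "E = pull (t [^] i) E'" using E by auto
      show ?thesis
      proof (cases "r = t")
        case True
        have "pull t E = pull (t [^] (1 + i)) E'" unfolding i(4) pull_pw_add[OF t] using t by simp
        moreover have "pull (t [^] (1 + i)) E' \<in> ?P"
        proof (cases "1 + i < k")
          case True
          then show ?thesis using i(1,3) by (intro UN_I[of "1 + i"] imageI) simp_all
        next
          case False
          then have "1 + i = k" using i by simp
          then have "pull (t [^] (1 + i)) E' = pull (t [^] (0::int)) E'"
            using kE[OF i(3)] pull_one[OF OH] i(3) P(3) by (simp add: subset_iff)
          then show ?thesis using i(3) k(1) by (simp only:) (intro UN_I[of 0] imageI; simp)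
        qed
        ultimately show ?thesis using True by simp
      next
        case False
        then have rF: "r \<in> F" using r by simp
        have "pull r E = pull (t [^] i) (pull r E')" unfolding i(4) using pull_commute s[OF rF] t by simp
        moreover have "pull r E' \<in> P" using P(4) rF i(3) by blast
        ultimately show ?thesis using i(1,2) by (simp only:) (intro UN_I[of i] imageI; simp)
      qed
    qed
    show ?case
    proof (rule exI[of _ ?P], intro conjI ballI)
      show "pull s E \<in> ?P" if "s \<in> insert t F" "E \<in> ?P" for s E using f4 that .
    qed (fact f1 f2 f3)+
  qed
  from this[OF subset_refl] obtain P where P: "finite P" "D \<in> P" "P \<subseteq> ?O" "\<forall>s\<in>S. \<forall>E\<in>P. pull s E \<in> P" by blast
  have PH: "E \<in> HH" if "E \<in> P" for E using that P(3) OH by blast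
  \<comment> \<open>An injective self-map of a finite set is onto, so closure under a generator
    implies closure under its inverse.\<close>
  have inv: "pull (inv s) E \<in> P" if s: "s \<in> S" and E: "E \<in> P" for s E
  proof -
    have sA: "s \<in> A" using S_subset s .
    have "inj_on (pull s) P"
      by (rule inj_on_inverseI[of _ "pull (inv s)"]) (use pull_inv(2)[of s] sA PH in simp)
    moreover have "pull s ` P \<subseteq> P" using P(4) s by blast
    ultimately have "pull s ` P = P" using P(1) endo_inj_surj by blast
    then obtain E' where "E' \<in> P" "E = pull s E'" using E by blast
    then show ?thesis using pull_inv(2)[of s E'] sA PH by simp
  qed
  have "h \<in> A \<and> (\<forall>E\<in>P. pull h E \<in> P)" if "h \<in> generate G S" for h
    using that
  proof (induction h rule: generate.induct)
    case one
    then show ?case using pull_one PH by simp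
  next
    case (incl h)
    then show ?case using P(4) S_subset by blast
  next
    case (inv h)
    then show ?case using \<open>\<And>s E. s \<in> S \<Longrightarrow> E \<in> P \<Longrightarrow> pull (inv s) E \<in> P\<close> S_subset by simp
  next
    case (eng h1 h2)
    then show ?case using pull_mult[of h1 h2] by simp
  qed
  then have "?O \<subseteq> P" using S_generates P(2) by blast
  then show ?thesis using P(1) by (rule finite_subset)
qed

section \<open>Periodic halfspaces that split orbits\<close>

definition split_walls :: "'x \<Rightarrow> 'x set set" where
  "split_walls x = {D. A_periodic D \<and> (\<exists>a\<in>A. \<phi> a x \<in> D) \<and> (\<exists>b\<in>A. \<phi> b x \<notin> D)}"

lemma not_split:
  assumes "A_periodic D" "D \<notin> split_walls x" "x \<in> V" "a \<in> A"
  shows "\<phi> a x \<in> D \<longleftrightarrow> x \<in> D"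
proof -
  have "\<phi> \<one> x = x" using assms by simp
  then show ?thesis using assms A_closed(1) unfolding split_walls_def by (metis (mono_tags, lifting) mem_Collect_eq)
qed

text \<open>By \<open>split_orbit\<close> they form finitely many orbits, each finite by
  \<open>finite_perd_orbit\<close>.\<close>

lemma finite_split:
  assumes x: "x \<in> V"
  shows "finite (split_walls x)"
proof -
  let ?U = "\<Union>D\<in>{D \<in> separators x. A_periodic D}. (\<lambda>b. pull b D) ` A"
  have "finite ?U" using finite_separators[OF x] finite_perd_orbit by (intro finite_UN_I) auto
  moreover have "split_walls x \<subseteq> ?U"
  proof
    fix D assume "D \<in> split_walls x"
    then obtain a b where D: "A_periodic D" and ab: "a \<in> A" "b \<in> A" "\<phi> a x \<in> D" "\<phi> b x \<notin> D" unfolding split_walls_def by blast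
    obtain c where c: "c \<in> A" "pull c D \<in> separators x" using split_orbit[OF x A_periodic_HH[OF D] ab] by blast
    have "D = pull (inv c) (pull c D)" using pull_inv(2)[of c D] A_periodic_HH[OF D] c by simp
    then have "D \<in> (\<lambda>b. pull b (pull c D)) ` A" using c(1) A_closed(2) by blast
    moreover have "A_periodic (pull c D)" using A_periodic_pull D c by simp
    ultimately show "D \<in> ?U" using c(2) by blast
  qed
  ultimately show ?thesis by (rule rev_finite_subset)
qed

lemma common_period:
  assumes a: "a \<in> A" and "finite F" "\<And>D. D \<in> F \<Longrightarrow> A_periodic D"
  shows "\<exists>k>0::int. \<forall>D\<in>F. pull (a [^] k) D = D"
  using assms(2,3)
proof (induction F rule: finite_induct)
  case empty
  then show ?case by (intro exI[of _ 1]) simp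
next
  case (insert D F)
  then obtain k where k: "k > 0" "\<forall>D\<in>F. pull (a [^] (k::int)) D = D" by auto
  obtain l where l: "l > 0" "pull (a [^] (l::int)) D = D"
    using insert(4) a unfolding A_periodic_def periodic_def by blast
  have "pull (a [^] (k * l)) E = E" if E: "E \<in> insert D F" for E
  proof (cases "E = D")
    case True
    then show ?thesis using periodic_multiple[OF a _ l(2), of "nat k"] A_periodic_HH insert(4) k(1)
      by (simp add: mult.commute)
  next
    case False
    then show ?thesis using periodic_multiple[OF a _ , of E k "nat l"] A_periodic_HH insert(4) k(2) l(1) E by simp
  qed
  then show ?case using k(1) l(1) by (intro exI[of _ "k * l"]) simp
qed

text \<open>The median of \<open>y\<close> with two far points of the orbit of \<open>z\<close>,
  forward and backward under a generic \<open>c\<close>. A halfspace skewered by \<open>c\<close>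
  contains the forward point if it contains \<open>y\<close>, and misses the backward one if it
  misses \<open>y\<close>, so the median follows \<open>y\<close>. A power of the generic element is
  taken that fixes all periodic halfspaces splitting the orbit of \<open>z\<close>; so both far
  points are on the side of \<open>z\<close> for every periodic halfspace.\<close>

lemma core_product:
  assumes y: "y \<in> core" and z: "z \<in> core"
  shows "\<exists>w\<in>core. (\<forall>D. A_skewered D \<longrightarrow> (w \<in> D \<longleftrightarrow> y \<in> D)) \<and> (\<forall>D. A_periodic D \<longrightarrow> (w \<in> D \<longleftrightarrow> z \<in> D))"
proof -
  note yV = core_V[OF y] and zV = core_V[OF z]
  obtain a where a: "a \<in> A" "\<And>D. A_skewered D \<Longrightarrow> \<not> periodic a D" using exists_generic by blast
  obtain k where k: "k > 0" "\<forall>D\<in>split_walls z. pull (a [^] (k::int)) D = D"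
    using common_period[OF a(1) finite_split[OF zV]] unfolding split_walls_def by auto
  let ?c = "a [^] k"
  have c: "?c \<in> A" using a(1) by simp
  obtain M1 where M1: "M1 \<ge> 0" "\<forall>n\<ge>M1. \<forall>D. skewered ?c D \<and> y \<in> D \<longrightarrow> pw ?c n z \<in> D"
    using push[OF c yV zV] by blast
  obtain M2 where M2: "M2 \<ge> 0" "\<forall>n\<ge>M2. \<forall>D. skewered ?c D \<and> y \<notin> D \<longrightarrow> pw ?c (- n) z \<notin> D"
    using push_back[OF c yV zV] by blast
  obtain M3 where M3: "M3 \<ge> 0" "\<forall>n\<ge>M3. \<forall>D. skewered ?c D \<and> z \<in> D \<longrightarrow> pw ?c n z \<in> D"
    using push[OF c zV zV] by blast
  define n where "n = max M1 M2"
  have n: "n \<ge> M1" "n \<ge> M2" "n \<ge> 0" using M1(1) unfolding n_def by auto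
  let ?w = "m y (pw ?c n z) (pw ?c (- n) z)"
  have pV: "pw ?c n z \<in> V" "pw ?c (- n) z \<in> V" using c zV by simp_all
  have core: "?w \<in> core" using core_median[OF y] core_act z c by simp
  have sk: "?w \<in> D \<longleftrightarrow> y \<in> D" if D: "skewered ?c D" for D
  proof -
    have "D \<in> HH" using D unfolding skewered_def by simp
    moreover have "y \<in> D \<Longrightarrow> pw ?c n z \<in> D" using M1(2) n(1) D by blast
    moreover have "y \<notin> D \<Longrightarrow> pw ?c (- n) z \<notin> D" using M2(2) n(2) D by blast
    ultimately show ?thesis using HH_majority[of D y "pw ?c n z" "pw ?c (- n) z"] yV pV by blast
  qed
  have "?w \<in> D \<longleftrightarrow> y \<in> D" if D: "A_skewered D" for D
  proof -
    consider "skewered a D" | "skewered a (V - D)" using generic_skewered[OF a(1) D a(2)[OF D]] by blast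
    then show ?thesis
    proof cases
      case 1
      then show ?thesis using sk skewered_pow[OF a(1) _ k(1)] by blast
    next
      case 2
      then have "?w \<in> V - D \<longleftrightarrow> y \<in> V - D" using sk skewered_pow[OF a(1) _ k(1)] by blast
      then show ?thesis using yV core_V[OF core] by blast
    qed
  qed
  moreover have "?w \<in> D \<longleftrightarrow> z \<in> D" if D: "A_periodic D" for D
  proof -
    have "pw ?c i z \<in> D \<longleftrightarrow> z \<in> D" for i
    proof (cases "D \<in> split_walls z")
      case False
      then show ?thesis using not_split[OF D _ zV] c by simp
    next
      case True
      then have kD: "pull ?c D = D" using k(2) by blast
      have pos: "pull (?c [^] int j) D = D" for j
        using periodic_multiple[OF c A_periodic_HH[OF D], of 1 j] kD c by simp
      have neg: "pull (?c [^] (- int j)) D = D" for j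
        using pos[of j] pull_pw_add[OF c, of "- int j" "int j" D] pull_one[OF A_periodic_HH[OF D]] by simp
      have "pull (?c [^] i) D = D" using pos neg by (cases i rule: int_cases2) simp_all
      then show ?thesis using mem_pull[OF zV] by metis
    qed
    then show ?thesis using HH_majority[OF A_periodic_HH[OF D] yV pV] by blast
  qed
  ultimately show ?thesis using core by blast
qed

text \<open>The witness is the gate of \<open>z\<close> in the convex hull of the orbit of \<open>y\<close>, as seen by periodic halfspaces.\<close>

lemma core_gate:
  assumes y: "y \<in> core" and z: "z \<in> core"
  shows "\<exists>w\<in>core. \<forall>D. A_periodic D \<longrightarrow> (w \<in> D \<longleftrightarrow> (if D \<in> split_walls y then z \<in> D else y \<in> D))"
proof -
  note yV = core_V[OF y] and zV = core_V[OF z]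
  \<comment> \<open>The two implications describe the gate of \<open>z\<close> in the convex hull of
    finitely many orbit points; the median with one more orbit point enlarges the hull.\<close>
  have fold: "\<exists>w\<in>core. \<forall>D\<in>HH. (z \<in> D \<longrightarrow> (w \<in> D \<longleftrightarrow> (\<exists>b\<in>insert \<one> B. \<phi> b y \<in> D))) \<and>
      (z \<notin> D \<longrightarrow> (w \<in> D \<longleftrightarrow> (\<forall>b\<in>insert \<one> B. \<phi> b y \<in> D)))"
    if "finite B" "B \<subseteq> A" for B
    using that
  proof (induction B rule: finite_induct)
    case empty
    then show ?case using y yV by (intro bexI[of _ y]) auto
  next
    case (insert b B)
    then obtain w where w: "w \<in> core" "\<forall>D\<in>HH. (z \<in> D \<longrightarrow> (w \<in> D \<longleftrightarrow> (\<exists>b\<in>insert \<one> B. \<phi> b y \<in> D))) \<and>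
      (z \<notin> D \<longrightarrow> (w \<in> D \<longleftrightarrow> (\<forall>b\<in>insert \<one> B. \<phi> b y \<in> D)))" by auto
    have b: "b \<in> carrier G" using insert(4) by simp
    let ?w = "m z (\<phi> b y) w"
    have "?w \<in> core" using core_median[OF z core_act[OF b y] w(1)] .
    moreover have "(z \<in> D \<longrightarrow> (?w \<in> D \<longleftrightarrow> (\<exists>b\<in>insert \<one> (insert b B). \<phi> b y \<in> D))) \<and>
      (z \<notin> D \<longrightarrow> (?w \<in> D \<longleftrightarrow> (\<forall>b\<in>insert \<one> (insert b B). \<phi> b y \<in> D)))" if D: "D \<in> HH" for D
    proof -
      have "?w \<in> D \<longleftrightarrow> z \<in> D \<and> \<phi> b y \<in> D \<or> \<phi> b y \<in> D \<and> w \<in> D \<or> z \<in> D \<and> w \<in> D"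
        using HH_majority[OF D zV _ core_V[OF w(1)]] b yV by simp
      then show ?thesis using w(2) D by auto
    qed
    ultimately show ?case by blast
  qed
  have "\<forall>D\<in>split_walls y. \<exists>a. a \<in> A \<and> \<phi> a y \<in> D" "\<forall>D\<in>split_walls y. \<exists>b. b \<in> A \<and> \<phi> b y \<notin> D"
    unfolding split_walls_def by blast+
  then obtain f g where fg: "\<forall>D\<in>split_walls y. f D \<in> A \<and> \<phi> (f D) y \<in> D" "\<forall>D\<in>split_walls y. g D \<in> A \<and> \<phi> (g D) y \<notin> D"
    unfolding bchoice_iff by blast
  \<comment> \<open>\<open>?B\<close> meets both sides of every splitting halfspace, so there the
    existential condition holds, the universal one fails, and \<open>z\<close> decides.\<close>
  let ?B = "f ` split_walls y \<union> g ` split_walls y"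
  have B: "finite ?B" "?B \<subseteq> A" using finite_split[OF yV] fg by auto
  obtain w where w: "w \<in> core" "\<forall>D\<in>HH. (z \<in> D \<longrightarrow> (w \<in> D \<longleftrightarrow> (\<exists>b\<in>insert \<one> ?B. \<phi> b y \<in> D))) \<and>
      (z \<notin> D \<longrightarrow> (w \<in> D \<longleftrightarrow> (\<forall>b\<in>insert \<one> ?B. \<phi> b y \<in> D)))" using fold[OF B] by blast
  have "w \<in> D \<longleftrightarrow> (if D \<in> split_walls y then z \<in> D else y \<in> D)" if D: "A_periodic D" for D
  proof (cases "D \<in> split_walls y")
    case True
    then have "f D \<in> ?B" "g D \<in> ?B" "\<phi> (f D) y \<in> D" "\<phi> (g D) y \<notin> D" using fg by auto
    then have "\<exists>b\<in>insert \<one> ?B. \<phi> b y \<in> D" "\<not> (\<forall>b\<in>insert \<one> ?B. \<phi> b y \<in> D)" by blast+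
    then have "w \<in> D \<longleftrightarrow> z \<in> D" using bspec[OF w(2) A_periodic_HH[OF D]] by argo
    then show ?thesis using True by simp
  next
    case False
    then have "\<phi> b y \<in> D \<longleftrightarrow> y \<in> D" if "b \<in> insert \<one> ?B" for b
      using not_split[OF D False yV] B(2) that A_closed(1) by blast
    then have "(\<exists>b\<in>insert \<one> ?B. \<phi> b y \<in> D) \<longleftrightarrow> y \<in> D" "(\<forall>b\<in>insert \<one> ?B. \<phi> b y \<in> D) \<longleftrightarrow> y \<in> D" by blast+
    then have "w \<in> D \<longleftrightarrow> y \<in> D" using bspec[OF w(2) A_periodic_HH[OF D]] by argo
    then show ?thesis using False by simp
  qed
  then show ?thesis using w(1) by blast
qed

section \<open>Points with the fewest splitting halfspaces\<close>

definition Y :: "'x set" where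
  "Y = {y \<in> core. \<forall>x\<in>core. card (split_walls y) \<le> card (split_walls x)}"

lemma Y_core: "y \<in> Y \<Longrightarrow> y \<in> core"
  unfolding Y_def by blast

lemma Y_V: "y \<in> Y \<Longrightarrow> y \<in> V"
  using Y_core core_V by blast

lemma Y_nonempty: "Y \<noteq> {}"
proof -
  obtain y where "y \<in> core" "\<forall>x. x \<in> core \<longrightarrow> card (split_walls y) \<le> card (split_walls x)"
    using ex_has_least_nat[of "\<lambda>y. y \<in> core" y0 "\<lambda>y. card (split_walls y)"] y0_core by blast
  then show ?thesis unfolding Y_def by blast
qed

lemma Y_split_subset:
  assumes y: "y \<in> Y" and w: "w \<in> core" "split_walls w \<subseteq> split_walls y"
  shows "w \<in> Y" "split_walls w = split_walls y"
proof -
  have "card (split_walls w) \<le> card (split_walls y)" using card_mono[OF finite_split[OF Y_V[OF y]] w(2)] .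
  then show "w \<in> Y" using y w(1) unfolding Y_def by (auto intro: le_trans)
  then have "card (split_walls y) \<le> card (split_walls w)" using y w(1) unfolding Y_def by blast
  then show "split_walls w = split_walls y" using card_seteq[OF finite_split[OF Y_V[OF y]] w(2)] by blast
qed

text \<open>Translates of splitting halfspaces are splitting, so the formula for \<open>w\<close>
  carries over to its whole orbit: halfspaces that do not split the orbit of \<open>y\<close> see a
  constant side, the others see the orbit of \<open>z\<close>.\<close>

lemma gate_split:
  assumes V: "w \<in> V" "y \<in> V" "z \<in> V"
    and gate: "\<And>D. A_periodic D \<Longrightarrow> w \<in> D \<longleftrightarrow> (if D \<in> split_walls y then z \<in> D else y \<in> D)"
  shows "split_walls w \<subseteq> split_walls y" "split_walls w \<subseteq> split_walls z"
proof -
  have pull: "pull a D \<in> split_walls y \<longleftrightarrow> D \<in> split_walls y" if a: "a \<in> A" and D: "A_periodic D" for a D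
  proof -
    have s: "D' \<in> split_walls y" if D': "A_periodic D'" "pull b D' \<in> split_walls y" and b: "b \<in> A" for b D'
    proof -
      obtain c d where cd: "c \<in> A" "d \<in> A" "\<phi> c y \<in> pull b D'" "\<phi> d y \<notin> pull b D'"
        using D'(2) unfolding split_walls_def by blast
      then have "\<phi> (b \<otimes> c) y \<in> D'" "\<phi> (b \<otimes> d) y \<notin> D'" using act_mult[of b _ y] b V by simp_all
      then show ?thesis using cd b D'(1) unfolding split_walls_def by (blast intro: A_closed(3))
    qed
    show ?thesis using s[of D a] s[of "pull a D" "inv a"] D a A_periodic_pull[of a D] pull_inv(2)[of a D] A_periodic_HH by auto
  qed
  have aw: "\<phi> a w \<in> D \<longleftrightarrow> (if D \<in> split_walls y then \<phi> a z \<in> D else \<phi> a y \<in> D)" if a: "a \<in> A" and D: "A_periodic D" for a D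
    using gate[of "pull a D"] pull[OF a D] A_periodic_pull[of a D] a D V by (simp split: if_splits)
  show "split_walls w \<subseteq> split_walls y"
  proof
    fix D assume D: "D \<in> split_walls w"
    then have pD: "A_periodic D" unfolding split_walls_def by blast
    show "D \<in> split_walls y"
    proof (rule ccontr)
      assume "D \<notin> split_walls y"
      then have "\<phi> a w \<in> D \<longleftrightarrow> y \<in> D" if "a \<in> A" for a using aw[OF that pD] not_split[OF pD _ V(2) that] by simp
      then show False using D unfolding split_walls_def by blast
    qed
  qed
  then show "split_walls w \<subseteq> split_walls z" using aw unfolding split_walls_def by (auto split: if_splits)
qed

text \<open>For the gate of \<open>z\<close> on the orbit of \<open>y\<close>, minimality turns both
  inclusions of \<open>gate_split\<close> into equalities.\<close>

lemma Y_split: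
  assumes "y \<in> Y" "z \<in> Y"
  shows "split_walls y = split_walls z"
proof -
  obtain w where w: "w \<in> core" "\<And>D. A_periodic D \<Longrightarrow> w \<in> D \<longleftrightarrow> (if D \<in> split_walls y then z \<in> D else y \<in> D)"
    using core_gate[OF Y_core[OF assms(1)] Y_core[OF assms(2)]] by blast
  note s = gate_split[OF core_V[OF w(1)] Y_V[OF assms(1)] Y_V[OF assms(2)] w(2)]
  show ?thesis using Y_split_subset(2)[OF assms(1) w(1) s(1)] Y_split_subset(2)[OF assms(2) w(1) s(2)] by simp
qed

text \<open>The chosen point is immaterial, by \<open>Y_split\<close>.\<close>

definition Q_walls :: "'x set set" where
  "Q_walls = split_walls (SOME y. y \<in> Y)"

lemma split_Q_walls: "y \<in> Y \<Longrightarrow> split_walls y = Q_walls"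
  unfolding Q_walls_def using Y_split Y_nonempty by (metis some_in_eq)

lemma Y_I: "w \<in> core \<Longrightarrow> split_walls w \<subseteq> Q_walls \<Longrightarrow> w \<in> Y"
  using Y_split_subset(1) split_Q_walls Y_nonempty by blast

lemma Q_walls_A_periodic: "D \<in> Q_walls \<Longrightarrow> A_periodic D"
  unfolding Q_walls_def split_walls_def by blast

lemma Q_walls_HH: "D \<in> Q_walls \<Longrightarrow> D \<in> HH"
  using Q_walls_A_periodic A_periodic_HH by blast

lemma finite_Q_walls: "finite Q_walls"
  using finite_split split_Q_walls Y_V Y_nonempty by (metis ex_in_conv)

lemma Y_constant: "y \<in> Y \<Longrightarrow> A_periodic D \<Longrightarrow> D \<notin> Q_walls \<Longrightarrow> a \<in> A \<Longrightarrow> \<phi> a y \<in> D \<longleftrightarrow> y \<in> D"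
  using not_split[of D y a] split_Q_walls Y_V by blast

lemma Q_walls_split: "y \<in> Y \<Longrightarrow> D \<in> Q_walls \<Longrightarrow> (\<exists>a\<in>A. \<phi> a y \<in> D) \<and> (\<exists>a\<in>A. \<phi> a y \<notin> D)"
  using split_Q_walls unfolding split_walls_def by blast

text \<open>A periodic halfspace outside \<open>Q_walls\<close> contains or misses each of the three
  orbits as a whole, hence also that of the median.\<close>

lemma Y_median:
  assumes "x \<in> Y" "y \<in> Y" "z \<in> Y"
  shows "m x y z \<in> Y"
proof (rule Y_I)
  show "m x y z \<in> core" using core_median Y_core assms by blast
  note V = Y_V[OF assms(1)] Y_V[OF assms(2)] Y_V[OF assms(3)]
  show "split_walls (m x y z) \<subseteq> Q_walls"
  proof
    fix D assume D: "D \<in> split_walls (m x y z)"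
    then have pD: "A_periodic D" unfolding split_walls_def by blast
    show "D \<in> Q_walls"
    proof (rule ccontr)
      assume nD: "D \<notin> Q_walls"
      have "\<phi> a (m x y z) \<in> D \<longleftrightarrow> m x y z \<in> D" if a: "a \<in> A" for a
        using act_median[OF _ V, of a] a Y_constant[OF _ pD nD a] assms V
          HH_majority[OF A_periodic_HH[OF pD] V] HH_majority[OF A_periodic_HH[OF pD], of "\<phi> a x" "\<phi> a y" "\<phi> a z"] by simp
      then show False using D unfolding split_walls_def by blast
    qed
  qed
qed

lemma split_act_iff:
  assumes g: "g \<in> carrier G" and y: "y \<in> V" and D: "D \<in> split_walls (\<phi> g y)"
  shows "pull g D \<in> split_walls y"
proof -
  obtain a b where D': "A_periodic D" and ab: "a \<in> A" "b \<in> A" "\<phi> a (\<phi> g y) \<in> D" "\<phi> b (\<phi> g y) \<notin> D"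
    using D unfolding split_walls_def by blast
  have "\<phi> (conjugate g a) y \<in> pull g D \<longleftrightarrow> \<phi> a (\<phi> g y) \<in> D" if "a \<in> A" for a
    using act_conj_pow[OF g that y, of 1] that conj_A[OF g that] y by simp
  then have "\<phi> (conjugate g a) y \<in> pull g D" "\<phi> (conjugate g b) y \<notin> pull g D" using ab by blast+
  then show ?thesis using conj_A[OF g] ab A_periodic_pull[OF g D'] unfolding split_walls_def by blast
qed

lemma card_split_act:
  assumes g: "g \<in> carrier G" and y: "y \<in> V"
  shows "card (split_walls (\<phi> g y)) \<le> card (split_walls y)"
proof (rule card_inj_on_le)
  show "inj_on (pull g) (split_walls (\<phi> g y))"
    by (rule inj_on_inverseI[of _ "pull (inv g)"])
      (use pull_inv(2)[OF g] A_periodic_HH in \<open>simp add: split_walls_def\<close>)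
  show "pull g ` split_walls (\<phi> g y) \<subseteq> split_walls y" using split_act_iff[OF g y] by blast
  show "finite (split_walls y)" using finite_split[OF y] .
qed

lemma Y_act:
  assumes g: "g \<in> carrier G" and y: "y \<in> Y"
  shows "\<phi> g y \<in> Y"
  using core_act[OF g Y_core[OF y]] card_split_act[OF g Y_V[OF y]] y
  unfolding Y_def by (auto intro: le_trans)

lemma Q_walls_pull:
  assumes g: "g \<in> carrier G" and D: "D \<in> Q_walls"
  shows "pull g D \<in> Q_walls"
proof -
  obtain y where y: "y \<in> Y" using Y_nonempty by blast
  then have "D \<in> split_walls (\<phi> g y)" using split_Q_walls[OF Y_act[OF g y]] D by simp
  then show ?thesis using split_act_iff[OF g Y_V[OF y]] split_Q_walls[OF y] by blast
qed

lemma Q_walls_compl: "D \<in> Q_walls \<Longrightarrow> V - D \<in> Q_walls"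
proof -
  assume D: "D \<in> Q_walls"
  obtain y where y: "y \<in> Y" using Y_nonempty by blast
  have "\<phi> a y \<in> V" if "a \<in> A" for a using Y_V[OF y] that by simp
  then have "V - D \<in> split_walls y"
    using D A_periodic_compl[OF Q_walls_A_periodic[OF D]] Q_walls_split[OF y D] unfolding split_walls_def by blast
  then show ?thesis using split_Q_walls[OF y] by simp
qed

section \<open>The three classes of halfspaces\<close>

definition F_walls :: "'x set set" where "F_walls = {D. A_skewered D}"

definition T_walls :: "'x set set" where "T_walls = {D. A_periodic D \<and> D \<notin> Q_walls}"

lemma F_walls_pull: "g \<in> carrier G \<Longrightarrow> D \<in> F_walls \<Longrightarrow> pull g D \<in> F_walls"
  unfolding F_walls_def using A_skewered_pull by blast

lemma T_walls_pull: 
  assumes g: "g \<in> carrier G" and D: "D \<in> T_walls"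
  shows "pull g D \<in> T_walls"
proof -
  have pD: "A_periodic D" "D \<notin> Q_walls" using D unfolding T_walls_def by auto
  have "pull g D \<notin> Q_walls"
    using Q_walls_pull[of "inv g" "pull g D"] pull_inv(2)[OF g A_periodic_HH[OF pD(1)]] pD(2) g by auto
  then show ?thesis using A_periodic_pull[OF g pD(1)] unfolding T_walls_def by blast
qed

definition agree :: "'x set set \<Rightarrow> 'x \<Rightarrow> 'x \<Rightarrow> bool" where
  "agree C x y \<longleftrightarrow> (\<forall>D\<in>C. x \<in> D \<longleftrightarrow> y \<in> D)"

lemma Y_eqI:
  assumes "x \<in> Y" "y \<in> Y" "agree T_walls x y" "agree F_walls x y" "agree Q_walls x y"
  shows "x = y"
proof (rule core_eqI)
  show "x \<in> core" "y \<in> core" using assms Y_core by blast+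
  show "x \<in> D \<longleftrightarrow> y \<in> D" if "A_skewered D" for D using assms(4) that unfolding agree_def F_walls_def by blast
  show "x \<in> D \<longleftrightarrow> y \<in> D" if "A_periodic D" for D using assms(3,5) that unfolding agree_def T_walls_def by blast
qed

text \<open>\<open>core_gate\<close> replaces the sides for \<open>Q_walls\<close> and keeps those
  for \<open>T_walls\<close>; \<open>core_product\<close> then replaces those for
  \<open>F_walls\<close> and keeps all periodic ones.\<close>

lemma Y_product:
  assumes x: "x \<in> Y" and y: "y \<in> Y" and z: "z \<in> Y"
  shows "\<exists>w\<in>Y. agree T_walls w x \<and> agree F_walls w y \<and> agree Q_walls w z"
proof -
  obtain u where u: "u \<in> core" "\<And>D. A_periodic D \<Longrightarrow> u \<in> D \<longleftrightarrow> (if D \<in> split_walls x then z \<in> D else x \<in> D)"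
    using core_gate[OF Y_core[OF x] Y_core[OF z]] by blast
  obtain w where w: "w \<in> core" "\<And>D. A_skewered D \<Longrightarrow> w \<in> D \<longleftrightarrow> y \<in> D" "\<And>D. A_periodic D \<Longrightarrow> w \<in> D \<longleftrightarrow> u \<in> D"
    using core_product[OF Y_core[OF y] u(1)] by blast
  have g: "w \<in> D \<longleftrightarrow> (if D \<in> split_walls x then z \<in> D else x \<in> D)" if "A_periodic D" for D
    using w(3)[OF that] u(2)[OF that] by simp
  have "split_walls w \<subseteq> Q_walls" using gate_split(1)[OF core_V[OF w(1)] Y_V[OF x] Y_V[OF z] g] split_Q_walls[OF x] by simp
  then have "w \<in> Y" using Y_I w(1) by blast
  moreover have "agree T_walls w x" "agree Q_walls w z"
    using g Q_walls_A_periodic split_Q_walls[OF x] unfolding agree_def T_walls_def by auto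
  moreover have "agree F_walls w y" using w(2) unfolding agree_def F_walls_def by blast
  ultimately show ?thesis by blast
qed

lemma A_agree_T_walls: "a \<in> A \<Longrightarrow> y \<in> Y \<Longrightarrow> agree T_walls (\<phi> a y) y"
  unfolding agree_def T_walls_def using Y_constant by blast


subsection \<open>Factors\<close>

definition alg :: "'x set \<Rightarrow> 'x med_alg" where
  "alg K = \<lparr>carrier = K, med = m\<rparr>"

lemma alg_simps [simp]: "carrier (alg K) = K" "med (alg K) = m"
  unfolding alg_def by simp_all

lemma V_eqI:
  assumes "p \<in> V" "q \<in> V" "\<And>D. D \<in> HH \<Longrightarrow> p \<in> D \<longleftrightarrow> q \<in> D"
  shows "p = q"
  using HH_separation assms by blast

lemma median_algebra_alg:
  assumes K: "K \<subseteq> V" "\<And>x y z. x \<in> K \<Longrightarrow> y \<in> K \<Longrightarrow> z \<in> K \<Longrightarrow> m x y z \<in> K"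
  shows "median_algebra (alg K)"
proof -
  have V: "x \<in> V" if "x \<in> K" for x using K(1) that by blast
  have 1: "m x y y = y" if "x \<in> K" "y \<in> K" for x y
    by (rule V_eqI) (use that V K(2) HH_majority in \<open>blast+\<close>)
  have 2: "m x y z = m z x y" "m x y z = m x z y" if "x \<in> K" "y \<in> K" "z \<in> K" for x y z
    using that V K(2) HH_majority[of _ x y z] HH_majority[of _ z x y] HH_majority[of _ x z y]
    by (auto intro!: V_eqI)
  have 3: "m (m x w y) w z = m x w (m y w z)" if "x \<in> K" "y \<in> K" "z \<in> K" "w \<in> K" for x y z w
  proof (rule V_eqI)
    note mv = V[OF K(2)[OF that(1,4,2)]] V[OF K(2)[OF that(2,4,3)]] and v = that[THEN V]
    show "m (m x w y) w z \<in> V" "m x w (m y w z) \<in> V" using med_closed mv v by blast+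
    fix D assume D: "D \<in> HH"
    show "m (m x w y) w z \<in> D \<longleftrightarrow> m x w (m y w z) \<in> D"
      using HH_majority[OF D mv(1) v(4,3)] HH_majority[OF D v(1,4,2)]
        HH_majority[OF D v(1,4) mv(2)] HH_majority[OF D v(2,4,3)] by argo
  qed
  show ?thesis unfolding median_algebra_def alg_simps
    by (intro conjI ballI; (rule K(2) | rule 1 | rule 2(1) | rule 2(2) | rule 3); assumption)
qed

text \<open>A factor is realised inside \<open>Y\<close>, as the points that agree with
  \<open>b\<close> on the walls of the other factors; this keeps the point type of the
  complex.\<close>

definition fibre :: "'x set set \<Rightarrow> 'x \<Rightarrow> 'x set" where
  "fibre C' b = {x \<in> Y. agree C' x b}"

lemma fibre_median:
  assumes "C' \<subseteq> HH" "b \<in> Y" "x \<in> fibre C' b" "y \<in> fibre C' b" "z \<in> fibre C' b"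
  shows "m x y z \<in> fibre C' b"
proof -
  have Y: "x \<in> Y" "y \<in> Y" "z \<in> Y" using assms unfolding fibre_def by auto
  have "m x y z \<in> D \<longleftrightarrow> b \<in> D" if D: "D \<in> C'" for D
  proof -
    have "x \<in> D \<longleftrightarrow> b \<in> D" "y \<in> D \<longleftrightarrow> b \<in> D" "z \<in> D \<longleftrightarrow> b \<in> D"
      using assms D unfolding fibre_def agree_def by auto
    then show ?thesis using HH_majority[OF subsetD[OF assms(1) D], of x y z] Y[THEN Y_V] by blast
  qed
  then show ?thesis using Y_median[OF Y] unfolding fibre_def agree_def by blast
qed

lemma median_algebra_fibre:
  assumes "C' \<subseteq> HH" "b \<in> Y"
  shows "median_algebra (alg (fibre C' b))"
  using fibre_median[OF assms] Y_V by (intro median_algebra_alg) (auto simp: fibre_def)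

text \<open>Sides for \<open>C\<close> and for \<open>C'\<close> can be prescribed independently by
  points of \<open>Y\<close> and together determine the point. Thus \<open>Y\<close> splits in two,
  and invariance of \<open>C\<close> lets \<open>G\<close> act on the part seen by
  \<open>C\<close>.\<close>

definition complementary :: "'x set set \<Rightarrow> 'x set set \<Rightarrow> bool" where
  "complementary C C' \<longleftrightarrow> C \<subseteq> HH \<and> C' \<subseteq> HH \<and> (\<forall>g\<in>carrier G. \<forall>D\<in>C. pull g D \<in> C) \<and>
     (\<forall>x\<in>Y. \<forall>y\<in>Y. \<exists>w\<in>Y. agree C w x \<and> agree C' w y) \<and>
     (\<forall>x\<in>Y. \<forall>y\<in>Y. agree C x y \<longrightarrow> agree C' x y \<longrightarrow> x = y)"

definition proj :: "'x set set \<Rightarrow> 'x set set \<Rightarrow> 'x \<Rightarrow> 'x \<Rightarrow> 'x" where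
  "proj C C' b x = (SOME w. w \<in> Y \<and> agree C w x \<and> agree C' w b)"

text \<open>An element of \<open>G\<close> may move the fibre through \<open>b\<close> to another
  one, so the image is projected back. The restriction makes the map extensional, as
  \<open>Bij\<close> demands.\<close>

definition factor_act :: "'x set set \<Rightarrow> 'x set set \<Rightarrow> 'x \<Rightarrow> 'a \<Rightarrow> 'x \<Rightarrow> 'x" where
  "factor_act C C' b g = (\<lambda>x\<in>fibre C' b. proj C C' b (\<phi> g x))"

lemma agree_refl: "agree C x x"
  unfolding agree_def by simp

lemma agree_sym: "agree C x y \<Longrightarrow> agree C y x"
  unfolding agree_def by simp

lemma agree_trans: "agree C x y \<Longrightarrow> agree C y z \<Longrightarrow> agree C x z"
  unfolding agree_def by simp

lemma agree_Un: "agree (C \<union> C') x y \<longleftrightarrow> agree C x y \<and> agree C' x y"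
  unfolding agree_def by blast

lemma proj_props:
  assumes "complementary C C'" "b \<in> Y" "x \<in> Y"
  shows "proj C C' b x \<in> fibre C' b" "agree C (proj C C' b x) x"
proof -
  have "\<exists>w. w \<in> Y \<and> agree C w x \<and> agree C' w b" using assms unfolding complementary_def by blast
  from someI_ex[OF this] show "proj C C' b x \<in> fibre C' b" "agree C (proj C C' b x) x"
    unfolding proj_def fibre_def by blast+
qed

lemma fibre_eqI:
  assumes "complementary C C'" "x \<in> fibre C' b" "y \<in> fibre C' b" "agree C x y"
  shows "x = y"
proof -
  have "x \<in> Y" "y \<in> Y" "agree C' x y" using assms agree_sym agree_trans unfolding fibre_def by blast+
  then show ?thesis using assms unfolding complementary_def by blast
qed

lemma proj_eqI:
  assumes "complementary C C'" "b \<in> Y" "x \<in> Y" "y \<in> fibre C' b" "agree C x y"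
  shows "proj C C' b x = y"
  using fibre_eqI[OF assms(1) proj_props(1)[OF assms(1-3)] assms(4)] proj_props(2)[OF assms(1-3)] assms(5)
    agree_trans by blast

lemma agree_act:
  assumes "complementary C C'" "g \<in> carrier G" "x \<in> Y" "y \<in> Y" "agree C x y"
  shows "agree C (\<phi> g x) (\<phi> g y)"
  unfolding agree_def
proof
  fix D assume "D \<in> C"
  then have "pull g D \<in> C" using assms unfolding complementary_def by blast
  then have "x \<in> pull g D \<longleftrightarrow> y \<in> pull g D" using assms unfolding agree_def by blast
  then show "\<phi> g x \<in> D \<longleftrightarrow> \<phi> g y \<in> D" using Y_V assms by simp
qed

lemma proj_median:
  assumes c: "complementary C C'" and b: "b \<in> Y" and xyz: "x \<in> Y" "y \<in> Y" "z \<in> Y"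
  shows "proj C C' b (m x y z) = m (proj C C' b x) (proj C C' b y) (proj C C' b z)"
proof (rule proj_eqI[OF c b Y_median[OF xyz]])
  have CH: "C \<subseteq> HH" "C' \<subseteq> HH" using c unfolding complementary_def by auto
  note p = proj_props[OF c b xyz(1)] proj_props[OF c b xyz(2)] proj_props[OF c b xyz(3)]
  show "m (proj C C' b x) (proj C C' b y) (proj C C' b z) \<in> fibre C' b"
    using fibre_median[OF CH(2) b] p by blast
  have V: "proj C C' b x \<in> V" "proj C C' b y \<in> V" "proj C C' b z \<in> V"
    using p Y_V unfolding fibre_def by blast+
  show "agree C (m x y z) (m (proj C C' b x) (proj C C' b y) (proj C C' b z))"
    unfolding agree_def
  proof
    fix D assume D: "D \<in> C"
    have "proj C C' b x \<in> D \<longleftrightarrow> x \<in> D" "proj C C' b y \<in> D \<longleftrightarrow> y \<in> D" "proj C C' b z \<in> D \<longleftrightarrow> z \<in> D"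
      using p D unfolding agree_def by blast+
    then show "m x y z \<in> D \<longleftrightarrow> m (proj C C' b x) (proj C C' b y) (proj C C' b z) \<in> D"
      using HH_majority[OF subsetD[OF CH(1) D]] V xyz[THEN Y_V] by simp
  qed
qed

lemma factor_act_proj:
  assumes c: "complementary C C'" and b: "b \<in> Y" and g: "g \<in> carrier G" and x: "x \<in> Y"
  shows "factor_act C C' b g (proj C C' b x) = proj C C' b (\<phi> g x)"
proof -
  note p = proj_props[OF c b x]
  have pY: "proj C C' b x \<in> Y" using p(1) unfolding fibre_def by blast
  have "agree C (\<phi> g (proj C C' b x)) (\<phi> g x)" by (rule agree_act[OF c g pY x p(2)])
  then have "proj C C' b (\<phi> g (proj C C' b x)) = proj C C' b (\<phi> g x)"
    using proj_props[OF c b Y_act[OF g x]] agree_trans agree_sym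
    by (intro proj_eqI[OF c b Y_act[OF g pY]]) blast+
  then show ?thesis using p(1) unfolding factor_act_def by simp
qed

lemma proj_fibre: "complementary C C' \<Longrightarrow> b \<in> Y \<Longrightarrow> x \<in> fibre C' b \<Longrightarrow> proj C C' b x = x"
  by (rule proj_eqI) (auto simp: fibre_def agree_refl)

lemma med_action_factor:
  assumes c: "complementary C C'" and b: "b \<in> Y"
  shows "med_action G (alg (fibre C' b)) (factor_act C C' b)"
proof -
  let ?K = "fibre C' b" and ?f = "factor_act C C' b"
  have KY: "x \<in> Y" if "x \<in> ?K" for x using that unfolding fibre_def by blast
  have ext: "?f g \<in> extensional ?K" for g unfolding factor_act_def by simp
  have val: "?f g x = proj C C' b (\<phi> g x)" if "x \<in> ?K" for g x using that unfolding factor_act_def by simp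
  have cl: "?f g x \<in> ?K" if "g \<in> carrier G" "x \<in> ?K" for g x
    using val proj_props(1)[OF c b Y_act] KY that by simp
  have mult: "?f (g \<otimes> h) x = ?f g (?f h x)" if g: "g \<in> carrier G" and h: "h \<in> carrier G" and x: "x \<in> ?K" for g h x
    using factor_act_proj[OF c b g Y_act[OF h KY[OF x]]] val[OF x] act_mult[OF g h Y_V[OF KY[OF x]]] by simp
  have one: "?f \<one> x = x" if x: "x \<in> ?K" for x
    using val[OF x] act_one[OF Y_V[OF KY[OF x]]] proj_fibre[OF c b x] by simp
  have bij: "bij_betw (?f g) ?K ?K" if g: "g \<in> carrier G" for g
  proof (rule bij_betw_byWitness[where f' = "?f (inv g)"])
    show "\<forall>x\<in>?K. ?f (inv g) (?f g x) = x" "\<forall>x\<in>?K. ?f g (?f (inv g) x) = x"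
      using mult[of "inv g" g] mult[of g "inv g"] one g by simp_all
    show "?f g ` ?K \<subseteq> ?K" "?f (inv g) ` ?K \<subseteq> ?K" using cl g by auto
  qed
  have B: "?f g \<in> Bij ?K" if "g \<in> carrier G" for g using bij[OF that] ext unfolding Bij_def by simp
  have "?f (g \<otimes> h) = compose ?K (?f g) (?f h)" if "g \<in> carrier G" "h \<in> carrier G" for g h
    using ext mult[OF that] by (intro extensionalityI[of _ ?K]) (auto simp: compose_def)
  then have "?f \<in> hom G (BijGroup ?K)"
    using B by (intro homI) (auto simp: BijGroup_def)
  then have "group_action G ?K ?f"
    unfolding group_action_def group_hom_def group_hom_axioms_def
    using G_group group_BijGroup by blast
  moreover have "?f g \<in> med_iso (alg ?K) (alg ?K)" if g: "g \<in> carrier G" for g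
  proof -
    have "?f g (m x y z) = m (?f g x) (?f g y) (?f g z)" if xyz: "x \<in> ?K" "y \<in> ?K" "z \<in> ?K" for x y z
    proof -
      have "m x y z \<in> ?K" using fibre_median[of C' b] c b xyz unfolding complementary_def by blast
      then show ?thesis
        using val xyz act_median[OF g] KY Y_V proj_median[OF c b] Y_act[OF g] by simp
    qed
    then show ?thesis using bij[OF g] unfolding med_iso_def by simp
  qed
  ultimately show ?thesis unfolding med_action_def by simp
qed

lemma F_walls_HH: "F_walls \<subseteq> HH" and T_walls_HH: "T_walls \<subseteq> HH" and Q_walls_HH': "Q_walls \<subseteq> HH"
  using A_skewered_HH A_periodic_HH Q_walls_HH unfolding F_walls_def T_walls_def by blast+

lemma complementaryI:
  assumes "C \<subseteq> HH" "C' \<subseteq> HH" "\<And>g D. g \<in> carrier G \<Longrightarrow> D \<in> C \<Longrightarrow> pull g D \<in> C"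
    and "\<And>x y. x \<in> Y \<Longrightarrow> y \<in> Y \<Longrightarrow> \<exists>w\<in>Y. agree C w x \<and> agree C' w y"
    and "\<And>x y. x \<in> Y \<Longrightarrow> y \<in> Y \<Longrightarrow> agree C x y \<Longrightarrow> agree C' x y \<Longrightarrow> x = y"
  shows "complementary C C'"
  unfolding complementary_def using assms by simp

lemma complementary_factors:
  "complementary T_walls (F_walls \<union> Q_walls)" "complementary F_walls (T_walls \<union> Q_walls)" "complementary Q_walls (T_walls \<union> F_walls)"
proof -
  show "complementary T_walls (F_walls \<union> Q_walls)"
  proof (rule complementaryI)
    show "T_walls \<subseteq> HH" "F_walls \<union> Q_walls \<subseteq> HH" using F_walls_HH T_walls_HH Q_walls_HH' by simp_all
    show "pull g D \<in> T_walls" if "g \<in> carrier G" "D \<in> T_walls" for g D using T_walls_pull[OF that] .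
    show "\<exists>w\<in>Y. agree T_walls w x \<and> agree (F_walls \<union> Q_walls) w y" if "x \<in> Y" "y \<in> Y" for x y
      using Y_product[OF that(1,2,2)] unfolding agree_Un by blast
    show "x = y" if "x \<in> Y" "y \<in> Y" "agree T_walls x y" "agree (F_walls \<union> Q_walls) x y" for x y
      using that unfolding agree_Un by (intro Y_eqI) simp_all
  qed
  show "complementary F_walls (T_walls \<union> Q_walls)"
  proof (rule complementaryI)
    show "F_walls \<subseteq> HH" "T_walls \<union> Q_walls \<subseteq> HH" using F_walls_HH T_walls_HH Q_walls_HH' by simp_all
    show "pull g D \<in> F_walls" if "g \<in> carrier G" "D \<in> F_walls" for g D using F_walls_pull[OF that] .
    show "\<exists>w\<in>Y. agree F_walls w x \<and> agree (T_walls \<union> Q_walls) w y" if "x \<in> Y" "y \<in> Y" for x y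
      using Y_product[OF that(2,1,2)] unfolding agree_Un by blast
    show "x = y" if "x \<in> Y" "y \<in> Y" "agree F_walls x y" "agree (T_walls \<union> Q_walls) x y" for x y
      using that unfolding agree_Un by (intro Y_eqI) simp_all
  qed
  show "complementary Q_walls (T_walls \<union> F_walls)"
  proof (rule complementaryI)
    show "Q_walls \<subseteq> HH" "T_walls \<union> F_walls \<subseteq> HH" using F_walls_HH T_walls_HH Q_walls_HH' by simp_all
    show "pull g D \<in> Q_walls" if "g \<in> carrier G" "D \<in> Q_walls" for g D using Q_walls_pull[OF that] .
    show "\<exists>w\<in>Y. agree Q_walls w x \<and> agree (T_walls \<union> F_walls) w y" if "x \<in> Y" "y \<in> Y" for x y
      using Y_product[OF that(2,2,1)] unfolding agree_Un by blast
    show "x = y" if "x \<in> Y" "y \<in> Y" "agree Q_walls x y" "agree (T_walls \<union> F_walls) x y" for x y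
      using that unfolding agree_Un by (intro Y_eqI) simp_all
  qed
qed

subsection \<open>The cube factor\<close>

text \<open>Convexity in terms of medians with two arguments in \<open>E\<close>, in any positions,
  which avoids appeals to the symmetry of \<open>m\<close>.\<close>

definition Y_convex :: "'x set \<Rightarrow> bool" where
  "Y_convex E \<longleftrightarrow> E \<subseteq> Y \<and> (\<forall>x\<in>Y. \<forall>y\<in>Y. \<forall>z\<in>Y. x \<in> E \<and> y \<in> E \<or> y \<in> E \<and> z \<in> E \<or> x \<in> E \<and> z \<in> E \<longrightarrow> m x y z \<in> E)"

lemma Y_convexD:
  "Y_convex E \<Longrightarrow> x \<in> Y \<Longrightarrow> y \<in> Y \<Longrightarrow> z \<in> Y \<Longrightarrow> x \<in> E \<and> y \<in> E \<or> y \<in> E \<and> z \<in> E \<or> x \<in> E \<and> z \<in> E \<Longrightarrow> m x y z \<in> E"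
  unfolding Y_convex_def by blast

lemma Y_convexI:
  "E \<subseteq> Y \<Longrightarrow> (\<And>x y z. \<lbrakk>x \<in> Y; y \<in> Y; z \<in> Y; x \<in> E \<and> y \<in> E \<or> y \<in> E \<and> z \<in> E \<or> x \<in> E \<and> z \<in> E\<rbrakk> \<Longrightarrow> m x y z \<in> E)
    \<Longrightarrow> Y_convex E"
  unfolding Y_convex_def by simp

lemma Y_convex_Int:
  assumes "Y_convex E" "Y_convex C"
  shows "Y_convex (E \<inter> C)"
proof (rule Y_convexI)
  show "E \<inter> C \<subseteq> Y" using assms unfolding Y_convex_def by blast
  fix x y z assume Y: "x \<in> Y" "y \<in> Y" "z \<in> Y"
    and "x \<in> E \<inter> C \<and> y \<in> E \<inter> C \<or> y \<in> E \<inter> C \<and> z \<in> E \<inter> C \<or> x \<in> E \<inter> C \<and> z \<in> E \<inter> C"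
  then show "m x y z \<in> E \<inter> C" using Y_convexD[OF assms(1) Y] Y_convexD[OF assms(2) Y] by blast
qed

text \<open>The other members are replaced by their traces on one member \<open>C\<close>. Two
  traces still meet: the median of one point from each of the three pairwise intersections lies in
  all three sets.\<close>

lemma Helly:
  assumes "finite F"
    and "\<And>E. E \<in> F \<Longrightarrow> Y_convex E"
    and "\<And>E E'. E \<in> F \<Longrightarrow> E' \<in> F \<Longrightarrow> E \<inter> E' \<noteq> {}"
  shows "\<exists>w\<in>Y. \<forall>E\<in>F. w \<in> E"
  using assms
proof (induction "card F" arbitrary: F rule: less_induct)
  case less
  show ?case
  proof (cases "F = {}")
    case True
    then show ?thesis using Y_nonempty by blast
  next
    case False
    then obtain C where C: "C \<in> F" by blast
    let ?F = "(\<lambda>E. E \<inter> C) ` (F - {C})"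
    have "card ?F \<le> card (F - {C})" using less(2) by (intro card_image_le) simp
    also have "\<dots> < card F" using C less(2) by (intro psubset_card_mono) auto
    finally have lt: "card ?F < card F" .
    have "\<exists>w\<in>Y. \<forall>E\<in>?F. w \<in> E"
    proof (rule less(1)[OF lt])
      show "finite ?F" using less(2) by simp
      fix E assume "E \<in> ?F"
      then obtain E0 where E0: "E0 \<in> F" "E = E0 \<inter> C" by blast
      show "Y_convex E"
        using less(3)[OF E0(1)] less(3)[OF C] unfolding E0(2) by (rule Y_convex_Int)
    next
      fix E E' assume "E \<in> ?F" "E' \<in> ?F"
      then obtain E0 E1 where E0: "E0 \<in> F" "E = E0 \<inter> C" and E1: "E1 \<in> F" "E' = E1 \<inter> C" by blast
      obtain x y z where xyz: "x \<in> E0 \<inter> C" "y \<in> E1 \<inter> C" "z \<in> E0 \<inter> E1"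
        using less(4)[OF E0(1) C] less(4)[OF E1(1) C] less(4)[OF E0(1) E1(1)] by blast
      have "E0 \<subseteq> Y" "E1 \<subseteq> Y" using less(3)[OF E0(1)] less(3)[OF E1(1)] unfolding Y_convex_def by simp_all
      then have Y: "x \<in> Y" "y \<in> Y" "z \<in> Y" using xyz by blast+
      have "m x y z \<in> E0" "m x y z \<in> E1" "m x y z \<in> C"
        using Y_convexD[OF less(3)[OF E0(1)] Y] Y_convexD[OF less(3)[OF E1(1)] Y] Y_convexD[OF less(3)[OF C] Y]
          xyz by simp_all
      then show "E \<inter> E' \<noteq> {}" unfolding E0(2) E1(2) by blast
    qed
    then obtain w where w: "w \<in> Y" "\<forall>E\<in>?F. w \<in> E" by blast
    show ?thesis
    \<comment> \<open>If \<open>C\<close> is the only member, there are no traces and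
      \<open>w\<close> need not lie in \<open>C\<close>.\<close>
    proof (cases "F = {C}")
      case True
      then obtain v where "v \<in> C" using less(4)[OF C C] by blast
      then show ?thesis using True less(3)[OF C] unfolding Y_convex_def by blast
    next
      case False
      then obtain E where "E \<in> F - {C}" using C by blast
      then have "w \<in> C" using w(2) by blast
      then show ?thesis using w by blast
    qed
  qed
qed

lemma Y_halfspace_convex:
  assumes D: "D \<in> HH"
  shows "Y_convex (D \<inter> Y)"
proof (rule Y_convexI)
  fix x y z assume Y: "x \<in> Y" "y \<in> Y" "z \<in> Y"
    and "x \<in> D \<inter> Y \<and> y \<in> D \<inter> Y \<or> y \<in> D \<inter> Y \<and> z \<in> D \<inter> Y \<or> x \<in> D \<inter> Y \<and> z \<in> D \<inter> Y"
  then show "m x y z \<in> D \<inter> Y"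
    using HH_majority[OF D Y_V[OF Y(1)] Y_V[OF Y(2)] Y_V[OF Y(3)]] Y_median[OF Y] by blast
qed blast

text \<open>Orbit points up to their sides for \<open>Q_walls\<close>. There are finitely many
  patterns even if the orbit is infinite, so they can be counted.\<close>

definition patterns :: "'x \<Rightarrow> 'x set set set" where
  "patterns y = (\<lambda>a. {D \<in> Q_walls. \<phi> a y \<in> D}) ` A"

definition weight :: "'x \<Rightarrow> 'x set \<Rightarrow> nat" where
  "weight y D = card {p \<in> patterns y. D \<in> p}"

lemma finite_patterns: "finite (patterns y)"
  by (rule finite_subset[of _ "Pow Q_walls"]) (auto simp: patterns_def finite_Q_walls)

text \<open>Translation by \<open>a\<close> takes the pattern of \<open>\<phi> b y\<close> to that
  of \<open>\<phi> (a \<otimes> b) y\<close>, injectively.\<close>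

lemma weight_pull_le:
  assumes y: "y \<in> Y" and a: "a \<in> A" and D: "D \<in> Q_walls"
  shows "weight y (pull a D) \<le> weight y D"
  unfolding weight_def
proof (rule card_inj_on_le)
  let ?h = "\<lambda>p. {E \<in> Q_walls. pull a E \<in> p}"
  have sub: "p \<subseteq> Q_walls" if "p \<in> patterns y" for p using that unfolding patterns_def by blast
  have rec: "p = pull a ` ?h p" if "p \<in> patterns y" for p
  proof
    show "p \<subseteq> pull a ` ?h p"
    proof
      fix E assume E: "E \<in> p"
      then have EQ: "E \<in> Q_walls" using sub that by blast
      then have "pull a (pull (inv a) E) = E" "pull (inv a) E \<in> Q_walls"
        using pull_inv(1)[of a E] Q_walls_HH Q_walls_pull a by simp_all
      then show "E \<in> pull a ` ?h p" using E by (intro rev_image_eqI[of "pull (inv a) E"]) auto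
    qed
  qed blast
  show "inj_on ?h {p \<in> patterns y. pull a D \<in> p}"
  proof (rule inj_onI)
    fix p q assume "p \<in> {p \<in> patterns y. pull a D \<in> p}" "q \<in> {p \<in> patterns y. pull a D \<in> p}" "?h p = ?h q"
    then show "p = q" using rec[of p] rec[of q] by simp
  qed
  show "?h ` {p \<in> patterns y. pull a D \<in> p} \<subseteq> {p \<in> patterns y. D \<in> p}"
  proof
    fix q assume "q \<in> ?h ` {p \<in> patterns y. pull a D \<in> p}"
    then obtain p where p: "p \<in> patterns y" "pull a D \<in> p" "q = ?h p" by blast
    obtain b where b: "b \<in> A" "p = {D \<in> Q_walls. \<phi> b y \<in> D}" using p(1) unfolding patterns_def by blast
    have "pull a E \<in> p \<longleftrightarrow> \<phi> (a \<otimes> b) y \<in> E" if "E \<in> Q_walls" for E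
      using that b Q_walls_pull[of a E] a act_mult[of a b y] Y_V[OF y] by simp
    then have "q = {D \<in> Q_walls. \<phi> (a \<otimes> b) y \<in> D}" unfolding p(3) by blast
    then have "q \<in> patterns y" unfolding patterns_def
      using A_closed(3)[OF a b(1)] by (rule image_eqI)
    moreover have "D \<in> q" using p D by simp
    ultimately show "q \<in> {p \<in> patterns y. D \<in> p}" by simp
  qed
  show "finite {p \<in> patterns y. D \<in> p}" using finite_patterns by simp
qed

lemma weight_pull:
  assumes "y \<in> Y" "a \<in> A" "D \<in> Q_walls"
  shows "weight y (pull a D) = weight y D"
proof (rule le_antisym)
  show "weight y (pull a D) \<le> weight y D" by (rule weight_pull_le[OF assms])
  show "weight y D \<le> weight y (pull a D)"
    using weight_pull_le[of y "inv a" "pull a D"] pull_inv(2)[of a D] Q_walls_HH Q_walls_pull assms by simp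
qed

text \<open>
  A halfspace containing more than half of the orbit patterns would, with its translates and all
  other such halfspaces, contain a whole orbit by Helly's theorem.
\<close>

lemma weight_le_half:
  assumes y: "y \<in> Y" and D: "D \<in> Q_walls"
  shows "2 * weight y D \<le> card (patterns y)"
proof (rule ccontr)
  assume D0: "\<not> 2 * weight y D \<le> card (patterns y)"
  let ?M = "{D \<in> Q_walls. 2 * weight y D > card (patterns y)}"
  have "\<exists>w\<in>Y. \<forall>E\<in>(\<lambda>D. D \<inter> Y) ` ?M. w \<in> E"
  proof (rule Helly)
    show "finite ((\<lambda>D. D \<inter> Y) ` ?M)" using finite_Q_walls by simp
    show "Y_convex E"
      if "E \<in> (\<lambda>D. D \<inter> Y) ` ?M" for E
      using that Y_halfspace_convex Q_walls_HH by (elim imageE) simp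
    fix E E' assume "E \<in> (\<lambda>D. D \<inter> Y) ` ?M" "E' \<in> (\<lambda>D. D \<inter> Y) ` ?M"
    then obtain D D' where D: "D \<in> ?M" "E = D \<inter> Y" and D': "D' \<in> ?M" "E' = D' \<inter> Y" by blast
    let ?P = "{p \<in> patterns y. D \<in> p}" and ?P' = "{p \<in> patterns y. D' \<in> p}"
    \<comment> \<open>Two majorities of the patterns have a pattern in common, hence the two
      halfspaces share an orbit point.\<close>
    have "?P \<inter> ?P' \<noteq> {}"
    proof
      assume "?P \<inter> ?P' = {}"
      then have "card (?P \<union> ?P') = card ?P + card ?P'" using finite_patterns by (intro card_Un_disjoint) simp_all
      moreover have "card (?P \<union> ?P') \<le> card (patterns y)" using finite_patterns by (intro card_mono) auto
      ultimately show False using D(1) D'(1) unfolding weight_def by simp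
    qed
    then obtain a where "a \<in> A" "\<phi> a y \<in> D" "\<phi> a y \<in> D'" unfolding patterns_def by blast
    then show "E \<inter> E' \<noteq> {}" using Y_act[OF _ y, of a] D(2) D'(2) by auto
  qed
  then obtain w where w: "w \<in> Y" "\<forall>E\<in>(\<lambda>D. D \<inter> Y) ` ?M. w \<in> E" ..
  have "\<phi> a w \<in> D" if a: "a \<in> A" for a
  proof -
    have "pull a D \<in> ?M" using Q_walls_pull[of a D] weight_pull[OF y a D] D0 D a by simp
    then have "w \<in> pull a D \<inter> Y" by (rule w(2)[rule_format, OF imageI])
    then show ?thesis using Y_V[OF w(1)] by simp
  qed
  then show False using Q_walls_split[OF w(1) D] by blast
qed

text \<open>The weights of \<open>D\<close> and of its complement add up to the number of patterns,
  and neither exceeds half of it.\<close>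

lemma weight_half:
  assumes y: "y \<in> Y" and D: "D \<in> Q_walls"
  shows "2 * weight y D = card (patterns y)"
proof -
  have DV: "p \<in> patterns y \<Longrightarrow> V - D \<in> p \<longleftrightarrow> D \<notin> p" for p
    using D Q_walls_compl[OF D] Y_V[OF Y_act[OF _ y]] unfolding patterns_def by auto
  have "{p \<in> patterns y. D \<in> p} \<union> {p \<in> patterns y. V - D \<in> p} = patterns y"
    "{p \<in> patterns y. D \<in> p} \<inter> {p \<in> patterns y. V - D \<in> p} = {}" using DV by blast+
  then have "weight y D + weight y (V - D) = card (patterns y)"
    unfolding weight_def using finite_patterns[of y]
    by (metis (no_types, lifting) card_Un_disjoint finite_Un)
  then show ?thesis using weight_le_half[OF y D] weight_le_half[OF y Q_walls_compl[OF D]] by linarith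
qed

text \<open>The patterns containing \<open>D\<close> are among those containing \<open>D'\<close>
  and equally many, so they are the same; the pattern of \<open>y\<close> itself then carries
  membership over. It follows that different walls of this class are transverse on
  \<open>Y\<close>.\<close>

lemma Q_walls_nested_eq:
  assumes D: "D \<in> Q_walls" "D' \<in> Q_walls" and sub: "D \<inter> Y \<subseteq> D'"
  shows "D \<inter> Y = D' \<inter> Y"
proof
  show "D' \<inter> Y \<subseteq> D \<inter> Y"
  proof
    fix y assume y: "y \<in> D' \<inter> Y"
    then have yY: "y \<in> Y" by blast
    let ?P = "{p \<in> patterns y. D \<in> p}" and ?P' = "{p \<in> patterns y. D' \<in> p}"
    have "?P \<subseteq> ?P'" using D sub Y_act[OF _ yY] unfolding patterns_def by auto
    moreover have "weight y D = weight y D'" using weight_half[OF yY D(1)] weight_half[OF yY D(2)] by simp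
    then have "card ?P = card ?P'" unfolding weight_def .
    ultimately have eq: "?P = ?P'" using finite_patterns by (intro card_subset_eq) simp_all
    have "{D \<in> Q_walls. \<phi> \<one> y \<in> D} \<in> patterns y" unfolding patterns_def by (rule imageI) simp
    moreover have "\<phi> \<one> y \<in> D'" using y Y_V[OF yY] by simp
    ultimately have "{D \<in> Q_walls. \<phi> \<one> y \<in> D} \<in> ?P'" using D(2) by simp
    then have "\<phi> \<one> y \<in> D" unfolding eq[symmetric] by blast
    then show "y \<in> D \<inter> Y" using yY Y_V by simp
  qed
qed (use sub in blast)

lemma cube_factor:
  assumes b: "b \<in> Y"
  shows "finite_dim_cube (alg (fibre (T_walls \<union> F_walls) b))"
proof -
  let ?K = "fibre (T_walls \<union> F_walls) b"
  \<comment> \<open>One side of each wall, chosen so as to avoid \<open>b\<close>. Traces are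
    counted because distinct members of \<open>Q_walls\<close> may cut \<open>Y\<close>
    alike.\<close>
  define B where "B = (\<lambda>D. D \<inter> Y) ` {D \<in> Q_walls. b \<notin> D}"
  define k where "k = card B"
  note c = complementary_factors(3)
  have "finite B" using finite_Q_walls unfolding B_def by simp
  then obtain e where e: "bij_betw e {0..<k} B" using ex_bij_betw_nat_finite unfolding k_def by blast
  have eQ: "\<exists>D. D \<in> Q_walls \<and> b \<notin> D \<and> e i = D \<inter> Y" if "i < k" for i
  proof -
    have "e i \<in> B" using bij_betwE[OF e] that by simp
    then show ?thesis unfolding B_def by blast
  qed
  have eR: "\<exists>i<k. e i = D \<inter> Y" if "D \<in> Q_walls" "b \<notin> D" for D
  proof -
    have "D \<inter> Y \<in> e ` {0..<k}" unfolding bij_betw_imp_surj_on[OF e] B_def using that by blast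
    then show ?thesis by auto
  qed
  have e_inj: "i = j" if "i < k" "j < k" "e i = e j" for i j
    using inj_onD[OF bij_betw_imp_inj_on[OF e] that(3)] that by simp
  define f where "f y = {i. i < k \<and> y \<in> e i}" for y
  have inj: "inj_on f ?K"
  proof (rule inj_onI)
    fix x y assume x: "x \<in> ?K" and y: "y \<in> ?K" and fxy: "f x = f y"
    have xyY: "x \<in> Y" "y \<in> Y" using x y unfolding fibre_def by auto
    have one: "x \<in> D \<longleftrightarrow> y \<in> D" if D: "D \<in> Q_walls" "b \<notin> D" for D
    proof -
      obtain i where i: "i < k" "e i = D \<inter> Y" using eR[OF D] by blast
      have "i \<in> f x \<longleftrightarrow> i \<in> f y" using fxy by simp
      then show ?thesis using i xyY unfolding f_def by simp
    qed
    have "agree Q_walls x y" unfolding agree_def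
    proof
      fix D assume D: "D \<in> Q_walls"
      show "x \<in> D \<longleftrightarrow> y \<in> D"
      proof (cases "b \<in> D")
        case True
        then have "x \<in> V - D \<longleftrightarrow> y \<in> V - D" using one[OF Q_walls_compl[OF D]] by blast
        then show ?thesis using xyY[THEN Y_V] by blast
      qed (use one D in blast)
    qed
    then show "x = y" using fibre_eqI[OF c x y] by blast
  qed
  have surj: "\<exists>y\<in>?K. f y = \<Sigma>" if \<Sigma>: "\<Sigma> \<subseteq> {..<k}" for \<Sigma>
  proof -
    let ?E = "\<lambda>i. if i \<in> \<Sigma> then e i else Y - e i"
    have "\<exists>w\<in>Y. \<forall>E\<in>?E ` {..<k}. w \<in> E"
    proof (rule Helly)
      show "finite (?E ` {..<k})" by simp
      show "Y_convex E" if E: "E \<in> ?E ` {..<k}" for E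
      proof -
        obtain i where i: "i < k" "E = ?E i" using E by auto
        obtain D where D: "D \<in> Q_walls" "e i = D \<inter> Y" using eQ[OF i(1)] by blast
        have "Y - e i = (V - D) \<inter> Y" using D(2) Y_V by blast
        then have "E = D \<inter> Y \<or> E = (V - D) \<inter> Y" using i(2) D(2) by auto
        then show ?thesis using Y_halfspace_convex[OF Q_walls_HH[OF D(1)]] Y_halfspace_convex[OF Q_walls_HH[OF Q_walls_compl[OF D(1)]]] by (elim disjE) simp_all
      qed
      fix E E' assume "E \<in> ?E ` {..<k}" "E' \<in> ?E ` {..<k}"
      then obtain i j where i: "i < k" "E = ?E i" and j: "j < k" "E' = ?E j" by (elim imageE) simp
      obtain D where D: "D \<in> Q_walls" "b \<notin> D" "e i = D \<inter> Y" using eQ[OF i(1)] by blast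
      obtain D' where D': "D' \<in> Q_walls" "b \<notin> D'" "e j = D' \<inter> Y" using eQ[OF j(1)] by blast
      have ij: "i = j" if "e i = e j" using e_inj[OF i(1) j(1) that] .
      have mixed: "D1 \<inter> Y \<inter> (Y - D2) \<noteq> {}" if "D1 \<in> Q_walls" "D2 \<in> Q_walls" "D1 \<inter> Y \<noteq> D2 \<inter> Y" for D1 D2
        using Q_walls_nested_eq[OF that(1,2)] that(3) by blast
      consider "i \<in> \<Sigma>" "j \<in> \<Sigma>" | "i \<in> \<Sigma>" "j \<notin> \<Sigma>" | "i \<notin> \<Sigma>" "j \<in> \<Sigma>" | "i \<notin> \<Sigma>" "j \<notin> \<Sigma>" by blast
      then show "E \<inter> E' \<noteq> {}"
      proof cases
        case 1
        \<comment> \<open>Both halfspaces avoid \<open>b\<close>, so \<open>D\<close> and the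
          complement of \<open>D'\<close> have different traces; by \<open>Q_walls_nested_eq\<close>
          the first is not contained in the second.\<close>
        have "D \<inter> Y \<noteq> (V - D') \<inter> Y" using D(2) D'(2) b Y_V[OF b] by blast
        then have "D \<inter> Y \<inter> (Y - (V - D')) \<noteq> {}" by (rule mixed[OF D(1) Q_walls_compl[OF D'(1)]])
        then show ?thesis using 1 i(2) j(2) D(3) D'(3) Y_V by auto
      next
        case 2
        then have "D \<inter> Y \<noteq> D' \<inter> Y" using ij D(3) D'(3) by auto
        then show ?thesis using mixed[OF D(1) D'(1)] 2 i(2) j(2) D(3) D'(3) by auto
      next
        case 3
        then have "D' \<inter> Y \<noteq> D \<inter> Y" using ij D(3) D'(3) by auto
        then show ?thesis using mixed[OF D'(1) D(1)] 3 i(2) j(2) D(3) D'(3) by auto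
      next
        case 4
        then have "b \<in> E" "b \<in> E'" using i(2) j(2) D D' b by auto
        then show ?thesis by blast
      qed
    qed
    then obtain w where w: "w \<in> Y" "\<forall>E\<in>?E ` {..<k}. w \<in> E" ..
    have "w \<in> e i \<longleftrightarrow> i \<in> \<Sigma>" if "i < k" for i
    proof -
      have "w \<in> ?E i" by (rule w(2)[rule_format], rule imageI) (use that in simp)
      then show ?thesis by (simp split: if_splits)
    qed
    then have fw: "f w = \<Sigma>" using \<Sigma> unfolding f_def by auto
    \<comment> \<open>Helly's theorem only gives a point of \<open>Y\<close>; projecting it to the
      fibre keeps its sides for \<open>Q_walls\<close>.\<close>
    let ?p = "proj Q_walls (T_walls \<union> F_walls) b w"
    note p = proj_props[OF c b w(1)]
    have pY: "?p \<in> Y" using p(1) unfolding fibre_def by simp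
    have "?p \<in> e i \<longleftrightarrow> w \<in> e i" if i: "i < k" for i
    proof -
      obtain D where D: "D \<in> Q_walls" "e i = D \<inter> Y" using eQ[OF i] by blast
      then have "?p \<in> D \<longleftrightarrow> w \<in> D" using p(2) unfolding agree_def by simp
      then show ?thesis using pY w(1) unfolding D(2) by simp
    qed
    then have "f ?p = f w" unfolding f_def by auto
    then show ?thesis using p(1) fw by (intro bexI[of _ ?p]) simp_all
  qed
  have "f ` ?K \<subseteq> Pow {..<k}" unfolding f_def by auto
  then have "bij_betw f ?K (Pow {..<k})"
  proof (intro bij_betw_imageI subset_antisym inj)
    show "Pow {..<k} \<subseteq> f ` ?K"
    proof
      fix \<Sigma> assume "\<Sigma> \<in> Pow {..<k}"
      then obtain y where "y \<in> ?K" "f y = \<Sigma>" using surj[of \<Sigma>] by auto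
      then show "\<Sigma> \<in> f ` ?K" by (intro image_eqI) simp_all
    qed
  qed
  moreover have "f (m x y z) = f x \<inter> f y \<union> f y \<inter> f z \<union> f x \<inter> f z" if "x \<in> ?K" "y \<in> ?K" "z \<in> ?K" for x y z
  proof -
    have xyz: "x \<in> Y" "y \<in> Y" "z \<in> Y" using that unfolding fibre_def by auto
    have "m x y z \<in> e i \<longleftrightarrow> x \<in> e i \<and> y \<in> e i \<or> y \<in> e i \<and> z \<in> e i \<or> x \<in> e i \<and> z \<in> e i" if i: "i < k" for i
    proof -
      obtain D where D: "D \<in> Q_walls" "e i = D \<inter> Y" using eQ[OF i] by blast
      show ?thesis
        using HH_majority[OF Q_walls_HH[OF D(1)] Y_V[OF xyz(1)] Y_V[OF xyz(2)] Y_V[OF xyz(3)]] xyz Y_median[OF xyz]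
        unfolding D(2) by simp
    qed
    then show ?thesis unfolding f_def by (auto simp: set_eq_iff)
  qed
  ultimately have "f \<in> med_iso (alg ?K) (cube_alg k)" unfolding med_iso_def cube_alg_def by simp
  then show ?thesis unfolding finite_dim_cube_def by blast
qed


subsection \<open>The flat factor\<close>

text \<open>Such an element translates along the flat: it crosses every wall of \<open>F\<close>,
  never moves a point of \<open>Y\<close> out of a halfspace that it skewers, and preserves the
  fibre because it fixes all \<open>Q_walls\<close>.\<close>

definition axial :: "'a \<Rightarrow> bool" where
  "axial c \<longleftrightarrow> c \<in> A \<and> (\<forall>D. A_skewered D \<longrightarrow> skewered c D \<or> skewered c (V - D)) \<and>
     (\<forall>D y. skewered c D \<longrightarrow> y \<in> Y \<longrightarrow> y \<in> D \<longrightarrow> \<phi> c y \<in> D) \<and> (\<forall>D\<in>Q_walls. pull c D = D)"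

lemma axialD:
  assumes "axial c"
  shows "c \<in> A" "A_skewered D \<Longrightarrow> skewered c D \<or> skewered c (V - D)"
    "skewered c D \<Longrightarrow> y \<in> Y \<Longrightarrow> y \<in> D \<Longrightarrow> \<phi> c y \<in> D" "D \<in> Q_walls \<Longrightarrow> pull c D = D"
  using assms unfolding axial_def by simp_all

lemma exists_axial: "\<exists>c. axial c"
proof -
  obtain a where a: "a \<in> A" "\<And>D. A_skewered D \<Longrightarrow> \<not> periodic a D" using exists_generic by blast
  obtain k where k: "k > 0" "\<forall>D\<in>Q_walls. pull (a [^] (k::int)) D = D"
    using common_period[OF a(1) finite_Q_walls Q_walls_A_periodic] by blast
  \<comment> \<open>The power \<open>k\<close> fixes each member of \<open>Q_walls\<close>, and the
    power \<open>N\<close> turns the condition in \<open>core\<close> into monotonicity.\<close>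
  let ?e = "a [^] k"
  let ?c = "?e [^] N"
  have e: "?e \<in> A" and c: "?c \<in> A" using a(1) by simp_all
  have sk: "skewered ?e D \<or> skewered ?e (V - D)" if "A_skewered D" for D
    using generic_skewered[OF a(1) that a(2)[OF that]] skewered_pow[OF a(1) _ k(1)] by blast
  \<comment> \<open>The condition in \<open>core\<close> speaks of \<open>?e\<close>, so a halfspace
    skewered by \<open>?c\<close> must first be seen to be skewered by \<open>?e\<close> in the same
    direction.\<close>
  have undo: "skewered ?e D" if D: "skewered ?c D" for D
  proof -
    have "A_skewered D" using D c unfolding A_skewered_def by (rule bexI)
    moreover have "\<not> skewered ?e (V - D)"
    proof
      assume "skewered ?e (V - D)"
      then have "skewered ?c (V - D)" by (rule skewered_pow[OF e _ N_pos])
      then show False using D ev_disjoint[of ?c D] unfolding skewered_def by simp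
    qed
    ultimately show ?thesis using sk by blast
  qed
  have "axial ?c" unfolding axial_def
  proof (intro conjI allI ballI impI)
    show "?c \<in> A" by (rule c)
    show "skewered ?c D \<or> skewered ?c (V - D)" if "A_skewered D" for D
      using sk[OF that] skewered_pow[OF e _ N_pos] by blast
    show "\<phi> ?c y \<in> D" if "skewered ?c D" "y \<in> Y" "y \<in> D" for D y
      using core_skewered[OF Y_core[OF that(2)] e undo[OF that(1)] that(3)] .
    show "pull ?c D = D" if D: "D \<in> Q_walls" for D
    proof -
      have "pull (?e [^] (1::int)) D = D" using k(2) D e by simp
      from periodic_multiple[OF e Q_walls_HH[OF D] this, of "nat N"] show ?thesis using N_pos by simp
    qed
  qed
  then show ?thesis ..
qed

lemma axial_inv:
  assumes "axial c"
  shows "axial (inv c)"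
  unfolding axial_def
proof (intro conjI allI ballI impI)
  note ax = axialD[OF assms]
  show "inv c \<in> A" using ax(1) by simp
  show "skewered (inv c) D \<or> skewered (inv c) (V - D)" if "A_skewered D" for D
    using ax(2)[OF that] skewered_inv[OF ax(1), of D] skewered_inv[OF ax(1), of "V - D"]
      compl_compl[OF A_skewered_HH[OF that]] by auto
  show "\<phi> (inv c) y \<in> D" if "skewered (inv c) D" "y \<in> Y" "y \<in> D" for D y
  proof (rule ccontr)
    assume n: "\<phi> (inv c) y \<notin> D"
    have "skewered c (V - D)" using skewered_inv[OF A_closed(2)[OF ax(1)] that(1)] ax(1) by simp
    moreover have "\<phi> (inv c) y \<in> Y" using Y_act that(2) ax(1) by simp
    moreover have "\<phi> (inv c) y \<in> V - D" using n Y_V[OF \<open>\<phi> (inv c) y \<in> Y\<close>] by simp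
    ultimately have "\<phi> c (\<phi> (inv c) y) \<in> V - D" by (rule ax(3))
    then show False using that(3) ax(1) Y_V[OF that(2)] by simp
  qed
  show "pull (inv c) D = D" if "D \<in> Q_walls" for D
    using pull_inv(2)[of c D] ax(4)[OF that] ax(1) Q_walls_HH[OF that] by simp
qed

abbreviation flat :: "'x \<Rightarrow> 'x set" where
  "flat b \<equiv> fibre (T_walls \<union> Q_walls) b"

abbreviation flat_alg :: "'x \<Rightarrow> 'x med_alg" where
  "flat_alg b \<equiv> alg (flat b)"

lemma flat_Y: "y \<in> flat b \<Longrightarrow> y \<in> Y"
  unfolding fibre_def by simp

lemma flat_V: "y \<in> flat b \<Longrightarrow> y \<in> V"
  using flat_Y Y_V by simp

lemma base_flat: "b \<in> Y \<Longrightarrow> b \<in> flat b"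
  unfolding fibre_def by (simp add: agree_refl)

lemma flat_median: "b \<in> Y \<Longrightarrow> x \<in> flat b \<Longrightarrow> y \<in> flat b \<Longrightarrow> z \<in> flat b \<Longrightarrow> m x y z \<in> flat b"
  using fibre_median T_walls_HH Q_walls_HH' by simp

lemma flat_act:
  assumes c: "axial c" and y: "y \<in> flat b"
  shows "\<phi> c y \<in> flat b"
proof -
  note ax = axialD[OF c] and yY = flat_Y[OF y]
  have "agree Q_walls (\<phi> c y) y" unfolding agree_def
    using ax(4) mem_pull[OF Y_V[OF yY], of c] by auto
  then have "agree (T_walls \<union> Q_walls) (\<phi> c y) y" using A_agree_T_walls[OF ax(1) yY] unfolding agree_Un by simp
  moreover have "agree (T_walls \<union> Q_walls) y b" using y unfolding fibre_def by simp
  ultimately show ?thesis using Y_act[OF _ yY, of c] ax(1) agree_trans unfolding fibre_def by simp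
qed

lemma flat_pw:
  assumes "axial c" "y \<in> flat b"
  shows "pw c n y \<in> flat b"
proof -
  have nat: "pw c (int k) y \<in> flat b" if "axial c" for k c
  proof (induction k)
    case 0
    then show ?case using assms(2) flat_V by simp
  next
    case (Suc k)
    have "pw c (int (Suc k)) y = \<phi> c (pw c (int k) y)"
      using pw_add[OF axialD(1)[OF that] flat_V[OF assms(2)], of 1 "int k"] axialD(1)[OF that] by simp
    then show ?case using flat_act[OF that Suc] by simp
  qed
  show ?thesis
  proof (cases n rule: int_cases2)
    case (nonneg k)
    then show ?thesis using nat[OF assms(1)] by simp
  next
    case (nonpos k)
    then show ?thesis using nat[OF axial_inv[OF assms(1)], of k] pw_inv[OF axialD(1)[OF assms(1)], of "int k" y] by simp
  qed
qed

lemma flat_mono: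
  assumes c: "axial c" and D: "skewered c D" and y: "y \<in> flat b" and "i \<le> j" "pw c i y \<in> D"
  shows "pw c j y \<in> D"
  using assms(4,5)
proof (induction j rule: int_ge_induct)
  case (step j)
  have "pw c (j + 1) y = \<phi> c (pw c j y)"
    using pw_add[OF axialD(1)[OF c] flat_V[OF y], of 1 j] axialD(1)[OF c] by (simp add: add.commute)
  then show ?case using axialD(3)[OF c D flat_Y[OF flat_pw[OF c y]]] step by simp
qed simp

lemma flat_separation:
  assumes c: "axial c" and x: "x \<in> flat b" and y: "y \<in> flat b" and "x \<noteq> y"
  shows "\<exists>D. skewered c D \<and> (x \<in> D \<longleftrightarrow> y \<notin> D)"
proof -
  have "\<not> agree F_walls x y" using fibre_eqI[OF complementary_factors(2) x y] assms(4) by blast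
  then obtain D where D: "A_skewered D" "x \<in> D \<longleftrightarrow> y \<notin> D" unfolding agree_def F_walls_def by blast
  show ?thesis
  proof (cases "skewered c D")
    case False
    then have "skewered c (V - D)" using axialD(2)[OF c D(1)] by simp
    moreover have "x \<in> V - D \<longleftrightarrow> y \<notin> V - D" using D(2) flat_V[OF x] flat_V[OF y] by simp
    ultimately show ?thesis by blast
  qed (use D in blast)
qed

lemma flat_median_eqI:
  assumes c: "axial c" and b: "b \<in> Y" and xyz: "x \<in> flat b" "y \<in> flat b" "z \<in> flat b"
    and D: "\<And>D. skewered c D \<Longrightarrow> (x \<in> D \<and> y \<in> D \<longrightarrow> z \<in> D) \<and> (z \<in> D \<longrightarrow> x \<in> D \<or> y \<in> D)"
  shows "m x y z = z"
proof (rule ccontr)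
  assume "m x y z \<noteq> z"
  then obtain D where *: "skewered c D" "m x y z \<in> D \<longleftrightarrow> z \<notin> D"
    using flat_separation[OF c flat_median[OF b xyz] xyz(3)] by blast
  then have "D \<in> HH" unfolding skewered_def by simp
  from HH_majority[OF this flat_V[OF xyz(1)] flat_V[OF xyz(2)] flat_V[OF xyz(3)]] D[OF *(1)] *(2)
  show False by argo
qed

text \<open>The orbit of \<open>b\<close> is monotone for every skewered halfspace, and these
  separate the points of the flat.\<close>

lemma axis_geodesic:
  assumes c: "axial c" and b: "b \<in> Y" and "i \<le> j" "j \<le> k"
  shows "m (pw c i b) (pw c k b) (pw c j b) = pw c j b"
proof -
  note bf = base_flat[OF b]
  show ?thesis
    by (rule flat_median_eqI[OF c b flat_pw[OF c bf] flat_pw[OF c bf] flat_pw[OF c bf]])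
      (use flat_mono[OF c _ bf] assms in blast)
qed

text \<open>By \<open>push\<close> and \<open>push_back\<close>, for all large \<open>n\<close> a
  skewered halfspace that contains \<open>z\<close> contains the forward point, and one that misses
  \<open>z\<close> misses the backward point. So the majority is with \<open>z\<close>.\<close>

lemma axis_spans:
  assumes c: "axial c" and b: "b \<in> Y" and z: "z \<in> flat b"
  shows "\<exists>N\<ge>0. \<forall>n\<ge>N. m (pw c (- n) b) (pw c n b) z = z"
proof -
  note bf = base_flat[OF b] and cA = axialD(1)[OF c]
  obtain N where N: "N \<ge> 0" "\<forall>n\<ge>N. \<forall>D. skewered c D \<and> z \<in> D \<longrightarrow> pw c n b \<in> D"
    using push[OF cA flat_V[OF z] flat_V[OF bf]] by blast
  obtain M where M: "M \<ge> 0" "\<forall>n\<ge>M. \<forall>D. skewered c D \<and> z \<notin> D \<longrightarrow> pw c (- n) b \<notin> D"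
    using push_back[OF cA flat_V[OF z] flat_V[OF bf]] by blast
  have "m (pw c (- n) b) (pw c n b) z = z" if n: "n \<ge> max N M" for n
  proof (rule flat_median_eqI[OF c b flat_pw[OF c bf] flat_pw[OF c bf] z])
    fix D assume D: "skewered c D"
    have "n \<ge> N" "n \<ge> M" using n by simp_all
    then have "z \<in> D \<Longrightarrow> pw c n b \<in> D" "z \<notin> D \<Longrightarrow> pw c (- n) b \<notin> D" using N(2) M(2) D by blast+
    then show "(pw c (- n) b \<in> D \<and> pw c n b \<in> D \<longrightarrow> z \<in> D) \<and> (z \<in> D \<longrightarrow> pw c (- n) b \<in> D \<or> pw c n b \<in> D)"
      by argo
  qed
  moreover have "max N M \<ge> 0" using N(1) by simp
  ultimately show ?thesis by blast
qed

section \<open>The two ends of the flat\<close>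

lemma halfspace_alg:
  assumes "D \<in> halfspaces (alg K)"
  shows "D \<subseteq> K" "K - D \<in> halfspaces (alg K)"
    "x \<in> D \<Longrightarrow> y \<in> D \<Longrightarrow> z \<in> K \<Longrightarrow> m x y z = z \<Longrightarrow> z \<in> D"
proof -
  have h: "med_convex (alg K) D" "med_convex (alg K) (K - D)" "D \<noteq> {}" "K - D \<noteq> {}"
    using assms unfolding halfspaces_def by simp_all
  then show sub: "D \<subseteq> K" unfolding med_convex_def by simp
  have "K - (K - D) = D" using sub by blast
  then show "K - D \<in> halfspaces (alg K)"
    unfolding halfspaces_def using h by (simp only: mem_Collect_eq alg_simps) simp
  show "x \<in> D \<Longrightarrow> y \<in> D \<Longrightarrow> z \<in> K \<Longrightarrow> m x y z = z \<Longrightarrow> z \<in> D"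
    using h(1) unfolding med_convex_def med_interval_def by auto
qed

lemma trace_halfspace:
  assumes D: "D \<in> HH" and K: "K \<subseteq> V" and xy: "x \<in> K" "x \<in> D" "y \<in> K" "y \<notin> D"
  shows "D \<inter> K \<in> halfspaces (alg K)"
proof -
  have "med_convex (alg K) (E \<inter> K)" if E: "E \<in> HH" for E
    unfolding med_convex_def
  proof (intro conjI ballI subsetI)
    fix x y z assume x: "x \<in> E \<inter> K" and y: "y \<in> E \<inter> K" and "z \<in> med_interval (alg K) x y"
    then have z: "z \<in> K" "m x y z = z" unfolding med_interval_def by simp_all
    have "m x y z \<in> E" using HH_majority[OF E, of x y z] x y z(1) K by blast
    then show "z \<in> E \<inter> K" using z by simp
  qed simp
  from this[OF D] this[OF HH_compl[OF D]]
  have "med_convex (alg K) (D \<inter> K)" "med_convex (alg K) ((V - D) \<inter> K)" .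
  moreover have "(V - D) \<inter> K = K - D \<inter> K" using K by blast
  ultimately show ?thesis using xy unfolding halfspaces_def by auto
qed

lemma trace_skewered:
  assumes c: "axial c" and b: "b \<in> Y" and D: "skewered c D"
  shows "D \<inter> flat b \<in> halfspaces (flat_alg b)"
proof -
  obtain j where j: "pw c j b \<notin> D" "pw c (j + 1) b \<in> D"
    using skewered_cross[OF axialD(1)[OF c] D Y_V[OF b]] by blast
  have "D \<in> HH" using D unfolding skewered_def by simp
  then show ?thesis
    by (rule trace_halfspace[OF _ _ flat_pw[OF c base_flat[OF b]] j(2) flat_pw[OF c base_flat[OF b]] j(1)])
      (use flat_V in blast)
qed

text \<open>The limit of the forward orbit of \<open>b\<close> in the Roller compactification;
  \<open>endpoint (inv c) b\<close> is the backward limit.\<close>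

definition endpoint :: "'a \<Rightarrow> 'x \<Rightarrow> 'x set set" where
  "endpoint c b = {D \<in> halfspaces (flat_alg b). \<exists>N::int. \<forall>n\<ge>N. pw c n b \<in> D}"

text \<open>Halfspaces of the flat are not known here to be traces of members of \<open>HH\<close>,
  so \<open>ev\<close> is of no use. Instead, convexity forbids the axis, which is geodesic, to
  leave a halfspace and return to it.\<close>

lemma endpoint_total:
  assumes c: "axial c" and b: "b \<in> Y" and D: "D \<in> halfspaces (flat_alg b)"
  shows "D \<in> endpoint c b \<longleftrightarrow> flat b - D \<notin> endpoint c b"
proof -
  note Z = flat_pw[OF c base_flat[OF b]]
  have "\<not> (D \<in> endpoint c b \<and> flat b - D \<in> endpoint c b)"
  proof
    assume "D \<in> endpoint c b \<and> flat b - D \<in> endpoint c b"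
    then obtain N M where N: "\<forall>n\<ge>N. pw c n b \<in> D" and M: "\<forall>n\<ge>M. pw c n b \<in> flat b - D"
      unfolding endpoint_def by blast
    have "pw c (max N M) b \<in> D" by (rule N[rule_format]) simp
    moreover have "pw c (max N M) b \<in> flat b - D" by (rule M[rule_format]) simp
    ultimately show False by simp
  qed
  moreover have "D \<in> endpoint c b \<or> flat b - D \<in> endpoint c b"
  proof (rule ccontr)
    assume n: "\<not> (D \<in> endpoint c b \<or> flat b - D \<in> endpoint c b)"
    have out: "\<exists>n\<ge>N. pw c n b \<notin> D" for N using n D unfolding endpoint_def by blast
    have inn: "\<exists>n\<ge>N. pw c n b \<in> D" for N
      using n halfspace_alg(2)[OF D] Z unfolding endpoint_def by blast
    obtain i where i: "pw c i b \<in> D" using inn by blast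
    obtain j where j: "j \<ge> i" "pw c j b \<notin> D" using out by blast
    obtain k where k: "k \<ge> j" "pw c k b \<in> D" using inn by blast
    show False using halfspace_alg(3)[OF D i k(2) Z axis_geodesic[OF c b j(1) k(1)]] j(2) by simp
  qed
  ultimately show ?thesis by blast
qed

lemma orientationI:
  assumes "\<sigma> \<subseteq> halfspaces (alg K)"
    and "\<And>D. D \<in> halfspaces (alg K) \<Longrightarrow> D \<in> \<sigma> \<longleftrightarrow> K - D \<notin> \<sigma>"
    and "\<And>D E. D \<in> \<sigma> \<Longrightarrow> E \<in> halfspaces (alg K) \<Longrightarrow> D \<subseteq> E \<Longrightarrow> E \<in> \<sigma>"
  shows "orientation (alg K) \<sigma>"
  unfolding orientation_def
proof (intro conjI ballI impI)
  fix W assume "W \<in> walls (alg K)"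
  then obtain D where D: "D \<in> halfspaces (alg K)" "W = {D, K - D}" unfolding walls_def by auto
  show "\<exists>!D. D \<in> W \<and> D \<in> \<sigma>"
  proof (cases "D \<in> \<sigma>")
    case True
    then show ?thesis using assms(2)[OF D(1)] unfolding D(2) by (intro ex1I[of _ D]) auto
  next
    case False
    then show ?thesis using assms(2)[OF D(1)] unfolding D(2) by (intro ex1I[of _ "K - D"]) auto
  qed
qed (use assms in blast)+

lemma orientation_endpoint:
  assumes c: "axial c" and b: "b \<in> Y"
  shows "orientation (flat_alg b) (endpoint c b)"
proof (rule orientationI)
  show "endpoint c b \<subseteq> halfspaces (flat_alg b)" unfolding endpoint_def by blast
  show "D \<in> endpoint c b \<longleftrightarrow> flat b - D \<notin> endpoint c b" if "D \<in> halfspaces (flat_alg b)" for D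
    by (rule endpoint_total[OF c b that])
  show "E \<in> endpoint c b" if "D \<in> endpoint c b" "E \<in> halfspaces (flat_alg b)" "D \<subseteq> E" for D E
    using that unfolding endpoint_def by blast
qed

lemma orientation_principal:
  assumes "z \<in> K"
  shows "orientation (alg K) (principal_orientation (alg K) z)"
  by (rule orientationI) (use assms halfspace_alg(2) in \<open>auto simp: principal_orientation_def\<close>)

text \<open>Some translate of \<open>D0\<close> avoids \<open>z\<close>, but like every halfspace
  skewered by \<open>c\<close> it contains the forward end.\<close>

lemma endpoint_not_principal:
  assumes c: "axial c" and b: "b \<in> Y" and D0: "skewered c D0" and z: "z \<in> flat b"
  shows "endpoint c b \<noteq> principal_orientation (flat_alg b) z"
proof -
  note cA = axialD(1)[OF c] and zV = flat_V[OF z]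
  obtain j where j: "pw c j z \<notin> D0" using skewered_cross[OF cA D0 zV] by blast
  let ?D = "pull (c [^] j) D0"
  have D: "skewered c ?D" using skewered_pull[OF cA _ D0] cA by simp
  have zD: "z \<notin> ?D" using j zV by simp
  have "\<exists>N. \<forall>n\<ge>N. pw c n b \<in> ?D" using D Y_V[OF b] unfolding skewered_def ev_def by blast
  then obtain N where N: "\<forall>n\<ge>N. pw c n b \<in> ?D" ..
  have "\<forall>n\<ge>N. pw c n b \<in> ?D \<inter> flat b" using N flat_pw[OF c base_flat[OF b]] by simp
  then have "?D \<inter> flat b \<in> endpoint c b" using trace_skewered[OF c b D] unfolding endpoint_def by blast
  moreover have "?D \<inter> flat b \<notin> principal_orientation (flat_alg b) z"
    using zD unfolding principal_orientation_def by simp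
  ultimately show ?thesis by metis
qed

lemma endpoint_boundary:
  assumes "axial c" "b \<in> Y" "skewered c D0"
  shows "endpoint c b \<in> roller_boundary (flat_alg b)"
  using orientation_endpoint[OF assms(1,2)] endpoint_not_principal[OF assms]
  unfolding roller_boundary_def roller_compactification_def by auto

text \<open>A halfspace that contains both ends contains \<open>z\<close> by
  \<open>axis_spans\<close>. Applied to complements, this shows that a halfspace containing
  \<open>z\<close> contains at least one end.\<close>

lemma flat_between_endpoints:
  assumes c: "axial c" and b: "b \<in> Y" and z: "z \<in> flat b"
  shows "principal_orientation (flat_alg b) z
    \<in> med_interval (roller_compactification (flat_alg b)) (endpoint (inv c) b) (endpoint c b)"
proof -
  let ?s = "principal_orientation (flat_alg b) z" and ?p = "endpoint (inv c) b" and ?q = "endpoint c b"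
  note cA = axialD(1)[OF c] and ci = axial_inv[OF c]
  have both: "z \<in> D" if D: "D \<in> ?p" "D \<in> ?q" for D
  proof -
    have Dh: "D \<in> halfspaces (flat_alg b)" using D unfolding endpoint_def by simp
    obtain N where N: "\<forall>n\<ge>N. pw c n b \<in> D" using D(2) unfolding endpoint_def by blast
    obtain M where M: "\<forall>n\<ge>M. pw (inv c) n b \<in> D" using D(1) unfolding endpoint_def by blast
    obtain R where R: "\<forall>n\<ge>R. m (pw c (- n) b) (pw c n b) z = z" using axis_spans[OF c b z] by blast
    let ?n = "max R (max N M)"
    have "pw c ?n b \<in> D" by (rule N[rule_format]) simp
    moreover have "pw (inv c) ?n b \<in> D" by (rule M[rule_format]) simp
    then have "pw c (- ?n) b \<in> D" using pw_inv[OF cA] by simp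
    moreover have "m (pw c (- ?n) b) (pw c ?n b) z = z" by (rule R[rule_format]) simp
    ultimately show ?thesis using halfspace_alg(3)[OF Dh _ _ z] by blast
  qed
  have "?p \<inter> ?q \<union> ?q \<inter> ?s \<union> ?p \<inter> ?s = ?s"
  proof
    show "?p \<inter> ?q \<union> ?q \<inter> ?s \<union> ?p \<inter> ?s \<subseteq> ?s"
      using both unfolding principal_orientation_def endpoint_def by blast
    show "?s \<subseteq> ?p \<inter> ?q \<union> ?q \<inter> ?s \<union> ?p \<inter> ?s"
    proof
      fix D assume Ds: "D \<in> ?s"
      then have D: "D \<in> halfspaces (flat_alg b)" "z \<in> D" unfolding principal_orientation_def by simp_all
      have "D \<in> ?p \<or> D \<in> ?q"
      proof (rule ccontr)
        assume "\<not> (D \<in> ?p \<or> D \<in> ?q)"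
        then have "flat b - D \<in> ?p" "flat b - D \<in> ?q"
          using endpoint_total[OF c b D(1)] endpoint_total[OF ci b D(1)] by simp_all
        from both[OF this] show False using D(2) by simp
      qed
      then show "D \<in> ?p \<inter> ?q \<union> ?q \<inter> ?s \<union> ?p \<inter> ?s" using Ds by blast
    qed
  qed
  then show ?thesis
    using orientation_principal[OF z] unfolding med_interval_def roller_compactification_def by simp
qed

text \<open>A point of the interval shares the side of \<open>x\<close> and \<open>y\<close> for
  every halfspace that does not separate them, so its sides for the finitely many others determine
  it.\<close>

lemma med_discrete_alg:
  assumes K: "K \<subseteq> V"
  shows "med_discrete (alg K)"
  unfolding med_discrete_def
proof (intro ballI)
  fix x y assume "x \<in> carrier (alg K)" "y \<in> carrier (alg K)"
  then have xy: "x \<in> V" "y \<in> V" using K by auto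
  let ?P = "{D \<in> HH. x \<in> D \<and> y \<notin> D} \<union> {D \<in> HH. y \<in> D \<and> x \<notin> D}"
  let ?I = "med_interval (alg K) x y"
  have I: "z \<in> V" "m x y z = z" if "z \<in> ?I" for z using that K unfolding med_interval_def by auto
  show "finite ?I"
  proof (rule finite_imageD)
    have "(\<lambda>z. {D \<in> ?P. z \<in> D}) ` ?I \<subseteq> Pow ?P" by blast
    moreover have "finite (Pow ?P)" using HH_finite[OF xy] HH_finite[OF xy(2,1)] by simp
    ultimately show "finite ((\<lambda>z. {D \<in> ?P. z \<in> D}) ` ?I)" by (rule finite_subset)
    show "inj_on (\<lambda>z. {D \<in> ?P. z \<in> D}) ?I"
    proof (rule inj_onI)
      fix z w assume z: "z \<in> ?I" and w: "w \<in> ?I" and eq: "{D \<in> ?P. z \<in> D} = {D \<in> ?P. w \<in> D}"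
      show "z = w"
      proof (rule V_eqI[OF I(1)[OF z] I(1)[OF w]])
        fix D assume D: "D \<in> HH"
        have "D \<in> ?P \<Longrightarrow> z \<in> D \<longleftrightarrow> w \<in> D" using eq by blast
        moreover have "D \<in> ?P \<or> (x \<in> D \<longleftrightarrow> y \<in> D)" using D by blast
        ultimately show "z \<in> D \<longleftrightarrow> w \<in> D"
          using HH_majority[OF D xy I(1)[OF z]] HH_majority[OF D xy I(1)[OF w]] I(2)[OF z] I(2)[OF w] by argo
      qed
    qed
  qed
qed

text \<open>Only one wall separates \<open>x\<close> from \<open>y\<close>, so the traces of
  \<open>D\<close> and \<open>E\<close> are equal or complementary, and both halfspaces divide
  \<open>K\<close> relative to \<open>x\<close> in the same way.\<close>

lemma wall_adj_unique:
  assumes adj: "wall_adj (alg K) x y"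
    and D: "D \<inter> K \<in> halfspaces (alg K)" "x \<in> D \<longleftrightarrow> y \<notin> D"
    and E: "E \<inter> K \<in> halfspaces (alg K)" "x \<in> E \<longleftrightarrow> y \<notin> E"
    and xyw: "x \<in> K" "y \<in> K" "w \<in> K"
  shows "(w \<in> D \<longleftrightarrow> x \<in> D) \<longleftrightarrow> (w \<in> E \<longleftrightarrow> x \<in> E)"
proof -
  have sep: "{D \<inter> K, K - D \<inter> K} \<in> walls (alg K) \<and> wall_separates {D \<inter> K, K - D \<inter> K} x y"
    if "D \<inter> K \<in> halfspaces (alg K)" "x \<in> D \<longleftrightarrow> y \<notin> D" for D
    using that xyw unfolding walls_def wall_separates_def by auto
  have "{D \<inter> K, K - D \<inter> K} = {E \<inter> K, K - E \<inter> K}"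
    using adj sep[OF D] sep[OF E] unfolding wall_adj_def by blast
  then have "D \<inter> K = E \<inter> K \<or> D \<inter> K = K - E \<inter> K" by blast
  then show ?thesis
  proof
    assume "D \<inter> K = E \<inter> K"
    then have "v \<in> D \<longleftrightarrow> v \<in> E" if "v \<in> K" for v using that by blast
    then show ?thesis using xyw by simp
  next
    assume "D \<inter> K = K - E \<inter> K"
    then have "v \<in> D \<longleftrightarrow> v \<notin> E" if "v \<in> K" for v using that by blast
    then show ?thesis using xyw by simp
  qed
qed

lemma flat_nested:
  assumes c: "axial c" and T: "skewered c T" and ij: "i \<le> j" and y: "y \<in> flat b"
    and "y \<in> pull (c [^] (i :: int)) T"
  shows "y \<in> pull (c [^] j) T"
  using flat_mono[OF c T y ij] assms(5) flat_V[OF y] by simp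

text \<open>
  Neighbours of a vertex in a common cube are separated from it by pairwise transverse walls,
  while the translates of a wall under \<open>c\<close> are nested; there are finitely many translation classes.
\<close>

lemma finite_dimensional_flat:
  assumes c: "axial c" and b: "b \<in> Y"
  shows "finite_dimensional (cubulation (flat_alg b))"
proof -
  note cA = axialD(1)[OF c] and bV = Y_V[OF b]
  \<comment> \<open>Every halfspace skewered by \<open>c\<close> has a translate by a power of
    \<open>c\<close> in \<open>?R\<close>.\<close>
  let ?R = "{D \<in> HH. \<phi> c b \<in> D \<and> b \<notin> D}"
  have fR: "finite ?R" using HH_finite bV cA by simp
  have dim: "n \<le> 2 * card ?R"
    if C: "C \<subseteq> flat b" and f: "bij_betw f (Pow {..<n}) C"
      and adj: "\<And>S T. S \<in> Pow {..<n} \<Longrightarrow> T \<in> Pow {..<n} \<Longrightarrow>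
        wall_adj (flat_alg b) (f S) (f T) \<longleftrightarrow> card ((S - T) \<union> (T - S)) = 1"
    for C n and f :: "nat set \<Rightarrow> 'x"
  proof (rule ccontr)
    assume big: "\<not> n \<le> 2 * card ?R"
    let ?z = "f {}"
    have fK: "f S \<in> flat b" if "S \<subseteq> {..<n}" for S using bij_betwE[OF f] that C by blast
    have z: "?z \<in> flat b" using fK by simp
    have w: "f {i} \<in> flat b" if "i < n" for i using fK that by simp
    have ne: "f {i} \<noteq> f S" if "i < n" "S \<subseteq> {..<n}" "S \<noteq> {i}" for i S
      using inj_onD[OF bij_betw_imp_inj_on[OF f], of "{i}" S] that by auto
    have za: "wall_adj (flat_alg b) ?z (f {i})" if "i < n" for i using adj[of "{}" "{i}"] that by simp
    have "\<exists>E j. skewered c E \<and> (?z \<in> E \<longleftrightarrow> f {i} \<notin> E) \<and> pull (c [^] (j::int)) E \<in> ?R" if i: "i < n" for i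
    proof -
      have "?z \<noteq> f {i}" using ne[OF i, of "{}"] by simp
      then obtain E where E: "skewered c E" "?z \<in> E \<longleftrightarrow> f {i} \<notin> E"
        using flat_separation[OF c z w[OF i]] by blast
      obtain j where j: "pw c j b \<notin> E" "pw c (j + 1) b \<in> E" using skewered_cross[OF cA E(1) bV] by blast
      have "E \<in> HH" using E(1) unfolding skewered_def by simp
      then have "pull (c [^] j) E \<in> ?R" using j cA bV pw_add[OF cA bV, of j 1] by simp
      then show ?thesis using E by blast
    qed
    then have "\<forall>i. \<exists>E j. i < n \<longrightarrow> skewered c E \<and> (?z \<in> E \<longleftrightarrow> f {i} \<notin> E) \<and> pull (c [^] (j::int)) E \<in> ?R"
      by blast
    then obtain E where "\<forall>i. \<exists>j. i < n \<longrightarrow>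
      skewered c (E i) \<and> (?z \<in> E i \<longleftrightarrow> f {i} \<notin> E i) \<and> pull (c [^] (j::int)) (E i) \<in> ?R"
      by (rule choice[THEN exE])
    then obtain j :: "nat \<Rightarrow> int" where "\<forall>i. i < n \<longrightarrow>
      skewered c (E i) \<and> (?z \<in> E i \<longleftrightarrow> f {i} \<notin> E i) \<and> pull (c [^] j i) (E i) \<in> ?R"
      by (rule choice[THEN exE])
    then have E: "\<And>i. i < n \<Longrightarrow> skewered c (E i)"
      "\<And>i. i < n \<Longrightarrow> ?z \<in> E i \<longleftrightarrow> f {i} \<notin> E i" "\<And>i. i < n \<Longrightarrow> pull (c [^] j i) (E i) \<in> ?R"
      by simp_all
    \<comment> \<open>A neighbour of \<open>?z\<close> is coloured by the translation class of its
      wall and by the side of \<open>?z\<close>, which accounts for the bound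
      \<open>2 * card ?R\<close>.\<close>
    let ?col = "\<lambda>i. (pull (c [^] j i) (E i), ?z \<in> E i)"
    have "\<not> inj_on ?col {..<n}"
    proof
      assume "inj_on ?col {..<n}"
      then have "card {..<n} \<le> card (?R \<times> (UNIV :: bool set))"
        by (rule card_inj_on_le) (use E(3) fR in auto)
      then show False using big by (simp add: card_cartesian_product)
    qed
    then obtain i k where ik: "i < n" "k < n" "i \<noteq> k" "pull (c [^] j i) (E i) = pull (c [^] j k) (E k)"
      "?z \<in> E i \<longleftrightarrow> ?z \<in> E k" unfolding inj_on_def by auto
    have tr: "D \<inter> flat b \<in> halfspaces (flat_alg b)" if "skewered c D" for D by (rule trace_skewered[OF c b that])
    \<comment> \<open>\<open>E i\<close> and \<open>E k\<close> are translates of one halfspace,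
      hence nested on the flat, with \<open>?z\<close> on the same side of both. So one of them
      separates \<open>?z\<close> from both neighbours, and uniqueness of the separating wall
      identifies their walls.\<close>
    have same: "(y \<in> E i \<longleftrightarrow> ?z \<in> E i) \<longleftrightarrow> (y \<in> E k \<longleftrightarrow> ?z \<in> E k)" if y: "y \<in> flat b" for y
    proof -
      let ?T = "pull (c [^] j i) (E i)"
      have T: "skewered c ?T" using skewered_pull[OF cA _ E(1)[OF ik(1)]] cA by simp
      have undo: "pull (c [^] (- l)) (pull (c [^] l) D) = D" if "D \<in> HH" for l :: int and D
        using pull_pw_add[OF cA, of "- l" l D] pull_one[OF that] by simp
      have H: "E i \<in> HH" "E k \<in> HH" using E(1) ik unfolding skewered_def by simp_all
      have Ei: "E i = pull (c [^] (- j i)) ?T" by (rule undo[OF H(1), symmetric])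
      have Ek: "E k = pull (c [^] (- j k)) ?T" unfolding ik(4) by (rule undo[OF H(2), symmetric])
      have nest: "(\<forall>y\<in>flat b. y \<in> E i \<longrightarrow> y \<in> E k) \<or> (\<forall>y\<in>flat b. y \<in> E k \<longrightarrow> y \<in> E i)"
      proof (cases "- j i \<le> - j k")
        case True
        then have "\<forall>y\<in>flat b. y \<in> pull (c [^] (- j i)) ?T \<longrightarrow> y \<in> pull (c [^] (- j k)) ?T"
          using flat_nested[OF c T] by blast
        then show ?thesis using Ei Ek by simp
      next
        case False
        then have "- j k \<le> - j i" by simp
        then have "\<forall>y\<in>flat b. y \<in> pull (c [^] (- j k)) ?T \<longrightarrow> y \<in> pull (c [^] (- j i)) ?T"
          using flat_nested[OF c T] by blast
        then show ?thesis using Ei Ek by simp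
      qed
      have zw: "?z \<in> E i \<longleftrightarrow> f {i} \<notin> E i" "?z \<in> E k \<longleftrightarrow> f {k} \<notin> E k" using E(2) ik by simp_all
      have "(?z \<in> E k \<longleftrightarrow> f {i} \<notin> E k) \<or> (?z \<in> E i \<longleftrightarrow> f {k} \<notin> E i)"
        using nest zw ik(5) w[OF ik(1)] w[OF ik(2)] by blast
      then show ?thesis
        using wall_adj_unique[OF za[OF ik(1)] tr[OF E(1)[OF ik(1)]] zw(1) tr[OF E(1)[OF ik(2)]] _ z w[OF ik(1)] y]
          wall_adj_unique[OF za[OF ik(2)] tr[OF E(1)[OF ik(1)]] _ tr[OF E(1)[OF ik(2)]] zw(2) z w[OF ik(2)] y]
        by blast
    qed
    \<comment> \<open>Both neighbours now lie across the same wall from \<open>?z\<close>. A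
      halfspace \<open>D\<close> between them separates \<open>?z\<close> from one of them and so
      has this very wall, which does not separate them.\<close>
    have "f {i} \<noteq> f {k}" using ne[OF ik(1), of "{k}"] ik by simp
    then obtain D where D: "skewered c D" "f {i} \<in> D \<longleftrightarrow> f {k} \<notin> D"
      using flat_separation[OF c w[OF ik(1)] w[OF ik(2)]] by blast
    have i': "f {i} \<in> E k \<longleftrightarrow> ?z \<notin> E k" using same[OF w[OF ik(1)]] E(2)[OF ik(1)] by blast
    have k': "f {k} \<in> E k \<longleftrightarrow> ?z \<notin> E k" using E(2)[OF ik(2)] by blast
    show False
    proof (cases "?z \<in> D \<longleftrightarrow> f {i} \<notin> D")
      case True
      have "(f {k} \<in> D \<longleftrightarrow> ?z \<in> D) \<longleftrightarrow> (f {k} \<in> E k \<longleftrightarrow> ?z \<in> E k)"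
        by (rule wall_adj_unique[OF za[OF ik(1)] tr[OF D(1)] True tr[OF E(1)[OF ik(2)]] _ z w[OF ik(1)] w[OF ik(2)]])
          (use i' in blast)
      then show False using True D(2) k' by blast
    next
      case False
      then have zD: "?z \<in> D \<longleftrightarrow> f {k} \<notin> D" using D(2) by blast
      have "(f {i} \<in> D \<longleftrightarrow> ?z \<in> D) \<longleftrightarrow> (f {i} \<in> E k \<longleftrightarrow> ?z \<in> E k)"
        by (rule wall_adj_unique[OF za[OF ik(2)] tr[OF D(1)] zD tr[OF E(1)[OF ik(2)]] _ z w[OF ik(2)] w[OF ik(1)]])
          (use k' in blast)
      then show False using zD D(2) i' by blast
    qed
  qed
  show ?thesis unfolding finite_dimensional_def
  proof (intro exI[of _ "2 * card ?R"] ballI)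
    fix C assume "C \<in> cubes (cubulation (flat_alg b))"
    then obtain n and f :: "nat set \<Rightarrow> 'x" where C: "C \<subseteq> flat b" "bij_betw f (Pow {..<n}) C"
      "\<forall>S\<in>Pow {..<n}. \<forall>T\<in>Pow {..<n}. wall_adj (flat_alg b) (f S) (f T) \<longleftrightarrow> card ((S - T) \<union> (T - S)) = 1"
      unfolding cubulation_def by auto
    have "n \<le> 2 * card ?R" by (rule dim[OF C(1,2)]) (use C(3) in simp)
    moreover have "card C = 2 ^ n" using bij_betw_same_card[OF C(2)] by (simp add: card_Pow)
    ultimately show "card C \<le> 2 ^ (2 * card ?R)" by (simp add: power_increasing)
  qed
qed

text \<open>A second point of the flat provides halfspaces skewered by \<open>c\<close> and by its
  inverse; these keep the two ends from being principal orientations.\<close>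

lemma flat_factor:
  assumes b: "b \<in> Y"
  shows "median_flat (flat_alg b) \<or> (\<exists>p. carrier (flat_alg b) = {p})"
proof (cases "\<exists>x\<in>flat b. x \<noteq> b")
  case False
  then have "flat b = {b}" using base_flat[OF b] by blast
  then show ?thesis by simp
next
  case True
  obtain c where c: "axial c" using exists_axial by blast
  note ci = axial_inv[OF c]
  obtain x where x: "x \<in> flat b" "x \<noteq> b" using True by blast
  obtain D where D: "skewered c D" using flat_separation[OF c x(1) base_flat[OF b] x(2)] by blast
  obtain D' where D': "skewered (inv c) D'" using flat_separation[OF ci x(1) base_flat[OF b] x(2)] by blast
  have "principal_orientation (flat_alg b) ` carrier (flat_alg b)
      \<subseteq> med_interval (roller_compactification (flat_alg b)) (endpoint (inv c) b) (endpoint c b)"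
    using flat_between_endpoints[OF c b] by auto
  then have "\<exists>\<zeta>\<in>roller_boundary (flat_alg b). \<exists>\<xi>\<in>roller_boundary (flat_alg b).
      principal_orientation (flat_alg b) ` carrier (flat_alg b)
        \<subseteq> med_interval (roller_compactification (flat_alg b)) \<zeta> \<xi>"
    using endpoint_boundary[OF ci b D'] endpoint_boundary[OF c b D] by blast
  moreover have "median_algebra (flat_alg b)" using median_algebra_fibre[OF _ b] T_walls_HH Q_walls_HH' by simp
  moreover have "carrier (flat_alg b) \<noteq> {}" using base_flat[OF b] by auto
  moreover have "flat b \<subseteq> V" using flat_V by blast
  then have "med_discrete (flat_alg b)" by (rule med_discrete_alg)
  ultimately have "median_flat (flat_alg b)"
    using finite_dimensional_flat[OF c b] unfolding median_flat_def by simp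
  then show ?thesis ..
qed


subsection \<open>The decomposition\<close>

definition factor_map :: "'x \<Rightarrow> 'x \<Rightarrow> 'x \<times> 'x \<times> 'x" where
  "factor_map b x = (proj T_walls (F_walls \<union> Q_walls) b x, proj F_walls (T_walls \<union> Q_walls) b x, proj Q_walls (T_walls \<union> F_walls) b x)"

lemma factor_map_iso:
  assumes b: "b \<in> Y"
  shows "factor_map b \<in> med_iso (alg Y) (alg (fibre (F_walls \<union> Q_walls) b) \<times>\<^sub>m alg (fibre (T_walls \<union> Q_walls) b) \<times>\<^sub>m alg (fibre (T_walls \<union> F_walls) b))"
proof -
  let ?T = "fibre (F_walls \<union> Q_walls) b" and ?F = "fibre (T_walls \<union> Q_walls) b" and ?Q = "fibre (T_walls \<union> F_walls) b"
  note cf = complementary_factors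
  note p1 = proj_props[OF cf(1) b] and p2 = proj_props[OF cf(2) b] and p3 = proj_props[OF cf(3) b]
  have inj: "inj_on (factor_map b) Y"
  proof (rule inj_onI)
    fix x y assume x: "x \<in> Y" and y: "y \<in> Y" and e: "factor_map b x = factor_map b y"
    have "agree T_walls x y" "agree F_walls x y" "agree Q_walls x y"
      using e p1(2)[OF x] p1(2)[OF y] p2(2)[OF x] p2(2)[OF y] p3(2)[OF x] p3(2)[OF y]
      unfolding factor_map_def agree_def by simp_all
    then show "x = y" by (rule Y_eqI[OF x y])
  qed
  have "factor_map b ` Y = ?T \<times> ?F \<times> ?Q"
  proof (intro subset_antisym subsetI)
    fix p assume "p \<in> factor_map b ` Y"
    then show "p \<in> ?T \<times> ?F \<times> ?Q" using p1(1) p2(1) p3(1) unfolding factor_map_def by auto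
  next
    fix p assume "p \<in> ?T \<times> ?F \<times> ?Q"
    then obtain t f q where p: "p = (t, f, q)" and t: "t \<in> ?T" and f: "f \<in> ?F" and q: "q \<in> ?Q" by auto
    have tY: "t \<in> Y" "f \<in> Y" "q \<in> Y" using t f q unfolding fibre_def by simp_all
    obtain w where w: "w \<in> Y" "agree T_walls w t" "agree F_walls w f" "agree Q_walls w q" using Y_product[OF tY] by blast
    have "factor_map b w = p"
      unfolding factor_map_def p
      using proj_eqI[OF cf(1) b w(1) t w(2)] proj_eqI[OF cf(2) b w(1) f w(3)] proj_eqI[OF cf(3) b w(1) q w(4)]
      by simp
    then show "p \<in> factor_map b ` Y" using w(1) by blast
  qed
  then have "bij_betw (factor_map b) Y (?T \<times> ?F \<times> ?Q)" using inj unfolding bij_betw_def by simp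
  moreover have "factor_map b (m x y z) = med (alg ?T \<times>\<^sub>m alg ?F \<times>\<^sub>m alg ?Q) (factor_map b x) (factor_map b y) (factor_map b z)"
    if "x \<in> Y" "y \<in> Y" "z \<in> Y" for x y z
    using proj_median[OF cf(1) b that] proj_median[OF cf(2) b that] proj_median[OF cf(3) b that]
    unfolding factor_map_def med_prod_def by simp
  ultimately show ?thesis unfolding med_iso_def by (simp add: med_prod_def)
qed

lemma factor_map_act:
  assumes b: "b \<in> Y" and g: "g \<in> carrier G" and y: "y \<in> Y" and e: "factor_map b y = (t, f, q)"
  shows "factor_map b (\<phi> g y) =
    (factor_act T_walls (F_walls \<union> Q_walls) b g t, factor_act F_walls (T_walls \<union> Q_walls) b g f, factor_act Q_walls (T_walls \<union> F_walls) b g q)"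
  using e factor_act_proj[OF complementary_factors(1) b g y] factor_act_proj[OF complementary_factors(2) b g y]
    factor_act_proj[OF complementary_factors(3) b g y]
  unfolding factor_map_def by auto

lemma A_trivial_on_T:
  assumes b: "b \<in> Y" and a: "a \<in> A" and t: "t \<in> fibre (F_walls \<union> Q_walls) b"
  shows "factor_act T_walls (F_walls \<union> Q_walls) b a t = t"
proof -
  have tY: "t \<in> Y" using t unfolding fibre_def by simp
  have "proj T_walls (F_walls \<union> Q_walls) b (\<phi> a t) = t"
    by (rule proj_eqI[OF complementary_factors(1) b Y_act[OF A_carrier[OF a] tY] t A_agree_T_walls[OF a tY]])
  then show ?thesis using t unfolding factor_act_def by simp
qed

end

theorem theorem1p4:
  fixes G :: "('g, 'b) monoid_scheme"
    and X :: "'x cube_complex"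
    and \<phi> :: "'g \<Rightarrow> 'x \<Rightarrow> 'x"
    and A :: "'g set"
  assumes "group G"
    and "CAT0_cube_complex X"
    and "cubical_action G X \<phi>"
    and "A \<lhd> G"
    and "fin_gen_abelian_subgroup A G"
  shows "\<exists>H Y (T :: 'x med_alg) (F :: 'x med_alg) (Q :: 'x med_alg) \<Theta> \<psi>\<^sub>T \<psi>\<^sub>F \<psi>\<^sub>Q.
    finite_index_subgroup H G \<and> A \<subseteq> H \<and>
    Y \<noteq> {} \<and> median_subalgebra Y (vertex_alg X) \<and> (\<forall>h\<in>H. \<phi> h ` Y = Y) \<and>
    median_algebra T \<and> median_algebra F \<and> median_algebra Q \<and>
    \<Theta> \<in> med_iso ((vertex_alg X)\<lparr>carrier := Y\<rparr>) (T \<times>\<^sub>m F \<times>\<^sub>m Q) \<and>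
    med_action (G\<lparr>carrier := H\<rparr>) T \<psi>\<^sub>T \<and>
    med_action (G\<lparr>carrier := H\<rparr>) F \<psi>\<^sub>F \<and>
    med_action (G\<lparr>carrier := H\<rparr>) Q \<psi>\<^sub>Q \<and>
    (\<forall>h\<in>H. \<forall>y\<in>Y. \<forall>t f q. \<Theta> y = (t, f, q) \<longrightarrow> \<Theta> (\<phi> h y) = (\<psi>\<^sub>T h t, \<psi>\<^sub>F h f, \<psi>\<^sub>Q h q)) \<and>
    (median_flat F \<or> (\<exists>p. carrier F = {p})) \<and>
    finite_dim_cube Q \<and>
    (\<forall>a\<in>A. \<forall>t\<in>carrier T. \<psi>\<^sub>T a t = t)"
proof -
  interpret cat0: cat0_complex X by unfold_locales (rule assms(2))
  interpret act: group_action G "verts X" \<phi> using assms(3) unfolding cubical_action_def by simp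
  obtain S where S: "finite S" "generate G S = A"
    using assms(5) unfolding fin_gen_abelian_subgroup_def by blast
  have comm: "a \<otimes>\<^bsub>G\<^esub> b = b \<otimes>\<^bsub>G\<^esub> a" if "a \<in> A" "b \<in> A" for a b
  proof -
    have "comm_group (G\<lparr>carrier := A\<rparr>)" using assms(5) unfolding fin_gen_abelian_subgroup_def by simp
    then have "comm_monoid (G\<lparr>carrier := A\<rparr>)" by (rule comm_group.axioms(1))
    from comm_monoid.m_comm[OF this, of a b] show ?thesis using that by simp
  qed
  interpret wall_action G "verts X" \<phi> "vertex_median X" "ghalfspaces X" A S
  proof (intro wall_action.intro wall_action_axioms.intro)
    show "verts X \<noteq> {}" using cat0.sc unfolding simply_connected_complex_def by simp
    show "vertex_median X x y z \<in> verts X" if "x \<in> verts X" "y \<in> verts X" "z \<in> verts X" for x y z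
      using cat0.vertex_median(1) that .
    show "D \<subseteq> verts X" if "D \<in> ghalfspaces X" for D using cat0.ghalfspace_subset that .
    show "verts X - D \<in> ghalfspaces X" if "D \<in> ghalfspaces X" for D using cat0.ghalfspace_compl that .
    show "vertex_median X x y z \<in> D \<longleftrightarrow> x \<in> D \<and> y \<in> D \<or> y \<in> D \<and> z \<in> D \<or> x \<in> D \<and> z \<in> D"
      if "D \<in> ghalfspaces X" "x \<in> verts X" "y \<in> verts X" "z \<in> verts X" for D x y z
      using cat0.vertex_median(2)[OF that(2-4,1)] .
    show "\<exists>D\<in>ghalfspaces X. x \<in> D \<and> y \<notin> D" if "x \<in> verts X" "y \<in> verts X" "x \<noteq> y" for x y
      using cat0.ghalfspace_separation that .
    show "finite {D \<in> ghalfspaces X. x \<in> D \<and> y \<notin> D}" if "x \<in> verts X" "y \<in> verts X" for x y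
      using cat0.finite_ghalfspace_separators that .
    show "{x \<in> verts X. \<phi> g x \<in> D} \<in> ghalfspaces X" if "g \<in> carrier G" "D \<in> ghalfspaces X" for g D
      using cat0.ghalfspace_pull[OF assms(3)] that .
  qed (use assms(4) comm S act.group_action_axioms in blast)+
  obtain y0 where y0: "y0 \<in> verts X" "\<And>a D. a \<in> A \<Longrightarrow> peripheral a D \<Longrightarrow> y0 \<in> D"
    using exists_core_point by blast
  obtain N where N: "N > 0" "\<forall>a\<in>A. \<forall>D. skewered a D \<and> y0 \<in> D \<longrightarrow> pw a N y0 \<in> D"
    using exists_uniform_exponent[OF y0(1)] by blast
  interpret core_action G "verts X" \<phi> "vertex_median X" "ghalfspaces X" A S y0 N
    by (intro core_action.intro core_action_axioms.intro wall_action_axioms) (use y0 N in auto)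
  obtain b where b: "b \<in> Y" using Y_nonempty by blast
  have H: "G\<lparr>carrier := carrier G\<rparr> = G" by simp
  have "rcosets\<^bsub>G\<^esub> carrier G \<subseteq> {carrier G}"
    unfolding RCOSETS_def using group.coset_join2[OF assms(1) _ group.subgroup_self[OF assms(1)]] by auto
  then have fi: "finite_index_subgroup (carrier G) G"
    unfolding finite_index_subgroup_def using group.subgroup_self[OF assms(1)] finite_subset by blast
  have invariant: "\<phi> h ` Y = Y" if h: "h \<in> carrier G" for h
  proof (intro subset_antisym subsetI)
    fix y assume y: "y \<in> Y"
    have "y = \<phi> h (\<phi> (inv\<^bsub>G\<^esub> h) y)" using h Y_V[OF y] by simp
    moreover have "\<phi> (inv\<^bsub>G\<^esub> h) y \<in> Y" using Y_act y h by simp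
    ultimately show "y \<in> \<phi> h ` Y" by (rule image_eqI)
  qed (use Y_act h in auto)
  have Y_alg: "(vertex_alg X)\<lparr>carrier := Y\<rparr> = alg Y" unfolding vertex_alg_def alg_def by simp
  let ?T = "alg (fibre (F_walls \<union> Q_walls) b)" and ?F = "flat_alg b" and ?Q = "alg (fibre (T_walls \<union> F_walls) b)"
  let ?t = "factor_act T_walls (F_walls \<union> Q_walls) b" and ?f = "factor_act F_walls (T_walls \<union> Q_walls) b" and ?q = "factor_act Q_walls (T_walls \<union> F_walls) b"
  show ?thesis
  proof (rule exI[of _ "carrier G"], rule exI[of _ Y], rule exI[of _ ?T], rule exI[of _ ?F], rule exI[of _ ?Q],
      rule exI[of _ "factor_map b"], rule exI[of _ ?t], rule exI[of _ ?f], rule exI[of _ ?q],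
      unfold H Y_alg, intro conjI)
    show "finite_index_subgroup (carrier G) G" by (rule fi)
    show "A \<subseteq> carrier G" using A_carrier by blast
    show "Y \<noteq> {}" by (rule Y_nonempty)
    show "median_subalgebra Y (vertex_alg X)"
      unfolding median_subalgebra_def vertex_alg_def using Y_V Y_median by auto
    show "\<forall>h\<in>carrier G. \<phi> h ` Y = Y" using invariant by blast
    show "median_algebra ?T" "median_algebra ?F" "median_algebra ?Q"
      using median_algebra_fibre[OF _ b] F_walls_HH T_walls_HH Q_walls_HH' by simp_all
    show "factor_map b \<in> med_iso (alg Y) (?T \<times>\<^sub>m ?F \<times>\<^sub>m ?Q)" by (rule factor_map_iso[OF b])
    show "med_action G ?T ?t" "med_action G ?F ?f" "med_action G ?Q ?q"
      using complementary_factors med_action_factor[OF _ b] by simp_all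
    show "\<forall>h\<in>carrier G. \<forall>y\<in>Y. \<forall>t f q. factor_map b y = (t, f, q) \<longrightarrow> factor_map b (\<phi> h y) = (?t h t, ?f h f, ?q h q)"
      using factor_map_act[OF b] by simp
    show "median_flat ?F \<or> (\<exists>p. carrier ?F = {p})" by (rule flat_factor[OF b])
    show "finite_dim_cube ?Q" by (rule cube_factor[OF b])
    show "\<forall>a\<in>A. \<forall>t\<in>carrier ?T. ?t a t = t" using A_trivial_on_T[OF b] by simp
  qed
qed

end
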